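(* Let $L$ be a positive-definite even lattice of rank $1$, $M$ the corresponding rank one Heisenberg vertex operator algebra, $N=M\otimes e^\beta$ with $\beta\in L$, and let $\alpha_1,\dots,\alpha_n\in L$ satisfy $\alpha_1+\dots+\alpha_n=0$. Then $$F_N(e^{\alpha_1},z_1;\dots;e^{\alpha_n},z_n;q)=\frac{q^{(\beta,\beta)/2}}{\eta(\tau)}\prod_{1\le r\le n}\exp((\beta,\alpha_r)z_r)\prod_{1\le i<j\le n}\epsilon(\alpha_i,\alpha_j)K(z_{ij},\tau)^{(\alpha_i,\alpha_j)},$$ where $z_{ij}=z_i-z_j$.
   Context: Lattice VOA. $\mathfrak{H}=\mathbb{C}\otimes_{\mathbb{Z}}L$, $V_L=M\otimes\mathbb{C}[L]=\bigoplus_{\alpha\in L}M\otimes e^\alpha$; $M$ is the Fock space of the Heisenberg algebra $[h(m),h'(n)]=(h,h')m\delta_{m,-n}$, with conformal vector $\omega=\frac12a(-1)^2\mathbf 1$ for $a\in\mathfrak{H}$, $(a,a)=1$, and central charge $c=1$. For $h\in\mathfrak{H}$: $Y(h,z)=\sum_nh(n)z^{-n-1}$ and $h(0)(u\otimes e^\gamma)=(h,\gamma)u\otimes e^\gamma$. Write $e^\alpha$ also for $\mathbf 1\otimes e^\alpha$. $Y(e^\alpha,z)=Y_-(e^\alpha,z)Y_+(e^\alpha,z)e^\alpha z^\alpha$, $Y_\pm(e^\alpha,z)=\exp(\mp\sum_{n>0}\frac{\alpha(\pm n)}{n}z^{\mp n})$, with operators $e^\alpha(u\otimes e^\gamma)=\epsilon(\alpha,\gamma)u\otimes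 e^{\alpha+\gamma}$, $z^\alpha(u\otimes e^\gamma)=z^{(\alpha,\gamma)}u\otimes e^\gamma$, where $\epsilon=\pm1$ satisfies $\epsilon(\alpha,\gamma+\delta)=\epsilon(\alpha,\gamma)\epsilon(\alpha,\delta)$ and the operators satisfy $e^\alpha e^\gamma=(-1)^{(\alpha,\gamma)}e^\gamma e^\alpha$. $n$-point function: $\tau$ in the upper half plane, $q=\exp(2\pi i\tau)$, $q_i=\exp(z_i)$, and $F_N(u_1,z_1;\dots;u_n,z_n;q)=Tr_N\,Y(q_1^{L(0)}u_1,q_1)\cdots Y(q_n^{L(0)}u_n,q_n)q^{L(0)-c/24}$ (the composite preserves $N$ because $\sum\alpha_i=0$). The coefficient of each power of $q$ is a rational function of the $q_i$; equivalently the trace converges for $|q_1|>\dots>|q_n|>|q\,q_1|$ and is identified with its meromorphic continuation. Functions. $\eta(\tau)=q^{1/24}\prod_{n\ge1}(1-q^n)$. For even $k\ge2$, $E_k(\tau)=-\frac{B_k}{k!}+\frac{2}{(k-1)!}\sum_{n\ge1}\sigma_{k-1}(n)q^n$ ($B_k$ Bernoulli numbers); $E_k=0$ for odd $k$. $K(z,\tau)=\exp(-P_0(z,\tau))$ with $P_0(z,\tau)=-\log z+\sum_{k\ge2}\frac1kE_k(\tau)z^k$; i.e. $K(z,\tau)=z\exp(-\sum_{k\ge2}\frac1kE_k(\tau)z^k)$, the genus one prime form, which extends to an entire function of $z$. *)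

theory Defs
  imports
    "HOL-Complex_Analysis.Complex_Analysis"
    "HOL-Computational_Algebra.Computational_Algebra"
    "HOL-Library.Multiset"
    "HOL-Library.Poly_Mapping"
begin

text \<open>
  The type \<open>'b \<Rightarrow>\<^sub>0 complex\<close> of finitely supported functions is the complex vector space with
  basis \<open>'b\<close>.
\<close>

definition smul :: "complex \<Rightarrow> ('b \<Rightarrow>\<^sub>0 complex) \<Rightarrow> ('b \<Rightarrow>\<^sub>0 complex)" where
  "smul c v = Poly_Mapping.map (\<lambda>x. c * x) v"

definition lin_ext :: "('b \<Rightarrow> ('c \<Rightarrow>\<^sub>0 complex)) \<Rightarrow> ('b \<Rightarrow>\<^sub>0 complex) \<Rightarrow> ('c \<Rightarrow>\<^sub>0 complex)" where
  "lin_ext f v = (\<Sum>b\<in>Poly_Mapping.keys v. smul (Poly_Mapping.lookup v b) (f b))"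

text \<open>
  The exponential \<open>v \<mapsto> \<Sum>k. T^k v / k!\<close> of an operator, computed coefficientwise.  It is meaningful
  for locally finite \<open>T\<close> (then the sum lies in a finite-dimensional subspace); it is used only for
  operators that are diagonal in the distinguished basis.
\<close>

definition exp_op :: "(('b \<Rightarrow>\<^sub>0 complex) \<Rightarrow> ('b \<Rightarrow>\<^sub>0 complex)) \<Rightarrow> ('b \<Rightarrow>\<^sub>0 complex) \<Rightarrow> ('b \<Rightarrow>\<^sub>0 complex)" where
  "exp_op T v = Abs_poly_mapping (\<lambda>b. suminf (\<lambda>k. Poly_Mapping.lookup ((T ^^ k) v) b / fact k))"

text \<open>
  For pairwise commuting operators \<open>X 1, X 2, \<dots>\<close>, the coefficient of \<open>x^k\<close> in
  \<open>exp (\<Sum>n>0. X n x^n) = \<Sum>j. (1/j!) \<Sum>n1,\<dots>,nj>0. X n1 \<cdots> X nj x^(n1+\<cdots>+nj)\<close>.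
\<close>

definition exp_series_coeff ::
    "(nat \<Rightarrow> ('b \<Rightarrow>\<^sub>0 complex) \<Rightarrow> ('b \<Rightarrow>\<^sub>0 complex)) \<Rightarrow> nat \<Rightarrow> ('b \<Rightarrow>\<^sub>0 complex) \<Rightarrow> ('b \<Rightarrow>\<^sub>0 complex)" where
  "exp_series_coeff X k v =
     (\<Sum>ns | sum_list ns = k \<and> 0 \<notin> set ns. smul (1 / fact (length ns)) (foldr X ns v))"

text \<open>A lattice is the whole of an abelian group type; rank one means isomorphic to the integers.\<close>

definition pos_def_even_lattice_rank_one :: "('l::ab_group_add \<Rightarrow> 'l \<Rightarrow> int) \<Rightarrow> bool" where
  "pos_def_even_lattice_rank_one B \<longleftrightarrow>
     (\<exists>\<phi> :: int \<Rightarrow> 'l. bij \<phi> \<and> (\<forall>m n. \<phi> (m + n) = \<phi> m + \<phi> n)) \<and>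
     (\<forall>x y. B x y = B y x) \<and>
     (\<forall>x y z. B (x + y) z = B x z + B y z) \<and>
     (\<forall>x. x \<noteq> 0 \<longrightarrow> B x x > 0) \<and>
     (\<forall>x. even (B x x))"

text \<open>
  Since \<open>L\<close> has rank one, every element of \<open>\<complex> \<otimes> L\<close> is a pure tensor; the pair \<open>(s, \<gamma>)\<close> stands for
  \<open>s \<otimes> \<gamma>\<close>, and \<open>\<alpha> \<in> L\<close> is identified with \<open>1 \<otimes> \<alpha>\<close>.

  The basis vector \<open>({#i1, \<dots>, ik#}, \<gamma>)\<close> of \<open>V_L\<close> is \<open>a(-i1-1) \<cdots> a(-ik-1) \<^bold>1 \<otimes> e^\<gamma>\<close> (note the
  shift: index \<open>i\<close> belongs to the mode \<open>a(-i-1)\<close>), so that \<open>M = \<complex>[a(-1), a(-2), \<dots>]\<close>.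
\<close>

type_synonym 'l cpx = "complex \<times> 'l"
type_synonym 'l voa = "(nat multiset \<times> 'l) \<Rightarrow>\<^sub>0 complex"

definition bvec :: "nat multiset \<Rightarrow> 'l \<Rightarrow> 'l voa" where
  "bvec \<mu> \<gamma> = Poly_Mapping.single (\<mu>, \<gamma>) 1"

definition evec :: "'l \<Rightarrow> 'l voa" where
  "evec \<alpha> = bvec {#} \<alpha>"

text \<open>
  \<open>B\<close> is the form on \<open>L\<close>, \<open>\<epsilon>\<close> the sign function twisting the operators \<open>e^\<alpha>\<close>, and \<open>a\<close> the chosen
  vector of \<open>\<complex> \<otimes> L\<close> with \<open>(a, a) = 1\<close>.
\<close>

locale lattice_voa =
  fixes B :: "'l::ab_group_add \<Rightarrow> 'l \<Rightarrow> int"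
    and \<epsilon> :: "'l \<Rightarrow> 'l \<Rightarrow> int"
    and a :: "'l cpx"
begin

definition form :: "'l cpx \<Rightarrow> 'l cpx \<Rightarrow> complex" where
  "form h h' = fst h * fst h' * of_int (B (snd h) (snd h'))"

text \<open>
  The operators \<open>h(n)\<close> on \<open>V_L\<close>, where \<open>h = (h, a) a\<close>: creation for \<open>n < 0\<close>, and for \<open>n > 0\<close> the
  derivation \<open>(h, a) n \<partial>/\<partial>a(-n)\<close>.
\<close>

definition heis :: "'l cpx \<Rightarrow> int \<Rightarrow> 'l voa \<Rightarrow> 'l voa" where
  "heis h n = lin_ext (\<lambda>(\<mu>, \<gamma>).
     if n < 0 then smul (form h a) (bvec (add_mset (nat (- n) - 1) \<mu>) \<gamma>)
     else if n = 0 then smul (form h (1, \<gamma>)) (bvec \<mu> \<gamma>)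
     else smul (form h a * of_int n * of_nat (count \<mu> (nat n - 1)))
               (bvec (\<mu> - {#nat n - 1#}) \<gamma>))"

definition e_op :: "'l \<Rightarrow> 'l voa \<Rightarrow> 'l voa" where
  "e_op \<alpha> = lin_ext (\<lambda>(\<mu>, \<gamma>). smul (of_int (\<epsilon> \<alpha> \<gamma>)) (bvec \<mu> (\<alpha> + \<gamma>)))"

definition is_sign_cocycle :: bool where
  "is_sign_cocycle \<longleftrightarrow>
     (\<forall>\<alpha> \<gamma>. \<epsilon> \<alpha> \<gamma> = 1 \<or> \<epsilon> \<alpha> \<gamma> = -1) \<and>
     (\<forall>\<alpha> \<gamma> \<delta>. \<epsilon> \<alpha> (\<gamma> + \<delta>) = \<epsilon> \<alpha> \<gamma> * \<epsilon> \<alpha> \<delta>) \<and>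
     (\<forall>\<alpha> \<gamma> v. e_op \<alpha> (e_op \<gamma> v) = smul ((-1) powi B \<alpha> \<gamma>) (e_op \<gamma> (e_op \<alpha> v)))"

text \<open>The coefficient of \<open>z^p\<close> in the operator \<open>z^\<alpha>\<close>: the projection to the sum of those
  \<open>M \<otimes> e^\<gamma>\<close> with \<open>(\<alpha>, \<gamma>) = p\<close>.\<close>

definition z_op :: "'l \<Rightarrow> int \<Rightarrow> 'l voa \<Rightarrow> 'l voa" where
  "z_op \<alpha> p = lin_ext (\<lambda>(\<mu>, \<gamma>). if B \<alpha> \<gamma> = p then bvec \<mu> \<gamma> else 0)"

text \<open>The coefficient of \<open>z^j\<close> in \<open>Y_-(e^\<alpha>, z)\<close>, and of \<open>z^(-k)\<close> in \<open>Y_+(e^\<alpha>, z)\<close>.\<close>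

definition Y_minus :: "'l \<Rightarrow> nat \<Rightarrow> 'l voa \<Rightarrow> 'l voa" where
  "Y_minus \<alpha> j = exp_series_coeff (\<lambda>n v. smul (1 / of_nat n) (heis (1, \<alpha>) (- int n) v)) j"

definition Y_plus :: "'l \<Rightarrow> nat \<Rightarrow> 'l voa \<Rightarrow> 'l voa" where
  "Y_plus \<alpha> k = exp_series_coeff (\<lambda>n v. smul (- 1 / of_nat n) (heis (1, \<alpha>) (int n) v)) k"

text \<open>
  Fields are represented by their coefficients: \<open>\<Phi> m\<close> is the coefficient of \<open>z^m\<close> (so \<open>m = -n-1\<close>
  for the usual mode index \<open>n\<close>).  The sums \<open>Sum_any\<close> below have finite support on each vector.
\<close>

definition Y_exp :: "'l \<Rightarrow> int \<Rightarrow> 'l voa \<Rightarrow> 'l voa" where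
  "Y_exp \<alpha> m v = Sum_any (\<lambda>(j, k). Y_minus \<alpha> j (Y_plus \<alpha> k (e_op \<alpha> (z_op \<alpha> (m - int j + int k) v))))"

text \<open>
  The normally ordered product of \<open>(1/i!) \<partial>^i a(z) = \<Sum>l. (l+i choose i) a(-l-i-1) z^l\<close> with a
  field \<open>\<Phi>\<close>: modes \<open>a(n)\<close> with \<open>n < 0\<close> stand to the left of \<open>\<Phi>\<close>, those with \<open>n \<ge> 0\<close> to the right.
\<close>

definition normal_prod :: "nat \<Rightarrow> (int \<Rightarrow> 'l voa \<Rightarrow> 'l voa) \<Rightarrow> int \<Rightarrow> 'l voa \<Rightarrow> 'l voa" where
  "normal_prod i \<Phi> m v = Sum_any (\<lambda>l::int. smul (of_int (l + int i) gchoose i)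
     (if - l - int i - 1 < 0 then heis a (- l - int i - 1) (\<Phi> (m - l) v)
      else \<Phi> (m - l) (heis a (- l - int i - 1) v)))"

text \<open>The coefficient of \<open>z^m\<close> in \<open>Y(u, z)\<close>, where
  \<open>Y(a(-n1) \<cdots> a(-nk) \<^bold>1 \<otimes> e^\<alpha>, z) = :(1/(n1-1)!) \<partial>^(n1-1) a(z) \<cdots> (1/(nk-1)!) \<partial>^(nk-1) a(z) Y(e^\<alpha>, z):\<close>.\<close>

definition Y :: "'l voa \<Rightarrow> int \<Rightarrow> 'l voa \<Rightarrow> 'l voa" where
  "Y u m v = lin_ext (\<lambda>(\<mu>, \<alpha>). foldr normal_prod (sorted_list_of_multiset \<mu>) (Y_exp \<alpha>) m v) u"

definition conformal_vector :: "'l voa" where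
  "conformal_vector = smul (1 / 2) (heis a (-1) (heis a (-1) (evec 0)))"

text \<open>\<open>Y(\<omega>, z) = \<Sum>n. L(n) z^(-n-2)\<close>.\<close>

definition L0 :: "'l voa \<Rightarrow> 'l voa" where
  "L0 = Y conformal_vector (-2)"

text \<open>\<open>exp(z)^L(0)\<close>, and \<open>q^(L(0) - c/24)\<close> with \<open>q = exp(2 \<pi> i \<tau>)\<close> and \<open>c = 1\<close>.\<close>

definition exp_L0 :: "complex \<Rightarrow> 'l voa \<Rightarrow> 'l voa" where
  "exp_L0 z = exp_op (\<lambda>v. smul z (L0 v))"

definition q_L0 :: "complex \<Rightarrow> 'l voa \<Rightarrow> 'l voa" where
  "q_L0 \<tau> = exp_op (\<lambda>v. smul (2 * of_real pi * \<i> * \<tau>) (L0 v - smul (1 / 24) v))"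

text \<open>
  The terms of the series
  \<open>Tr_N Y(q_1^L(0) u_1, q_1) \<cdots> Y(q_n^L(0) u_n, q_n) q^(L(0) - c/24)\<close> for \<open>N = M \<otimes> e^\<beta>\<close>
  and \<open>q_i = exp(z_i)\<close>.  The trace is the sum of the diagonal coefficients at the basis vectors
  \<open>(\<mu>, \<beta>)\<close> of \<open>N\<close>, and each \<open>Y\<close> is expanded in powers \<open>q_i^(m i)\<close>; all these sums are taken together.
  The finite linear order \<open>'n\<close> is the index set \<open>{1, \<dots>, n}\<close>.
\<close>

definition trace_term ::
    "('n::{finite,linorder} \<Rightarrow> 'l voa) \<Rightarrow> 'l \<Rightarrow> complex \<Rightarrow> complex ^ 'n::{finite,linorder}
      \<Rightarrow> nat multiset \<times> ('n \<Rightarrow> int) \<Rightarrow> complex" where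
  "trace_term u \<beta> \<tau> z = (\<lambda>(\<mu>, m).
     Poly_Mapping.lookup
       (foldr (\<lambda>i. Y (exp_L0 (z $ i) (u i)) (m i)) (sorted_list_of_set UNIV) (q_L0 \<tau> (bvec \<mu> \<beta>)))
       (\<mu>, \<beta>)
     * (\<Prod>i\<in>UNIV. exp (z $ i) powi m i))"

end

definition holomorphic_several :: "(complex ^ 'n::finite \<Rightarrow> complex) \<Rightarrow> (complex ^ 'n::finite) set \<Rightarrow> bool" where
  "holomorphic_several F S \<longleftrightarrow>
     (\<forall>z\<in>S. \<exists>F'. (F has_derivative F') (at z) \<and> (\<forall>c v. F' (c *s v) = c * F' v))"

text \<open>The domain \<open>|q_1| > \<dots> > |q_n| > |q q_1|\<close>.\<close>

definition trace_region :: "complex \<Rightarrow> (complex ^ 'n::{finite,linorder}) set" where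
  "trace_region \<tau> = {z. (\<forall>i j. i < j \<longrightarrow> norm (exp (z $ i)) > norm (exp (z $ j))) \<and>
     norm (exp (z $ Max UNIV)) > norm (exp (2 * of_real pi * \<i> * \<tau>) * exp (z $ Min UNIV))}"

text \<open>
  The tuples \<open>z\<close> whose entries are pairwise distinct modulo \<open>2 \<pi> i (\<int> + \<int> \<tau>)\<close>: the connected, open
  and dense complement of the possible poles.
\<close>

definition config_space :: "complex \<Rightarrow> (complex ^ 'n::finite) set" where
  "config_space \<tau> = {z. \<forall>i j. i \<noteq> j \<longrightarrow>
     \<not> (\<exists>k l :: int. z $ i - z $ j = 2 * of_real pi * \<i> * (of_int k + of_int l * \<tau>))}"

context lattice_voa
begin

text \<open>
  The trace converges (absolutely) on \<open>|q_1| > \<dots> > |q_n| > |q q_1|\<close> to the restriction of \<open>F\<close>, which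
  is holomorphic off the possible poles.
\<close>

definition is_n_point_function ::
    "('n::{finite,linorder} \<Rightarrow> 'l voa) \<Rightarrow> 'l \<Rightarrow> complex \<Rightarrow> (complex ^ 'n::{finite,linorder} \<Rightarrow> complex) \<Rightarrow> bool" where
  "is_n_point_function u \<beta> \<tau> F \<longleftrightarrow>
     holomorphic_several F (config_space \<tau>) \<and>
     (\<forall>z\<in>trace_region \<tau>. (trace_term u \<beta> \<tau> z has_sum F z) UNIV)"

text \<open>The function \<open>F_N(u_1, z_1; \<dots>; u_n, z_n; q)\<close>; its values off \<open>config_space \<tau>\<close>, set to \<open>0\<close>,
  carry no meaning.\<close>

definition n_point_function ::
    "('n::{finite,linorder} \<Rightarrow> 'l voa) \<Rightarrow> 'l \<Rightarrow> complex \<Rightarrow> complex ^ 'n::{finite,linorder} \<Rightarrow> complex" where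
  "n_point_function u \<beta> \<tau> =
     (THE F. is_n_point_function u \<beta> \<tau> F \<and> (\<forall>z. z \<notin> config_space \<tau> \<longrightarrow> F z = 0))"

end

definition dedekind_eta :: "complex \<Rightarrow> complex" where
  "dedekind_eta \<tau> = exp (2 * of_real pi * \<i> * \<tau> / 24) *
     prodinf (\<lambda>n. 1 - exp (2 * of_real pi * \<i> * \<tau>) ^ Suc n)"

text \<open>Bernoulli numbers: \<open>x / (exp x - 1) = \<Sum>k. B_k x^k / k!\<close>.\<close>

definition bernoulli :: "nat \<Rightarrow> complex" where
  "bernoulli k = fact k * fps_nth (fps_X / (fps_exp 1 - 1)) k"

definition sigma :: "nat \<Rightarrow> nat \<Rightarrow> nat" where
  "sigma k n = (\<Sum>d | d dvd n. d ^ k)"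

definition eisenstein :: "nat \<Rightarrow> complex \<Rightarrow> complex" where
  "eisenstein k \<tau> =
     (if even k then - bernoulli k / fact k + 2 / fact (k - 1) *
        suminf (\<lambda>n. of_nat (sigma (k - 1) (Suc n)) * exp (2 * of_real pi * \<i> * \<tau>) ^ Suc n)
      else 0)"

text \<open>The power series in the exponent converges only near \<open>z = 0\<close>; \<open>K(\<cdot>, \<tau>)\<close> is the entire
  extension of the function defined there.\<close>

definition prime_form :: "complex \<Rightarrow> complex \<Rightarrow> complex" where
  "prime_form z \<tau> = (THE K. K holomorphic_on UNIV \<and>
     (\<forall>\<^sub>F w in nhds 0. K w = w * exp (- suminf (\<lambda>k. 1 / of_nat (k + 2) * eisenstein (k + 2) \<tau> * w ^ (k + 2))))) z"

end

theory Submission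
  imports Defs "HOL-Combinatorics.Multiset_Permutations"
begin

text \<open>
  On \<open>M = \<complex>[x\<^sub>1, x\<^sub>2, \<dots>]\<close>, with \<open>x\<^sub>k = a(-k)\<close>, the operator \<open>Y\<^sub>-(e\<^sup>\<alpha>, z) Y\<^sub>+(e\<^sup>\<alpha>, z)\<close> is
  \<open>f(x) \<mapsto> exp (\<Sum>\<^sub>k c\<^sub>k x\<^sub>k) f(x + d)\<close> with \<open>c\<^sub>k = (\<alpha>, a) z\<^sup>k / k\<close> and \<open>d\<^sub>k = - (\<alpha>, a) z\<^sup>-\<^sup>k\<close>.  Composing two
  such operators adds the parameters and produces the scalar \<open>exp (\<Sum>\<^sub>k d\<^sub>k c'\<^sub>k) = (1 - z'/z)\<^bsup>(\<alpha>, \<alpha>')\<^esup>\<close>; the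
  trace against \<open>q\<^bsup>L(0)\<^esup>\<close> factors over the modes into
  \<open>\<Prod>\<^sub>k exp (c\<^sub>k d\<^sub>k q\<^sup>k / (1 - q\<^sup>k)) / (1 - q\<^sup>k)\<close>.  The same identities with \<open>|c\<^sub>k|\<close> and \<open>|d\<^sub>k|\<close>
  in place of \<open>c\<^sub>k\<close> and \<open>d\<^sub>k\<close> give absolute convergence.  Since \<open>\<Sum>\<alpha>\<^sub>i = 0\<close>, the result regroups into the
  factors \<open>2 sinh (z/2) \<Prod>\<^sub>n (1 - q\<^sup>n e\<^sup>z) (1 - q\<^sup>n e\<^sup>-\<^sup>z) / (1 - q\<^sup>n)\<^sup>2\<close>, the product formula of the prime form,
  which follows from its definition by expanding the logarithm.
\<close>

section \<open>Absolutely convergent sums over multisets\<close>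

text \<open>The terms of the trace are indexed jointly by a basis vector and by the exponents of all
  \<open>q_i\<close>, so every exchange of summations needs absolute convergence. For this reason
  \<open>has_abs_sum\<close> carries an explicit bound: the bound of a composite is the sum of the
  bounds of its parts, and that sum is evaluated by the same formula applied to norms. The grading
  ties the exponents to the intermediate basis vectors, so summing over them amounts to inserting
  all intermediate states. Rank one enters twice. Products of two charges are lattice pairings, and
  all pairings are even, so the cocycle is symmetric and the signs between the \<alpha>'s and
  \<beta> multiply to 1. Since the \<alpha>'s sum to zero, every row of the matrix of their pairings
  sums to zero, and its diagonal can be distributed over the pairs i < j. This is the origin both of
  the symmetric exponentials of z/2 and -z/2 and of the squared denominators.\<close>

definition has_abs_sum :: "('a \<Rightarrow> 'c::banach) \<Rightarrow> 'c \<Rightarrow> real \<Rightarrow> 'a set \<Rightarrow> bool" where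
  "has_abs_sum f s C A \<longleftrightarrow> (f has_sum s) A \<and> (\<lambda>x. norm (f x)) summable_on A \<and>
     infsum (\<lambda>x. norm (f x)) A \<le> C"

lemma has_abs_sum_comparison:
  assumes f: "(f has_sum s) A" and g: "(g has_sum C) A"
    and le: "\<And>x. x \<in> A \<Longrightarrow> norm (f x) \<le> g x"
  shows "has_abs_sum f s C A"
proof -
  have S: "(\<lambda>x. norm (f x)) summable_on A"
    by (rule Infinite_Sum.abs_summable_on_comparison_test'[OF has_sum_imp_summable[OF g] le])
  have "infsum (\<lambda>x. norm (f x)) A \<le> infsum g A"
    by (rule infsum_mono[OF S has_sum_imp_summable[OF g] le])
  thus ?thesis using f S infsumI[OF g] by (simp add: has_abs_sum_def)
qed

lemma has_abs_sum_mono: "has_abs_sum f s C A \<Longrightarrow> C \<le> D \<Longrightarrow> has_abs_sum f s D A"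
  by (auto simp: has_abs_sum_def)

lemma has_abs_sum_cmult:
  fixes f :: "'a \<Rightarrow> 'c::{banach, real_normed_field}"
  assumes "has_abs_sum f s C A"
  shows "has_abs_sum (\<lambda>x. c * f x) (c * s) (norm c * C) A"
  using assms unfolding has_abs_sum_def norm_mult
  by (auto intro!: has_sum_cmult_right summable_on_cmult_right mult_left_mono
        simp: infsum_cmult_right)

lemma has_abs_sum_reindex_bij_betw:
  assumes "bij_betw g A B"
  shows "has_abs_sum (\<lambda>x. f (g x)) s C A \<longleftrightarrow> has_abs_sum f s C B"
  unfolding has_abs_sum_def using has_sum_reindex_bij_betw[OF assms, of f]
    summable_on_reindex_bij_betw[OF assms, of "\<lambda>x. norm (f x)"]
    infsum_reindex_bij_betw[OF assms, of "\<lambda>x. norm (f x)"] by simp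

text \<open>Tonelli: the fibre bounds \<open>h\<close> dominate the sums of norms along the fibres,
  and their convergence gives absolute summability on the product.\<close>

lemma has_sum_Times:
  fixes F :: "'b \<Rightarrow> 'a \<Rightarrow> 'c::banach"
  assumes F: "\<And>b. b \<in> B \<Longrightarrow> has_abs_sum (F b) (g b) (h b) A"
    and g: "(g has_sum s) B" and h: "(h has_sum H) B"
  shows "((\<lambda>(b, a). F b a) has_sum s) (B \<times> A)"
    and "(\<lambda>(b, a). norm (F b a)) summable_on (B \<times> A)"
    and "(\<lambda>b. infsum (\<lambda>a. norm (F b a)) A) summable_on B"
proof -
  let ?f = "\<lambda>(b, a). F b a"
  let ?n = "\<lambda>b. infsum (\<lambda>a. norm (F b a)) A"
  have "(\<lambda>b. norm (?n b)) summable_on B"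
    by (rule Infinite_Sum.abs_summable_on_comparison_test'[OF has_sum_imp_summable[OF h]])
       (use F in \<open>auto simp: has_abs_sum_def infsum_nonneg\<close>)
  thus nn: "?n summable_on B" by (simp add: infsum_nonneg)
  have abs: "(\<lambda>p. norm (?f p)) summable_on (B \<times> A)"
    unfolding Infinite_Sum.abs_summable_on_Sigma_iff using F nn
    by (simp add: infsum_nonneg has_abs_sum_def)
  thus "(\<lambda>(b, a). norm (F b a)) summable_on (B \<times> A)" by (simp add: case_prod_unfold)
  show "(?f has_sum s) (B \<times> A)"
    by (rule has_sum_SigmaI[OF _ g])
       (use F abs in \<open>auto intro: abs_summable_summable simp: has_abs_sum_def\<close>)
qed

text \<open>Summation by columns becomes summation by rows. The conclusion is again a
  \<open>has_abs_sum\<close>, because the norm of a row sum is at most the sum of norms along the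
  row, and these add up to at most the sum of the column bounds. Hence the lemma can be iterated
  along a product of operators.\<close>

lemma has_sum_fubini:
  fixes F :: "'a \<Rightarrow> 'b \<Rightarrow> 'c::banach"
  assumes F: "\<And>b. b \<in> B \<Longrightarrow> has_abs_sum (\<lambda>a. F a b) (g b) (h b) A"
    and g: "(g has_sum s) B" and h: "(h has_sum H) B"
    and row: "\<And>a. a \<in> A \<Longrightarrow> (F a has_sum r a) B"
  shows "has_abs_sum r s H A"
proof -
  have col: "((\<lambda>a. F a b) has_sum g b) A" and coln: "(\<lambda>a. norm (F a b)) summable_on A"
    and colb: "infsum (\<lambda>a. norm (F a b)) A \<le> h b" if "b \<in> B" for b
    using F[OF that] by (auto simp: has_abs_sum_def)
  let ?f = "\<lambda>(b, a). F a b"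
  let ?n = "\<lambda>b. infsum (\<lambda>a. norm (F a b)) A"
  note T = has_sum_Times[of B "\<lambda>b a. F a b" g h A, OF F g h]
  have nn: "?n summable_on B" and abs: "(\<lambda>p. norm (?f p)) summable_on (B \<times> A)"
    and tot: "(?f has_sum s) (B \<times> A)"
    using T by (auto simp: case_prod_unfold)
  hence "((\<lambda>(a, b). F a b) has_sum s) (A \<times> B)"
    by (subst has_sum_swap) (simp add: case_prod_unfold)
  hence 1: "(r has_sum s) A"
    by (rule has_sum_SigmaD) (use row in auto)
  have "((\<lambda>(b, a). norm (F a b)) has_sum infsum ?n B) (B \<times> A)"
    by (rule has_sum_SigmaI[where g = ?n]) (use nn coln abs in \<open>auto simp: case_prod_unfold\<close>)
  hence N: "((\<lambda>(a, b). norm (F a b)) has_sum infsum ?n B) (A \<times> B)"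
    by (subst has_sum_swap) (simp add: case_prod_unfold)
  have "(\<lambda>(a, b). norm (F a b)) summable_on (A \<times> B)"
    using N by (rule has_sum_imp_summable)
  hence rown: "(\<lambda>b. norm (F a b)) summable_on B" if "a \<in> A" for a
    using that by (rule summable_on_SigmaD1)
  have R: "((\<lambda>a. infsum (\<lambda>b. norm (F a b)) B) has_sum infsum ?n B) A"
    by (rule has_sum_SigmaD[OF N]) (use rown in auto)
  have le: "norm (r a) \<le> infsum (\<lambda>b. norm (F a b)) B" if "a \<in> A" for a
    by (rule norm_has_sum_bound[OF _ row[OF that]]) (use rown[OF that] in auto)
  have S: "(\<lambda>a. norm (r a)) summable_on A"
    by (rule Infinite_Sum.abs_summable_on_comparison_test'[OF has_sum_imp_summable[OF R] le])
  have "infsum (\<lambda>a. norm (r a)) A \<le> infsum (\<lambda>a. infsum (\<lambda>b. norm (F a b)) B) A"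
    by (rule infsum_mono[OF S has_sum_imp_summable[OF R] le])
  also have "\<dots> = infsum ?n B" using R by (rule infsumI)
  also have "\<dots> \<le> infsum h B" by (rule infsum_mono[OF nn has_sum_imp_summable[OF h] colb])
  also have "\<dots> = H" using h by (rule infsumI)
  finally show ?thesis using 1 S by (simp add: has_abs_sum_def)
qed

lemma has_sum_mult_Times:
  fixes u :: "'a \<Rightarrow> 'c::{banach, real_normed_field}" and v :: "'b \<Rightarrow> 'c"
  assumes u: "(u has_sum a) A" and v: "(v has_sum b) B"
    and un: "((\<lambda>x. norm (u x)) has_sum m) A" and vn: "((\<lambda>x. norm (v x)) has_sum n) B"
  shows "((\<lambda>(x, y). u x * v y) has_sum a * b) (A \<times> B)"
    and "((\<lambda>(x, y). norm (u x * v y)) has_sum m * n) (A \<times> B)"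
proof -
  have rows: "((\<lambda>y. norm (u x * v y)) has_sum norm (u x) * n) B" for x
    unfolding norm_mult by (rule has_sum_cmult_right[OF vn])
  have c: "((\<lambda>x. norm (u x) * n) has_sum m * n) A"
    by (rule has_sum_cmult_left[OF un])
  have S: "(\<lambda>(x, y). norm (u x * v y)) summable_on (A \<times> B)"
    by (rule summable_on_SigmaI) (use rows has_sum_imp_summable[OF c] in auto)
  show "((\<lambda>(x, y). norm (u x * v y)) has_sum m * n) (A \<times> B)"
    by (rule has_sum_SigmaI[OF _ c S]) (use rows in auto)
  have "(\<lambda>p. norm ((\<lambda>(x, y). u x * v y) p)) summable_on (A \<times> B)"
    using S by (simp add: case_prod_unfold)
  hence S': "(\<lambda>(x, y). u x * v y) summable_on (A \<times> B)"
    by (rule abs_summable_summable)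
  show "((\<lambda>(x, y). u x * v y) has_sum a * b) (A \<times> B)"
    by (rule has_sum_SigmaI[OF _ has_sum_cmult_left[OF u] S']) (use v in \<open>auto intro: has_sum_cmult_right\<close>)
qed

text \<open>Distributive law: a multiset supported below \<open>N\<close> is a tuple of
  \<open>N\<close> multiplicities, and the induction splits off the last one. The norms are carried
  along because the product of two infinite sums requires them.\<close>

lemma has_sum_multiset_prod_lessThan:
  fixes f :: "nat \<Rightarrow> nat \<Rightarrow> 'c::{banach, real_normed_field}"
  assumes f: "\<And>k. (f k has_sum S k) UNIV" and fn: "\<And>k. ((\<lambda>s. norm (f k s)) has_sum T k) UNIV"
  shows "((\<lambda>\<mu>. \<Prod>k<N. f k (count \<mu> k)) has_sum (\<Prod>k<N. S k)) {\<mu>. set_mset \<mu> \<subseteq> {..<N}} \<and>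
         ((\<lambda>\<mu>. norm (\<Prod>k<N. f k (count \<mu> k))) has_sum (\<Prod>k<N. T k)) {\<mu>. set_mset \<mu> \<subseteq> {..<N}}"
proof (induction N)
  case 0
  have [simp]: "{\<mu>::nat multiset. set_mset \<mu> \<subseteq> {}} = {{#}}" by auto
  show ?case by (auto intro!: has_sum_finiteI)
next
  case (Suc N)
  let ?A = "\<lambda>N. {\<mu>::nat multiset. set_mset \<mu> \<subseteq> {..<N}}"
  let ?h = "\<lambda>(\<mu>, s). \<mu> + replicate_mset s N"
  have bij: "bij_betw ?h (?A N \<times> UNIV) (?A (Suc N))"
  proof (rule bij_betwI[where g = "\<lambda>\<mu>. (filter_mset (\<lambda>k. k < N) \<mu>, count \<mu> N)"], goal_cases)
    case 1
    then show ?case by (auto simp: less_Suc_eq split: if_splits dest!: subsetD)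
  next
    case 2
    then show ?case by auto
  next
    case (3 x)
    then show ?case
      by (cases x) (auto simp: multiset_eq_iff count_eq_zero_iff dest: subsetD)
  next
    case (4 \<mu>)
    have "count \<mu> k = 0" if "\<not> k < N" "k \<noteq> N" for k
      using 4 that by (auto simp: count_eq_zero_iff dest!: subsetD)
    then show ?case by (auto simp: multiset_eq_iff)
  qed
  have eq: "(\<Prod>k<Suc N. f k (count (?h p) k)) = (case p of (\<mu>, s) \<Rightarrow> (\<Prod>k<N. f k (count \<mu> k)) * f N s)"
    if "p \<in> ?A N \<times> UNIV" for p
  proof -
    obtain \<mu> s where p: "p = (\<mu>, s)" by force
    have "N \<notin># \<mu>" using that p by auto
    hence "count \<mu> N = 0" by (simp add: count_eq_zero_iff)
    moreover have "(\<Prod>k<N. f k (count (?h p) k)) = (\<Prod>k<N. f k (count \<mu> k))"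
      unfolding p by (rule prod.cong) auto
    ultimately show ?thesis unfolding p by simp
  qed
  note IH = has_sum_mult_Times[OF conjunct1[OF Suc.IH] f[of N] conjunct2[OF Suc.IH] fn[of N]]
  have "((\<lambda>p. \<Prod>k<Suc N. f k (count (?h p) k)) has_sum (\<Prod>k<Suc N. S k)) (?A N \<times> UNIV)"
    by (rule iffD2[OF has_sum_cong[OF eq]]) (use IH(1) in \<open>simp_all add: case_prod_unfold\<close>)
  moreover have "((\<lambda>p. norm (\<Prod>k<Suc N. f k (count (?h p) k))) has_sum (\<Prod>k<Suc N. T k)) (?A N \<times> UNIV)"
    by (rule iffD2[OF has_sum_cong[OF arg_cong[OF eq, of _ norm]]])
       (use IH(2) in \<open>simp_all add: case_prod_unfold\<close>)
  ultimately show ?case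
    unfolding has_sum_reindex_bij_betw[OF bij, of "\<lambda>\<mu>. \<Prod>k<Suc N. f k (count \<mu> k)"]
      has_sum_reindex_bij_betw[OF bij, of "\<lambda>\<mu>. norm (\<Prod>k<Suc N. f k (count \<mu> k))"]
    by blast
qed

text \<open>Bounded sums of norms force summability, and the value is then the limit of the sums
  over the exhausting sets. Everything is required from \<open>N0\<close> on only, as truncated
  products agree with the full ones only for large \<open>N\<close>.\<close>

lemma has_sum_exhaust:
  fixes f :: "'a \<Rightarrow> 'c::banach"
  assumes A: "incseq A" "(\<Union>N. A N) = UNIV"
    and f: "\<And>N. N \<ge> N0 \<Longrightarrow> (f has_sum S N) (A N)"
    and fn: "\<And>N. N \<ge> N0 \<Longrightarrow> ((\<lambda>x. norm (f x)) has_sum T N) (A N)"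
    and P: "S \<longlonglongrightarrow> P" and Q: "\<And>N. N \<ge> N0 \<Longrightarrow> T N \<le> Q"
  shows "has_abs_sum f P Q UNIV"
proof -
  have cover: "\<exists>N\<ge>N0. X \<subseteq> A N" if "finite X" for X :: "'a set"
    using that
  proof induction
    case empty
    then show ?case by auto
  next
    case (insert x X)
    then obtain N where N: "N \<ge> N0" "X \<subseteq> A N" by blast
    obtain M where "x \<in> A M" using A(2) by blast
    then show ?case using N incseqD[OF A(1), of N "max N M"] incseqD[OF A(1), of M "max N M"]
      by (intro exI[of _ "max N M"]) auto
  qed
  have bnd: "(\<Sum>x\<in>X. norm (f x)) \<le> Q" if X: "finite X" for X :: "'a set"
  proof -
    obtain N where N: "N \<ge> N0" "X \<subseteq> A N" using cover[OF X] by blast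
    have "(\<Sum>x\<in>X. norm (f x)) \<le> T N"
      by (rule finite_sum_le_has_sum[OF fn[OF N(1)] X N(2)]) auto
    thus ?thesis using Q[OF N(1)] by simp
  qed
  have sn: "(\<lambda>x. norm (f x)) summable_on UNIV"
    by (rule nonneg_bounded_partial_sums_imp_summable_on[of _ _ Q])
       (auto simp: eventually_finite_subsets_at_top intro!: bnd)
  have iq: "infsum (\<lambda>x. norm (f x)) UNIV \<le> Q"
    by (rule infsum_le_finite_sums[OF sn]) (use bnd in auto)
  have "f summable_on UNIV" using sn by (rule abs_summable_summable)
  then obtain s where s: "(f has_sum s) UNIV" by (auto simp: summable_on_def)
  \<comment> \<open>The finite set \<open>X \<union> Z\<close> comes within \<open>e / 2\<close> of
    both sums, the one over everything and the one over \<open>A n\<close>.\<close>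
  have "S \<longlonglongrightarrow> s"
  proof (rule LIMSEQ_I)
    fix e :: real assume e: "e > 0"
    have "eventually (\<lambda>X. dist (sum f X) s < e / 2) (finite_subsets_at_top UNIV)"
      by (rule tendstoD[OF s[unfolded has_sum_def] half_gt_zero[OF e]])
    then obtain X where X: "finite X" "\<And>Y. finite Y \<Longrightarrow> X \<subseteq> Y \<Longrightarrow> dist (sum f Y) s < e / 2"
      by (auto simp: eventually_finite_subsets_at_top)
    obtain N where N: "N \<ge> N0" "X \<subseteq> A N" using cover[OF X(1)] by blast
    show "\<exists>no. \<forall>n\<ge>no. norm (S n - s) < e"
    proof (intro exI allI impI)
      fix n assume n: "N \<le> n"
      have "X \<subseteq> A n" using N incseqD[OF A(1) n] by blast
      have Sn: "(f has_sum S n) (A n)" using f n N by simp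
      hence "eventually (\<lambda>Y. dist (sum f Y) (S n) < e / 2) (finite_subsets_at_top (A n))"
        by (intro tendstoD[OF Sn[unfolded has_sum_def] half_gt_zero[OF e]])
      then obtain Z where Z: "finite Z" "Z \<subseteq> A n"
        "\<And>Y. finite Y \<Longrightarrow> Z \<subseteq> Y \<Longrightarrow> Y \<subseteq> A n \<Longrightarrow> dist (sum f Y) (S n) < e / 2"
        by (auto simp: eventually_finite_subsets_at_top)
      have "dist (sum f (X \<union> Z)) (S n) < e / 2" "dist (sum f (X \<union> Z)) s < e / 2"
        using X Z \<open>X \<subseteq> A n\<close> by auto
      hence "dist (S n) s < e" using dist_triangle_half_r by blast
      thus "norm (S n - s) < e" by (simp add: dist_norm)
    qed
  qed
  hence "s = P" using P LIMSEQ_unique by blast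
  thus ?thesis using s sn iq by (simp add: has_abs_sum_def)
qed

text \<open>Expansion of an infinite product of series into a series over multisets: a multiset
  chooses one summand from each factor. Finiteness of the exceptional set makes each term a finite
  product.\<close>

lemma has_sum_multiset_Prod_any:
  fixes f :: "nat \<Rightarrow> nat \<Rightarrow> 'c::{banach, real_normed_field}"
  assumes fin: "finite {k. f k 0 \<noteq> 1}"
    and F: "\<And>k. has_abs_sum (f k) (S k) (T k) UNIV"
    and P: "(\<lambda>N. \<Prod>k<N. S k) \<longlonglongrightarrow> P" and Q: "\<And>N. N \<ge> N1 \<Longrightarrow> (\<Prod>k<N. T k) \<le> Q"
  shows "has_abs_sum (\<lambda>\<mu>. Prod_any (\<lambda>k. f k (count \<mu> k))) P Q UNIV"
proof -
  \<comment> \<open>The product formula needs the exact sums of norms; the bounds \<open>T\<close>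
    are compared with them in \<open>Q'\<close>.\<close>
  define T' where "T' k = infsum (\<lambda>s. norm (f k s)) UNIV" for k
  have f: "(f k has_sum S k) UNIV" and fn: "((\<lambda>s. norm (f k s)) has_sum T' k) UNIV" for k
    using F[of k] by (auto simp: has_abs_sum_def T'_def)
  have Q': "(\<Prod>k<N. T' k) \<le> Q" if "N \<ge> N1" for N
    by (rule order.trans[OF prod_mono Q[of N]])
       (use F that in \<open>auto simp: has_abs_sum_def T'_def intro!: infsum_nonneg\<close>)
  let ?A = "\<lambda>N. {\<mu>::nat multiset. set_mset \<mu> \<subseteq> {..<N}}"
  obtain N0 where N0: "\<And>k. f k 0 \<noteq> 1 \<Longrightarrow> k < N0"
    using fin by (metis (mono_tags, lifting) finite_nat_set_iff_bounded mem_Collect_eq)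
  have eq: "Prod_any (\<lambda>k. f k (count \<mu> k)) = (\<Prod>k<N. f k (count \<mu> k))"
    if "N0 \<le> N" "\<mu> \<in> ?A N" for N \<mu>
  proof (rule Prod_any.expand_superset)
    show "{k. f k (count \<mu> k) \<noteq> 1} \<subseteq> {..<N}"
    proof
      fix k assume k: "k \<in> {k. f k (count \<mu> k) \<noteq> 1}"
      show "k \<in> {..<N}"
      proof (cases "k \<in># \<mu>")
        case False
        hence "count \<mu> k = 0" by (simp add: count_eq_zero_iff)
        with k have "f k 0 \<noteq> 1" by simp
        with N0 that show ?thesis by fastforce
      qed (use that in auto)
    qed
  qed auto
  have 1: "incseq ?A" by (force simp: incseq_def)
  have 2: "(\<Union>N. ?A N) = UNIV"
  proof -
    have "\<exists>N. set_mset \<mu> \<subseteq> {..<N}" for \<mu> :: "nat multiset"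
      using finite_nat_iff_bounded[of "set_mset \<mu>"] by auto
    thus ?thesis by auto
  qed
  note L = has_sum_multiset_prod_lessThan[of f S T', OF f fn]
  have 3: "((\<lambda>\<mu>. Prod_any (\<lambda>k. f k (count \<mu> k))) has_sum (\<Prod>k<N. S k)) (?A N)" if "N \<ge> N0" for N
    using L by (subst has_sum_cong[OF eq[OF that]]) auto
  have 4: "((\<lambda>\<mu>. norm (Prod_any (\<lambda>k. f k (count \<mu> k)))) has_sum (\<Prod>k<N. T' k)) (?A N)" if "N \<ge> N0" for N
    using L by (subst has_sum_cong[OF arg_cong[OF eq[OF that], of _ norm]]) auto
  show ?thesis
    by (rule has_sum_exhaust[OF 1 2, of "max N0 N1", OF 3 4 P Q']) auto
qed

section \<open>The harmonic oscillator\<close>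

text \<open>This is \<open>h(x) = f(x + d)\<close>, read off coefficientwise from the binomial
  expansion. Each coefficient of \<open>h\<close> is an infinite sum, hence a relation rather than
  an operation on power series.\<close>

definition taylor_shift :: "'a::{banach, real_normed_field} \<Rightarrow> 'a fps \<Rightarrow> 'a fps \<Rightarrow> bool" where
  "taylor_shift d f h \<longleftrightarrow>
     (\<forall>t. ((\<lambda>s. fps_nth f s * (of_nat (s choose t) * d ^ (s - t))) has_sum fps_nth h t) UNIV)"

lemma has_sum_sum:
  fixes f :: "'b \<Rightarrow> 'a \<Rightarrow> 'c::topological_comm_monoid_add"
  assumes "\<And>i. i \<in> I \<Longrightarrow> (f i has_sum S i) A"
  shows "((\<lambda>x. \<Sum>i\<in>I. f i x) has_sum (\<Sum>i\<in>I. S i)) A"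
  using assms by (induction I rule: infinite_finite_induct) (auto intro!: has_sum_add)

lemma has_sum_exp: "((\<lambda>n. x ^ n / fact n) has_sum exp (x::'a::{banach, real_normed_field})) UNIV"
proof (rule norm_summable_imp_has_sum)
  show "summable (\<lambda>n. norm (x ^ n / fact n))"
    using summable_norm_exp[of x] by (simp add: scaleR_conv_of_real field_simps norm_divide)
  show "(\<lambda>n. x ^ n / fact n) sums exp x"
    using exp_converges[of x] by (simp add: scaleR_conv_of_real field_simps)
qed

lemma taylor_shift_exp:
  "taylor_shift d (fps_exp c) (fps_const (exp (d * c)) * fps_exp c)"
  unfolding taylor_shift_def
proof
  fix t
  have "((\<lambda>n. c ^ t / fact t * ((d * c) ^ n / fact n)) has_sum c ^ t / fact t * exp (d * c)) UNIV"
    by (intro has_sum_cmult_right has_sum_exp)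
  also have "?this \<longleftrightarrow> ((\<lambda>s. fps_nth (fps_exp c) s * (of_nat (s choose t) * d ^ (s - t)))
      has_sum c ^ t / fact t * exp (d * c)) {t..}"
  proof (rule has_sum_reindex_bij_witness[of _ "\<lambda>s. s - t" "\<lambda>n. n + t"], goal_cases)
    case (5 n)
    have "(of_nat (n + t choose t) :: 'a) = fact (n + t) / (fact t * fact n)"
      using binomial_fact[of t "n + t", where 'a = 'a] by simp
    thus ?case by (simp add: field_simps power_add power_mult_distrib)
  qed auto
  also have "\<dots> \<longleftrightarrow> ((\<lambda>s. fps_nth (fps_exp c) s * (of_nat (s choose t) * d ^ (s - t)))
      has_sum c ^ t / fact t * exp (d * c)) UNIV"
    by (rule has_sum_cong_neutral) auto
  finally show "((\<lambda>s. fps_nth (fps_exp c) s * (of_nat (s choose t) * d ^ (s - t)))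
      has_sum fps_nth (fps_const (exp (d * c)) * fps_exp c) t) UNIV"
    by (simp add: mult_ac)
qed

lemma taylor_shift_add:
  "taylor_shift d f h \<Longrightarrow> taylor_shift d f' h' \<Longrightarrow> taylor_shift d (f + f') (h + h')"
  unfolding taylor_shift_def by (simp add: ring_distribs has_sum_add)

lemma taylor_shift_cmult:
  "taylor_shift d f h \<Longrightarrow> taylor_shift d (fps_const e * f) (fps_const e * h)"
  unfolding taylor_shift_def by (simp add: mult.assoc has_sum_cmult_right)

text \<open>The substitution is multiplicative and sends \<open>x\<close> to \<open>x + d\<close>;
  on coefficients this is Pascal's rule.\<close>

lemma taylor_shift_X_mult:
  assumes "taylor_shift d f h"
  shows "taylor_shift d (fps_X * f) ((fps_X + fps_const d) * h)"
  unfolding taylor_shift_def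
proof
  fix t
  let ?u = "\<lambda>s. if t = 0 then 0 else fps_nth f s * (of_nat (s choose (t - 1)) * d ^ (s - (t - 1)))"
  let ?g = "\<lambda>s. fps_nth (fps_X * f) s * (of_nat (s choose t) * d ^ (s - t))"
  let ?v = "d * fps_nth h t + (if t = 0 then 0 else fps_nth h (t - 1))"
  have A: "((\<lambda>s. fps_nth f s * (of_nat (s choose t) * d ^ (s - t))) has_sum fps_nth h t) UNIV" for t
    using assms by (simp add: taylor_shift_def)
  have "((\<lambda>s. d * (fps_nth f s * (of_nat (s choose t) * d ^ (s - t))) +
      ?u s)
      has_sum ?v) UNIV"
  proof (intro has_sum_add has_sum_cmult_right A)
    show "(?u
      has_sum (if t = 0 then 0 else fps_nth h (t - 1))) UNIV"
    proof (cases "t = 0")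
      case False
      show ?thesis unfolding if_not_P[OF False] by (rule A)
    qed simp
  qed
  also have "(\<lambda>s. d * (fps_nth f s * (of_nat (s choose t) * d ^ (s - t))) +
      ?u s) =
      (\<lambda>s. ?g (Suc s))"
  proof
    fix s
    show "d * (fps_nth f s * (of_nat (s choose t) * d ^ (s - t))) +
      ?u s =
      ?g (Suc s)"
    proof (cases t)
      case (Suc u)
      show ?thesis
      proof (cases "t \<le> s")
        case True
        hence "d ^ (s - u) = d * d ^ (s - t)" using Suc by (simp flip: power_Suc add: Suc_diff_Suc)
        thus ?thesis using Suc by (simp add: algebra_simps)
      qed (use Suc in \<open>auto simp: binomial_eq_0\<close>)
    qed (auto simp: mult_ac)
  qed
  also have "((\<lambda>s. ?g (Suc s))
      has_sum ?v) UNIV \<longleftrightarrow>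
    (?g
      has_sum ?v) {1..}"
    by (rule has_sum_reindex_bij_witness[of _ "\<lambda>s. s - 1" Suc]) auto
  also have "\<dots> \<longleftrightarrow> (?g
      has_sum ?v) UNIV"
    by (rule has_sum_cong_neutral) (auto simp: not_less_eq_eq)
  finally show "(?g
      has_sum fps_nth ((fps_X + fps_const d) * h) t) UNIV"
    by (simp add: ring_distribs add_ac)
qed

text \<open>The series that is shifted generates column \<open>u\<close> of \<open>osc c e\<close>,
  so this is the action of an annihilation part on a second operator, as needed in
  \<open>osc_compose\<close>.\<close>

lemma taylor_shift_power_exp:
  "taylor_shift d ((fps_X + fps_const e) ^ u * fps_exp c)
     ((fps_X + fps_const (d + e)) ^ u * (fps_const (exp (d * c)) * fps_exp c))"
proof (induction u)
  case (Suc u)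
  have eq: "(x + y) ^ Suc u * k = x * ((x + y) ^ u * k) + y * ((x + y) ^ u * k)" for x y k :: "'a fps"
    by (simp add: algebra_simps)
  have de: "fps_X + fps_const (d + e) = (fps_X + fps_const d) + fps_const e"
    by (simp add: add.assoc)
  show ?case
    using taylor_shift_add[OF taylor_shift_X_mult[OF Suc.IH] taylor_shift_cmult[OF Suc.IH, of e]]
    unfolding de eq .
qed (simp add: taylor_shift_exp)

text \<open>Matrix coefficients, in the basis of monomials, of the operator
  \<open>f(x) \<mapsto> exp (c x) f(x + d)\<close> on polynomials.\<close>

definition osc :: "'a::{banach, real_normed_field} \<Rightarrow> 'a \<Rightarrow> nat \<Rightarrow> nat \<Rightarrow> 'a" where
  "osc c d r s = fps_nth (fps_exp c * (fps_X + fps_const d) ^ s) r"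

lemma fps_nth_X_plus_const_power:
  "fps_nth ((fps_X + fps_const (d::'a::comm_ring_1)) ^ s) t = of_nat (s choose t) * d ^ (s - t)"
proof -
  have "fps_nth (of_nat n * fps_X ^ k * fps_const d ^ m) t = of_nat n * (if t = k then 1 else 0) * d ^ m"
    for n k m by (simp add: mult.assoc flip: fps_of_nat)
  hence "fps_nth ((fps_X + fps_const d) ^ s) t =
      (\<Sum>k\<le>s. of_nat (s choose k) * (if t = k then 1 else 0) * d ^ (s - k))"
    by (simp only: binomial_ring fps_sum_nth)
  also have "\<dots> = of_nat (s choose t) * d ^ (s - t)"
    by (cases "t \<le> s") (auto simp: sum.remove[of _ t] binomial_eq_0)
  finally show ?thesis .
qed

text \<open>The index \<open>t\<close> counts the factors that are left untouched:
  \<open>s - t\<close> are annihilated and \<open>r - t\<close> are created.\<close>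

lemma osc_altdef:
  "osc c d r s = (\<Sum>t\<le>r. c ^ (r - t) / fact (r - t) * (of_nat (s choose t) * d ^ (s - t)))"
proof -
  have "osc c d r s = fps_nth ((fps_X + fps_const d) ^ s * fps_exp c) r"
    by (simp add: osc_def mult.commute)
  also have "\<dots> = (\<Sum>t\<le>r. c ^ (r - t) / fact (r - t) * (of_nat (s choose t) * d ^ (s - t)))"
    unfolding fps_mult_nth fps_nth_X_plus_const_power atLeast0AtMost fps_exp_nth of_nat_fact
    by (simp only: mult_ac)
  finally show ?thesis .
qed

lemma osc_0_0 [simp]: "osc c d 0 0 = 1"
  by (simp add: osc_altdef)

lemma osc_zero: "osc 0 0 r s = (if r = s then 1 else 0)"
  by (simp add: osc_def fps_const_0_eq_0)

lemma osc_nonneg: "c \<ge> 0 \<Longrightarrow> d \<ge> 0 \<Longrightarrow> osc c d r s \<ge> (0::real)"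
  by (auto simp: osc_altdef intro!: sum_nonneg)

lemma norm_osc_le: "norm (osc c d r s) \<le> osc (norm c) (norm d) r s"
  unfolding osc_altdef
  by (rule sum_norm_le) (simp add: norm_mult norm_divide norm_power)

text \<open>Conjugation by the dilation that multiplies the monomial of degree \<open>r\<close> by
  \<open>x ^ r\<close>.\<close>

lemma osc_scale:
  assumes "x \<noteq> 0"
  shows "osc (c * x) (d / x) r s = x ^ r / x ^ s * osc c d r s"
  unfolding osc_altdef sum_distrib_left
proof (rule sum.cong)
  fix t assume "t \<in> {..r}"
  show "(c * x) ^ (r - t) / fact (r - t) * (of_nat (s choose t) * (d / x) ^ (s - t)) =
    x ^ r / x ^ s * (c ^ (r - t) / fact (r - t) * (of_nat (s choose t) * d ^ (s - t)))"
  proof (cases "t \<le> s")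
    case True
    have "x ^ r = x ^ (r - t) * x ^ t" "x ^ s = x ^ (s - t) * x ^ t"
      using True \<open>t \<in> {..r}\<close> by (simp_all flip: power_add)
    thus ?thesis using assms by (simp add: power_mult_distrib power_divide field_simps)
  qed (simp add: binomial_eq_0)
qed auto

text \<open>The intermediate degree \<open>s\<close> is unbounded, but the only infinite sum is the
  shift by \<open>d1\<close> of column \<open>u\<close> of the second operator. Multiplication by
  \<open>fps_exp c1\<close> is a finite convolution and commutes with it.\<close>

lemma osc_compose:
  "((\<lambda>s. osc c1 d1 r s * osc c2 d2 s u) has_sum exp (d1 * c2) * osc (c1 + c2) (d1 + d2) r u) UNIV"
proof -
  let ?f = "(fps_X + fps_const d2) ^ u * fps_exp c2"
  let ?h = "(fps_X + fps_const (d1 + d2)) ^ u * (fps_const (exp (d1 * c2)) * fps_exp c2)"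
  have T: "((\<lambda>s. fps_nth ?f s * (of_nat (s choose t) * d1 ^ (s - t))) has_sum fps_nth ?h t) UNIV" for t
    using taylor_shift_power_exp[of d1 d2 u c2] by (simp add: taylor_shift_def)
  have "((\<lambda>s. \<Sum>t\<le>r. c1 ^ (r - t) / fact (r - t) * (fps_nth ?f s * (of_nat (s choose t) * d1 ^ (s - t))))
      has_sum (\<Sum>t\<le>r. c1 ^ (r - t) / fact (r - t) * fps_nth ?h t)) UNIV"
    by (intro has_sum_sum has_sum_cmult_right T)
  also have "(\<Sum>t\<le>r. c1 ^ (r - t) / fact (r - t) * fps_nth ?h t) = fps_nth (?h * fps_exp c1) r"
    unfolding fps_mult_nth[of ?h "fps_exp c1"] by (simp add: atLeast0AtMost mult_ac)
  also have "?h * fps_exp c1 =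
      fps_const (exp (d1 * c2)) * (fps_exp (c1 + c2) * (fps_X + fps_const (d1 + d2)) ^ u)"
    unfolding fps_exp_add_mult by (simp only: mult_ac)
  also have "fps_nth \<dots> r = exp (d1 * c2) * osc (c1 + c2) (d1 + d2) r u"
    unfolding fps_mult_left_const_nth osc_def ..
  also have "(\<lambda>s. \<Sum>t\<le>r. c1 ^ (r - t) / fact (r - t) * (fps_nth ?f s * (of_nat (s choose t) * d1 ^ (s - t))))
      = (\<lambda>s. osc c1 d1 r s * osc c2 d2 s u)"
    unfolding osc_altdef[of c1] osc_def[of c2] sum_distrib_right
    by (intro ext sum.cong) (simp_all only: mult_ac)
  finally show ?thesis .
qed

lemma has_abs_sum_osc_compose:
  "has_abs_sum (\<lambda>s. osc c1 d1 r s * osc c2 d2 s u) (exp (d1 * c2) * osc (c1 + c2) (d1 + d2) r u)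
     (exp (norm d1 * norm c2) * osc (norm c1 + norm c2) (norm d1 + norm d2) r u) UNIV"
proof (rule has_abs_sum_comparison[OF osc_compose osc_compose])
  show "norm (osc c1 d1 r s * osc c2 d2 s u) \<le>
      osc (norm c1) (norm d1) r s * osc (norm c2) (norm d2) s u" for s
    unfolding norm_mult by (intro mult_mono norm_osc_le osc_nonneg) simp_all
qed

text \<open>Multiplying by the geometric series raises \<open>j\<close>: the Cauchy product sums
  \<open>i choose j\<close> over \<open>i \<le> k\<close>, which the hockey-stick identity turns
  into \<open>Suc k choose Suc j\<close>.\<close>

lemma sums_choose_power:
  fixes t :: "'a::{banach, real_normed_field}"
  assumes t: "norm t < 1"
  shows "summable (\<lambda>s. norm (of_nat (s choose j) * t ^ s)) \<and>
         (\<lambda>s. of_nat (s choose j) * t ^ s) sums (t ^ j / (1 - t) ^ Suc j)"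
proof (induction j)
  case 0
  show ?case using t geometric_sums[OF t] by (simp add: norm_power summable_geometric)
next
  case (Suc j)
  have g: "summable (\<lambda>s. norm (t ^ s))" using t by (simp add: norm_power summable_geometric)
  \<comment> \<open>Stated over a fresh type, as it serves both \<open>t\<close> and the real number
    \<open>norm t\<close>.\<close>
  have eq: "(\<Sum>i\<le>k. (of_nat (i choose j) * t ^ i) * t ^ (k - i)) = of_nat (Suc k choose Suc j) * t ^ k"
    for k and t :: "'b::{banach, real_normed_field}"
  proof -
    have "(\<Sum>i\<le>k. (of_nat (i choose j) * t ^ i) * t ^ (k - i)) = (\<Sum>i\<le>k. of_nat (i choose j) * t ^ k)"
      by (intro sum.cong) (auto simp: mult.assoc simp flip: power_add)
    also have "\<dots> = of_nat (\<Sum>i\<le>k. i choose j) * t ^ k" by (simp add: sum_distrib_right)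
    finally show ?thesis by (simp only: sum_choose_upper)
  qed
  have "(\<lambda>k. of_nat (Suc k choose Suc j) * t ^ k) sums (t ^ j / (1 - t) ^ Suc j * (1 / (1 - t)))"
    using Cauchy_product_sums[OF conjunct1[OF Suc.IH] g] Suc.IH geometric_sums[OF t]
    by (simp add: eq sums_iff)
  hence "(\<lambda>k. t * (of_nat (Suc k choose Suc j) * t ^ k)) sums (t * (t ^ j / (1 - t) ^ Suc j * (1 / (1 - t))))"
    by (rule sums_mult)
  hence 1: "(\<lambda>k. of_nat (Suc k choose Suc j) * t ^ Suc k) sums (t ^ Suc j / (1 - t) ^ Suc (Suc j))"
    by (simp add: mult_ac)
  have s: "(\<lambda>s. of_nat (s choose Suc j) * t ^ s) sums (t ^ Suc j / (1 - t) ^ Suc (Suc j))"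
    using 1 by (subst (asm) sums_Suc_iff) simp
  have g': "summable (\<lambda>s. norm (norm t ^ s))" using t by (simp add: summable_geometric)
  have a': "summable (\<lambda>s. norm (of_nat (s choose j) * norm t ^ s))"
    using Suc.IH by (simp add: norm_mult norm_power)
  have "summable (\<lambda>k. of_nat (Suc k choose Suc j) * norm t ^ k)"
    using Cauchy_product_sums[OF a' g'] unfolding eq by (rule sums_summable)
  from summable_mult[OF this, of "norm t"]
  have "summable (\<lambda>k. norm (of_nat (Suc k choose Suc j) * t ^ Suc k))"
    by (simp add: norm_mult norm_power mult_ac del: binomial_Suc_Suc of_nat_add)
  hence "summable (\<lambda>s. norm (of_nat (s choose Suc j) * t ^ s))"
    by (subst (asm) summable_Suc_iff)
  with s show ?case by blast
qed

lemma has_sum_choose_power: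
  fixes t :: "'a::{banach, real_normed_field}"
  assumes t: "norm t < 1"
  shows "((\<lambda>s. of_nat (s choose j) * t ^ s) has_sum (t ^ j / (1 - t) ^ Suc j)) UNIV"
  using norm_summable_imp_has_sum[OF conjunct1 conjunct2, OF sums_choose_power[OF t] sums_choose_power[OF t]] .

text \<open>On the diagonal as many factors are annihilated as are created. With this number as
  \<open>j\<close>, the sum over \<open>s\<close> is done first by
  \<open>has_sum_choose_power\<close>, and what remains is an exponential series in
  \<open>j\<close>.\<close>

lemma osc_trace:
  fixes c d t :: "'a::{banach, real_normed_field}"
  assumes t: "norm t < 1"
  shows "((\<lambda>s. t ^ s * osc c d s s) has_sum exp (c * d * (t / (1 - t))) / (1 - t)) UNIV"
proof -
  define F where "F s j = (c * d) ^ j / fact j * (of_nat (s choose j) * t ^ s)" for s j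
  have t1: "1 - t \<noteq> 0" using t by auto
  have "norm (norm t) < 1" using t by simp
  note C = has_sum_choose_power[OF this]
  have 1: "has_abs_sum (\<lambda>s. F s j) ((c * d) ^ j / fact j * (t ^ j / (1 - t) ^ Suc j))
      (norm (c * d) ^ j / fact j * (norm t ^ j / (1 - norm t) ^ Suc j)) UNIV" for j
    unfolding F_def
    by (rule has_abs_sum_comparison[OF has_sum_cmult_right[OF has_sum_choose_power[OF t]]
          has_sum_cmult_right[OF C]]) (simp add: norm_mult norm_divide norm_power)
  have 2: "((\<lambda>j. x ^ j / fact j * (u ^ j / (1 - u) ^ Suc j)) has_sum exp (x * (u / (1 - u))) / (1 - u)) UNIV"
    for x u :: "'b::{banach, real_normed_field}"
  proof -
    have "(x * (u / (1 - u))) ^ j / fact j * (1 / (1 - u)) = x ^ j / fact j * (u ^ j / (1 - u) ^ Suc j)" for j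
      by (simp add: power_mult_distrib power_divide)
    thus ?thesis
      using has_sum_cmult_left[OF has_sum_exp[of "x * (u / (1 - u))"], of "1 / (1 - u)"] by simp
  qed
  have 3: "(F s has_sum t ^ s * osc c d s s) UNIV" for s
  proof (rule has_sum_finite_neutralI[of "{..s}"])
    \<comment> \<open>The index of \<open>osc_altdef\<close> counts surviving factors, that of
      \<open>F\<close> the annihilated ones.\<close>
    have "(\<Sum>j\<le>s. F s j) = (\<Sum>j\<le>s. F s (s - j))"
      by (rule sum.reindex_bij_witness[of _ "\<lambda>j. s - j" "\<lambda>j. s - j"]) auto
    also have "\<dots> = t ^ s * osc c d s s"
      unfolding osc_altdef sum_distrib_left F_def
    proof (intro sum.cong refl)
      fix j assume "j \<in> {..s}"
      hence "s choose (s - j) = s choose j" using binomial_symmetric[of j s] by simp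
      thus "(c * d) ^ (s - j) / fact (s - j) * (of_nat (s choose (s - j)) * t ^ s) =
        t ^ s * (c ^ (s - j) / fact (s - j) * (of_nat (s choose j) * d ^ (s - j)))"
        by (simp add: power_mult_distrib)
    qed
    finally show "t ^ s * osc c d s s = (\<Sum>j\<le>s. F s j)" ..
  qed (auto simp: F_def binomial_eq_0)
  show ?thesis
    using has_sum_fubini[OF 1 2 2 3] by (simp add: has_abs_sum_def)
qed

lemma has_abs_sum_osc_trace:
  assumes t: "norm t < 1"
  shows "has_abs_sum (\<lambda>s. t ^ s * osc c d s s) (exp (c * d * (t / (1 - t))) / (1 - t))
    (exp (norm c * norm d * (norm t / (1 - norm t))) / (1 - norm t)) UNIV"
proof (rule has_abs_sum_comparison[OF osc_trace[OF t] osc_trace])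
  show "norm (norm t) < 1" using t by simp
  show "norm (t ^ s * osc c d s s) \<le> norm t ^ s * osc (norm c) (norm d) s s" for s
    unfolding norm_mult norm_power by (rule mult_left_mono[OF norm_osc_le]) simp
qed

section \<open>Vertex operators on the Fock space\<close>

text \<open>The degree in \<open>M\<close>, which is the \<open>L(0)\<close> eigenvalue up to the
  shift by half the norm of the lattice vector. The index \<open>k\<close> stands for the mode
  \<open>a(-k-1)\<close>, hence \<open>Suc k\<close>.\<close>

definition weight :: "nat multiset \<Rightarrow> nat" where
  "weight \<mu> = (\<Sum>k\<in>#\<mu>. Suc k)"

lemma weight_simps [simp]:
  "weight {#} = 0" "weight (add_mset k \<mu>) = Suc k + weight \<mu>"
  "weight (\<mu> + \<nu>) = weight \<mu> + weight \<nu>"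
  by (simp_all add: weight_def)

lemma count_support_subset:
  assumes "\<And>k. g k 0 = 1"
  shows "{k. g k (count \<mu> k) \<noteq> 1} \<subseteq> set_mset \<mu>"
proof
  fix k assume "k \<in> {k. g k (count \<mu> k) \<noteq> 1}"
  thus "k \<in># \<mu>" using assms[of k] by (cases "k \<in># \<mu>") (auto simp: not_in_iff)
qed

lemma power_weight: "t ^ weight \<mu> = Prod_any (\<lambda>k. (t ^ Suc k) ^ count \<mu> k)"
proof -
  have "t ^ weight \<mu> = (\<Prod>k\<in>#\<mu>. t ^ Suc k)"
    by (induction \<mu>) (simp_all add: power_add mult_ac)
  also have "\<dots> = (\<Prod>k\<in>set_mset \<mu>. (t ^ Suc k) ^ count \<mu> k)"
    by (rule image_prod_mset_multiplicity)
  also have "\<dots> = Prod_any (\<lambda>k. (t ^ Suc k) ^ count \<mu> k)"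
    by (rule Prod_any.expand_superset[symmetric, OF _ count_support_subset]) simp_all
  finally show ?thesis .
qed

text \<open>The tensor product of the one-variable operators over all modes. Since
  \<open>osc c d 0 0 = 1\<close>, only the modes that occur in \<open>\<rho>\<close> or
  \<open>\<sigma>\<close> contribute, and the product is finite for all parameters.\<close>

definition fock_kernel ::
    "(nat \<Rightarrow> 'a::{banach, real_normed_field}) \<Rightarrow> (nat \<Rightarrow> 'a) \<Rightarrow> nat multiset \<Rightarrow> nat multiset \<Rightarrow> 'a" where
  "fock_kernel c d \<rho> \<sigma> = Prod_any (\<lambda>k. osc (c k) (d k) (count \<rho> k) (count \<sigma> k))"

lemma finite_osc_support: "finite {k. osc (c k) (d k) (count \<rho> k) (count \<sigma> k) \<noteq> 1}"
  by (rule finite_subset[of _ "set_mset \<rho> \<union> set_mset \<sigma>"])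
     (auto simp: count_eq_zero_iff, metis count_eq_zero_iff osc_0_0)

lemma fock_kernel_expand:
  assumes "set_mset \<rho> \<union> set_mset \<sigma> \<subseteq> K" "finite K"
  shows "fock_kernel c d \<rho> \<sigma> = (\<Prod>k\<in>K. osc (c k) (d k) (count \<rho> k) (count \<sigma> k))"
  unfolding fock_kernel_def
  by (rule Prod_any.expand_superset)
     (use assms in \<open>auto simp: count_eq_zero_iff\<close>, metis Un_subset_iff count_eq_zero_iff in_mono osc_0_0)

lemma fock_kernel_zero: "fock_kernel (\<lambda>_. 0) (\<lambda>_. 0) \<rho> \<sigma> = (if \<rho> = \<sigma> then 1 else 0)"
proof (cases "\<rho> = \<sigma>")
  case False
  then obtain k where k: "count \<rho> k \<noteq> count \<sigma> k" by (auto simp: multiset_eq_iff)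
  hence "k \<in> set_mset \<rho> \<union> set_mset \<sigma>" by (metis Un_iff count_eq_zero_iff)
  with False k show ?thesis
    by (subst fock_kernel_expand[OF order.refl]) (auto simp: osc_zero)
qed (simp add: fock_kernel_def osc_zero)

lemma fock_kernel_nonneg:
  "(\<And>k. c k \<ge> 0) \<Longrightarrow> (\<And>k. d k \<ge> 0) \<Longrightarrow> fock_kernel c d \<rho> \<sigma> \<ge> (0::real)"
  by (subst fock_kernel_expand[OF order.refl]) (auto intro!: prod_nonneg osc_nonneg)

lemma norm_fock_kernel_le:
  "norm (fock_kernel c d \<rho> \<sigma>) \<le> fock_kernel (\<lambda>k. norm (c k)) (\<lambda>k. norm (d k)) \<rho> \<sigma>"
  by (subst (1 2) fock_kernel_expand[OF order.refl])
     (auto simp: norm_osc_le simp flip: prod_norm intro!: prod_mono)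

lemma prod_osc_eventually:
  "\<exists>N1. \<forall>N\<ge>N1. \<forall>c d. (\<Prod>k<N. osc (c k) (d k) (count \<rho> k) (count \<mu> k) :: 'a::{banach, real_normed_field})
     = fock_kernel c d \<rho> \<mu>"
proof -
  obtain N1 where "set_mset \<rho> \<union> set_mset \<mu> \<subseteq> {..<N1}"
    using finite_nat_iff_bounded[of "set_mset \<rho> \<union> set_mset \<mu>"] by auto
  hence *: "set_mset \<rho> \<union> set_mset \<mu> \<subseteq> {..<N}" if "N \<ge> N1" for N using that by fastforce
  show ?thesis by (intro exI[of _ N1] allI impI fock_kernel_expand[symmetric] *) auto
qed

text \<open>The power of the insertion point dictated by the difference of weights is absorbed into
  the parameters of the operator.\<close>

lemma fock_kernel_scale:
  assumes "x \<noteq> (0::'a::{banach, real_normed_field})"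
  shows "fock_kernel (\<lambda>k. c k * x ^ Suc k) (\<lambda>k. d k / x ^ Suc k) \<rho> \<sigma> =
    x ^ weight \<rho> / x ^ weight \<sigma> * fock_kernel c d \<rho> \<sigma>"
proof -
  define K where "K = set_mset \<rho> \<union> set_mset \<sigma>"
  have K: "set_mset \<rho> \<union> set_mset \<sigma> \<subseteq> K" "finite K" by (auto simp: K_def)
  have P: "x ^ weight \<mu> = (\<Prod>k\<in>K. (x ^ Suc k) ^ count \<mu> k)" if "set_mset \<mu> \<subseteq> K" for \<mu>
    unfolding power_weight
    by (rule Prod_any.expand_superset[OF K(2) order.trans[OF count_support_subset that]]) simp
  have "fock_kernel (\<lambda>k. c k * x ^ Suc k) (\<lambda>k. d k / x ^ Suc k) \<rho> \<sigma> =
      (\<Prod>k\<in>K. (x ^ Suc k) ^ count \<rho> k / (x ^ Suc k) ^ count \<sigma> k * osc (c k) (d k) (count \<rho> k) (count \<sigma> k))"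
    unfolding fock_kernel_expand[OF K] using assms by (intro prod.cong osc_scale) auto
  thus ?thesis
    using P[of \<rho>] P[of \<sigma>] K(1)
    by (simp only: prod.distrib prod_dividef fock_kernel_expand[OF K]) simp
qed

text \<open>Composition mode by mode. The \<open>osc\<close> factors are 1 from some mode on, so
  only the scalars \<open>exp (d1 k * c2 k)\<close> form an infinite product; the assumption makes
  it converge, and the bound is the same formula for norms.\<close>

lemma fock_kernel_compose:
  fixes c1 d1 c2 d2 :: "nat \<Rightarrow> 'a::{banach, real_normed_field}"
  assumes sm: "summable (\<lambda>k. norm (d1 k) * norm (c2 k))"
  shows "has_abs_sum (\<lambda>\<sigma>. fock_kernel c1 d1 \<rho> \<sigma> * fock_kernel c2 d2 \<sigma> \<mu>)
    (exp (suminf (\<lambda>k. d1 k * c2 k)) * fock_kernel (\<lambda>k. c1 k + c2 k) (\<lambda>k. d1 k + d2 k) \<rho> \<mu>)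
    (exp (suminf (\<lambda>k. norm (d1 k) * norm (c2 k))) *
       fock_kernel (\<lambda>k. norm (c1 k) + norm (c2 k)) (\<lambda>k. norm (d1 k) + norm (d2 k)) \<rho> \<mu>) UNIV"
proof -
  have sm': "summable (\<lambda>k. d1 k * c2 k)"
    by (rule summable_norm_cancel) (use sm in \<open>simp add: norm_mult\<close>)
  obtain N1 where N1: "\<And>N c d. N \<ge> N1 \<Longrightarrow>
      (\<Prod>k<N. osc (c k) (d k) (count \<rho> k) (count \<mu> k) :: 'a) = fock_kernel c d \<rho> \<mu>"
    using prod_osc_eventually by blast
  obtain N2 where N2: "\<And>N c d. N \<ge> N2 \<Longrightarrow>
      (\<Prod>k<N. osc (c k) (d k) (count \<rho> k) (count \<mu> k) :: real) = fock_kernel c d \<rho> \<mu>"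
    using prod_osc_eventually by blast
  let ?f = "\<lambda>k s. osc (c1 k) (d1 k) (count \<rho> k) s * osc (c2 k) (d2 k) s (count \<mu> k)"
  have eq: "(\<lambda>\<sigma>. fock_kernel c1 d1 \<rho> \<sigma> * fock_kernel c2 d2 \<sigma> \<mu>) =
      (\<lambda>\<sigma>. Prod_any (\<lambda>k. ?f k (count \<sigma> k)))"
    unfolding fock_kernel_def by (intro ext Prod_any.distrib[symmetric] finite_osc_support)
  have fin: "finite {k. ?f k 0 \<noteq> 1}"
    by (rule finite_subset[of _ "set_mset \<rho> \<union> set_mset \<mu>"]) (auto, metis count_eq_zero_iff osc_0_0 mult_1)
  have lim: "(\<lambda>N. \<Prod>k<N. exp (d1 k * c2 k) * osc (c1 k + c2 k) (d1 k + d2 k) (count \<rho> k) (count \<mu> k))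
      \<longlonglongrightarrow> exp (suminf (\<lambda>k. d1 k * c2 k)) * fock_kernel (\<lambda>k. c1 k + c2 k) (\<lambda>k. d1 k + d2 k) \<rho> \<mu>"
    unfolding prod.distrib exp_sum[OF finite_lessThan, symmetric]
  proof (intro tendsto_mult tendsto_exp summable_LIMSEQ sm')
    show "(\<lambda>N. \<Prod>k<N. osc (c1 k + c2 k) (d1 k + d2 k) (count \<rho> k) (count \<mu> k))
      \<longlonglongrightarrow> fock_kernel (\<lambda>k. c1 k + c2 k) (\<lambda>k. d1 k + d2 k) \<rho> \<mu>"
      by (rule tendsto_eventually) (auto simp: eventually_at_top_linorder intro!: exI[of _ N1] N1)
  qed
  have bound: "(\<Prod>k<N. exp (norm (d1 k) * norm (c2 k)) * osc (norm (c1 k) + norm (c2 k))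
         (norm (d1 k) + norm (d2 k)) (count \<rho> k) (count \<mu> k)) \<le>
      exp (suminf (\<lambda>k. norm (d1 k) * norm (c2 k))) *
       fock_kernel (\<lambda>k. norm (c1 k) + norm (c2 k)) (\<lambda>k. norm (d1 k) + norm (d2 k)) \<rho> \<mu>"
    if "N \<ge> N2" for N
    unfolding prod.distrib exp_sum[OF finite_lessThan, symmetric] N2[OF that]
    by (intro mult_right_mono fock_kernel_nonneg) (auto intro!: sum_le_suminf sm)
  show ?thesis
    unfolding eq
    by (rule has_sum_multiset_Prod_any[OF fin has_abs_sum_osc_compose lim bound])
qed

abbreviation lambert :: "'a::{banach, real_normed_field} \<Rightarrow> nat \<Rightarrow> 'a" where
  "lambert t k \<equiv> t ^ Suc k / (1 - t ^ Suc k)"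

abbreviation trace_value :: "(nat \<Rightarrow> 'a::{banach, real_normed_field}) \<Rightarrow> (nat \<Rightarrow> 'a) \<Rightarrow> 'a \<Rightarrow> 'a" where
  "trace_value c d t \<equiv>
     exp (suminf (\<lambda>k. c k * d k * lambert t k)) / prodinf (\<lambda>k. 1 - t ^ Suc k)"

lemma fock_kernel_trace:
  fixes c d :: "nat \<Rightarrow> 'a::{banach, real_normed_field}"
  assumes t: "norm t < 1"
    and sm: "summable (\<lambda>k. norm (c k) * norm (d k) * norm t ^ Suc k)"
  shows "\<exists>Q. has_abs_sum (\<lambda>\<mu>. t ^ weight \<mu> * fock_kernel c d \<mu> \<mu>)
    (trace_value c d t) Q UNIV"
    and "summable (\<lambda>k. c k * d k * lambert t k)"
    and "prodinf (\<lambda>k. 1 - t ^ Suc k) \<noteq> 0"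
proof -
  \<comment> \<open>Stated for an arbitrary field, because it is applied to the given data and again
    to their norms over the reals.\<close>
  have L: "(\<lambda>N. \<Prod>k<N. exp (c k * d k * lambert t k) / (1 - t ^ Suc k))
      \<longlonglongrightarrow> trace_value c d t \<and>
      summable (\<lambda>k. c k * d k * lambert t k) \<and> prodinf (\<lambda>k. 1 - t ^ Suc k) \<noteq> 0"
    if t: "norm t < 1" and sm: "summable (\<lambda>k. norm (c k) * norm (d k) * norm t ^ Suc k)"
    for c d :: "nat \<Rightarrow> 'b::{banach, real_normed_field}" and t
  proof -
    have pw: "norm t ^ Suc k \<le> norm t" for k
      using t power_le_one[of "norm t" k] by (simp add: mult_left_le)
    have S: "summable (\<lambda>k. c k * d k * lambert t k)"
    proof (rule summable_comparison_test)
      show "summable (\<lambda>k. norm (c k) * norm (d k) * norm t ^ Suc k * (1 / (1 - norm t)))"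
        by (rule summable_mult2[OF sm])
      have "norm (lambert t k) \<le> norm t ^ Suc k * (1 / (1 - norm t))" for k
      proof -
        have "1 - norm t \<le> norm (1 - t ^ Suc k)"
          using norm_triangle_ineq2[of 1 "t ^ Suc k"] pw[of k] by (simp add: norm_power norm_mult)
        thus ?thesis using t unfolding norm_divide norm_power
          by (simp add: frac_le)
      qed
      thus "\<exists>N. \<forall>n\<ge>N. norm (c n * d n * lambert t n) \<le>
          norm (c n) * norm (d n) * norm t ^ Suc n * (1 / (1 - norm t))"
        unfolding norm_mult[of "_ * _"] norm_mult[of "c _"]
        by (intro exI[of _ 0] allI impI) (simp only: mult.assoc mult_left_mono norm_ge_zero)
    qed
    have ac: "abs_convergent_prod (\<lambda>k. 1 - t ^ Suc k)"
      unfolding abs_convergent_prod_conv_summable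
      using t by (simp add: norm_mult norm_power summable_mult summable_geometric)
    hence cp: "convergent_prod (\<lambda>k. 1 - t ^ Suc k)" by (rule abs_convergent_prod_imp_convergent_prod)
    have nz: "1 - t ^ Suc k \<noteq> 0" for k
      using t pw[of k] by (metis eq_iff_diff_eq_0 norm_one norm_power not_le)
    have p: "prodinf (\<lambda>k. 1 - t ^ Suc k) \<noteq> 0"
      using prodinf_nonzero[OF cp nz] .
    have "(\<lambda>N. \<Prod>k<N. 1 - t ^ Suc k) \<longlonglongrightarrow> prodinf (\<lambda>k. 1 - t ^ Suc k)"
      using convergent_prod_LIMSEQ[OF cp] by (subst LIMSEQ_lessThan_iff_atMost)
    hence "(\<lambda>N. exp (\<Sum>k<N. c k * d k * lambert t k) / (\<Prod>k<N. 1 - t ^ Suc k))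
        \<longlonglongrightarrow> trace_value c d t"
      using p by (intro tendsto_divide tendsto_exp summable_LIMSEQ S)
    thus ?thesis using S p by (simp only: prod_dividef exp_sum[OF finite_lessThan] simp_thms)
  qed
  show "summable (\<lambda>k. c k * d k * lambert t k)" "prodinf (\<lambda>k. 1 - t ^ Suc k) \<noteq> 0"
    using L[OF t sm] by blast+
  \<comment> \<open>By \<open>L\<close> for the norms, the partial products of the bounds converge
    and are therefore bounded, which yields \<open>Q\<close>.\<close>
  let ?T = "\<lambda>k. exp (norm (c k) * norm (d k) * (norm (t ^ Suc k) / (1 - norm (t ^ Suc k)))) / (1 - norm (t ^ Suc k))"
  have "convergent (\<lambda>N. \<Prod>k<N. ?T k)"
    using L[of "norm t" "\<lambda>k. norm (c k)" "\<lambda>k. norm (d k)"] t sm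
    unfolding norm_power convergent_def by auto
  from convergent_imp_Bseq[OF this] obtain Q where Q': "norm (\<Prod>k<N. ?T k) \<le> Q" for N
    unfolding Bseq_def by blast
  have Q: "(\<Prod>k<N. ?T k) \<le> Q" if "N \<ge> 0" for N
    by (rule order.trans[OF _ Q'[of N]]) (simp only: real_norm_def abs_ge_self)
  have lt: "norm (t ^ Suc k) < 1" for k
    unfolding norm_power using t power_Suc_less_one[of "norm t"] by (cases "t = 0") auto
  let ?f = "\<lambda>k s. (t ^ Suc k) ^ s * osc (c k) (d k) s s"
  have eq: "(\<lambda>\<mu>. t ^ weight \<mu> * fock_kernel c d \<mu> \<mu>) =
      (\<lambda>\<mu>. Prod_any (\<lambda>k. ?f k (count \<mu> k)))"
    unfolding fock_kernel_def power_weight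
  proof (intro ext Prod_any.distrib[symmetric] finite_osc_support)
    show "finite {k. (t ^ Suc k) ^ count \<mu> k \<noteq> 1}" for \<mu>
      by (rule finite_subset[of _ "set_mset \<mu>"]) (auto, metis count_eq_zero_iff power_0)
  qed
  have fin: "finite {k. ?f k 0 \<noteq> 1}" by simp
  show "\<exists>Q. has_abs_sum (\<lambda>\<mu>. t ^ weight \<mu> * fock_kernel c d \<mu> \<mu>)
    (trace_value c d t) Q UNIV"
    unfolding eq
    by (intro exI, rule has_sum_multiset_Prod_any[OF fin has_abs_sum_osc_trace[OF lt] conjunct1[OF L[OF t sm]] Q])
qed

lemma finite_subset_mset: "finite {\<nu>. \<nu> \<subseteq># (\<sigma>::'b multiset)}"
proof -
  have "\<nu> \<in> mset ` {xs. set xs \<subseteq> set_mset \<sigma> \<and> length xs \<le> size \<sigma>}" if "\<nu> \<subseteq># \<sigma>" for \<nu>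
  proof -
    obtain xs where xs: "mset xs = \<nu>" using ex_mset by blast
    hence "set xs \<subseteq> set_mset \<sigma>" "length xs \<le> size \<sigma>"
      using that set_mset_mono[OF that] size_mset_mono[OF that] by auto
    thus ?thesis using xs by blast
  qed
  hence "{\<nu>. \<nu> \<subseteq># \<sigma>} \<subseteq> mset ` {xs. set xs \<subseteq> set_mset \<sigma> \<and> length xs \<le> size \<sigma>}" by blast
  thus ?thesis by (rule finite_subset) (intro finite_imageI finite_lists_length_le, simp)
qed

text \<open>The summand of \<open>osc_altdef\<close>, extended by 0 to all \<open>t\<close>, so that
  a product of these finite sums can be expanded by
  \<open>has_sum_multiset_Prod_any\<close>.\<close>

definition osc_term :: "'a::{banach, real_normed_field} \<Rightarrow> 'a \<Rightarrow> nat \<Rightarrow> nat \<Rightarrow> nat \<Rightarrow> 'a" where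
  "osc_term c d r s t =
     (if t \<le> r \<and> t \<le> s then c ^ (r - t) / fact (r - t) * (of_nat (s choose t) * d ^ (s - t)) else 0)"

lemma has_sum_osc_term: "(osc_term c d r s has_sum osc c d r s) UNIV"
  unfolding osc_altdef
  by (rule has_sum_finite_neutralI[of "{..r}"])
     (auto simp: osc_term_def binomial_eq_0 intro!: sum.cong)

lemma has_abs_sum_osc_term:
  "has_abs_sum (osc_term c d r s) (osc c d r s) (osc (norm c) (norm d) r s) UNIV"
  by (rule has_abs_sum_comparison[OF has_sum_osc_term has_sum_osc_term])
     (auto simp: osc_term_def norm_mult norm_divide norm_power)

text \<open>Expanding the product over the modes, the summation indices form the multiset
  \<open>\<tau>\<close> of surviving factors, while \<open>\<rho> - \<tau>\<close> is created and
  \<open>\<sigma> - \<tau>\<close> annihilated. In this form the kernel can be compared with the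
  normally ordered product of \<open>Y_minus\<close> and \<open>Y_plus\<close>.\<close>

lemma fock_kernel_altdef:
  fixes c d :: "nat \<Rightarrow> 'a::{banach, real_normed_field}"
  shows "fock_kernel c d \<rho> \<sigma> = (\<Sum>\<tau> | \<tau> \<subseteq># \<rho> \<and> \<tau> \<subseteq># \<sigma>.
     (\<Prod>k\<in>set_mset (\<rho> - \<tau>). c k ^ count (\<rho> - \<tau>) k / fact (count (\<rho> - \<tau>) k)) *
     (\<Prod>k\<in>set_mset (\<sigma> - \<tau>). d k ^ count (\<sigma> - \<tau>) k * of_nat (count \<sigma> k choose count (\<sigma> - \<tau>) k)))"
    (is "_ = (\<Sum>\<tau> | _. ?C \<tau> * ?D \<tau>)")
proof -
  define h where "h k t = osc_term (c k) (d k) (count \<rho> k) (count \<sigma> k) t" for k t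
  note h_def = h_def osc_term_def
  have ha: "has_abs_sum (h k) (osc (c k) (d k) (count \<rho> k) (count \<sigma> k))
      (osc (norm (c k)) (norm (d k)) (count \<rho> k) (count \<sigma> k)) UNIV" for k
    unfolding h_def(1) by (rule has_abs_sum_osc_term)
  have fin: "finite {k. h k 0 \<noteq> 1}"
  proof (rule finite_subset)
    show "{k. h k 0 \<noteq> 1} \<subseteq> set_mset \<rho> \<union> set_mset \<sigma>"
      by (auto simp: h_def not_in_iff[symmetric] split: if_splits) (metis not_in_iff power_0 diff_zero fact_0 div_by_1 mult_1)
  qed auto
  obtain N1 where N1: "\<And>N c d. N \<ge> N1 \<Longrightarrow>
      (\<Prod>k<N. osc (c k) (d k) (count \<rho> k) (count \<sigma> k) :: 'a) = fock_kernel c d \<rho> \<sigma>"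
    using prod_osc_eventually by blast
  obtain N2 where N2: "\<And>N c d. N \<ge> N2 \<Longrightarrow>
      (\<Prod>k<N. osc (c k) (d k) (count \<rho> k) (count \<sigma> k) :: real) = fock_kernel c d \<rho> \<sigma>"
    using prod_osc_eventually by blast
  have lim: "(\<lambda>N. \<Prod>k<N. osc (c k) (d k) (count \<rho> k) (count \<sigma> k)) \<longlonglongrightarrow> fock_kernel c d \<rho> \<sigma>"
    by (rule tendsto_eventually) (auto simp: eventually_at_top_linorder intro!: exI[of _ N1] N1)
  have S: "((\<lambda>\<tau>. Prod_any (\<lambda>k. h k (count \<tau> k))) has_sum fock_kernel c d \<rho> \<sigma>) UNIV"
    using has_sum_multiset_Prod_any[OF fin ha lim eq_refl[OF N2]] by (simp add: has_abs_sum_def)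
  have zero: "Prod_any (\<lambda>k. h k (count \<tau> k)) = 0" if "\<not> (\<tau> \<subseteq># \<rho> \<and> \<tau> \<subseteq># \<sigma>)" for \<tau>
  proof -
    from that obtain k where k: "\<not> (count \<tau> k \<le> count \<rho> k \<and> count \<tau> k \<le> count \<sigma> k)"
      by (auto simp: subseteq_mset_def)
    show ?thesis
    proof (rule Prod_any_zero)
      show "h k (count \<tau> k) = 0" using k by (auto simp: h_def)
      show "finite {k. h k (count \<tau> k) \<noteq> 1}"
      proof (rule finite_subset)
        show "{k. h k (count \<tau> k) \<noteq> 1} \<subseteq> {k. h k 0 \<noteq> 1} \<union> set_mset \<tau>"
          by (auto simp: not_in_iff)
      qed (use fin in auto)
    qed
  qed
  have nz: "Prod_any (\<lambda>k. h k (count \<tau> k)) = ?C \<tau> * ?D \<tau>" if "\<tau> \<subseteq># \<rho>" "\<tau> \<subseteq># \<sigma>" for \<tau>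
  proof -
    define K where "K = set_mset \<rho> \<union> set_mset \<sigma>"
    have K: "finite K" by (simp add: K_def)
    have le: "count \<tau> k \<le> count \<rho> k" "count \<tau> k \<le> count \<sigma> k" for k
      using that by (auto simp: subseteq_mset_def)
    have z: "count \<rho> k = 0" "count \<sigma> k = 0" "count \<tau> k = 0" if "k \<notin> K" for k
      using that le[of k] by (auto simp: K_def not_in_iff)
    have 1: "?C \<tau> = (\<Prod>k\<in>K. c k ^ count (\<rho> - \<tau>) k / fact (count (\<rho> - \<tau>) k))"
      by (rule prod.mono_neutral_left[OF K])
         (auto simp: K_def not_in_iff simp del: count_diff dest: in_diffD)
    have 2: "?D \<tau> = (\<Prod>k\<in>K. d k ^ count (\<sigma> - \<tau>) k * of_nat (count \<sigma> k choose count (\<sigma> - \<tau>) k))"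
      by (rule prod.mono_neutral_left[OF K])
         (auto simp: K_def not_in_iff simp del: count_diff dest: in_diffD)
    have "Prod_any (\<lambda>k. h k (count \<tau> k)) = (\<Prod>k\<in>K. h k (count \<tau> k))"
    proof (rule Prod_any.expand_superset[OF K], rule subsetI, rule ccontr)
      fix k assume k: "k \<in> {k. h k (count \<tau> k) \<noteq> 1}" "k \<notin> K"
      show False using k(1) by (simp add: h_def z[OF k(2)])
    qed
    also have "\<dots> = ?C \<tau> * ?D \<tau>"
      unfolding 1 2 prod.distrib[symmetric]
    proof (rule prod.cong[OF refl])
      fix k
      have "count \<sigma> k choose (count \<sigma> k - count \<tau> k) = count \<sigma> k choose count \<tau> k"
        using binomial_symmetric[OF le(2)[of k]] by simp
      thus "h k (count \<tau> k) = c k ^ count (\<rho> - \<tau>) k / fact (count (\<rho> - \<tau>) k) *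
         (d k ^ count (\<sigma> - \<tau>) k * of_nat (count \<sigma> k choose count (\<sigma> - \<tau>) k))"
        using le[of k] by (simp add: h_def)
    qed
    finally show ?thesis .
  qed
  let ?P = "{\<tau>. \<tau> \<subseteq># \<rho> \<and> \<tau> \<subseteq># \<sigma>}"
  have "finite ?P" by (rule finite_subset[OF _ finite_subset_mset[of \<rho>]]) auto
  hence "((\<lambda>\<tau>. Prod_any (\<lambda>k. h k (count \<tau> k))) has_sum (\<Sum>\<tau>\<in>?P. ?C \<tau> * ?D \<tau>)) UNIV"
    by (rule has_sum_finite_neutralI) (use zero nz in \<open>auto intro!: sum.cong\<close>)
  thus ?thesis using S by (rule has_sum_unique[rotated])
qed

section \<open>Linear operators on finitely supported functions\<close>

lemma lookup_smul [simp]: "Poly_Mapping.lookup (smul c v) b = c * Poly_Mapping.lookup v b"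
  by (simp add: smul_def Poly_Mapping.map.rep_eq when_def)

lemma smul_one [simp]: "smul 1 v = v"
  and smul_zero_left [simp]: "smul 0 v = 0"
  and smul_zero_right [simp]: "smul c 0 = 0"
  and smul_smul [simp]: "smul c (smul d v) = smul (c * d) v"
  and smul_add_right: "smul c (v + w) = smul c v + smul c w"
  and smul_add_left: "smul (c + d) v = smul c v + smul d v"
  and smul_sum_right: "smul c (sum f A) = (\<Sum>x\<in>A. smul c (f x))"
  and smul_sum_left: "smul (sum g A) v = (\<Sum>x\<in>A. smul (g x) v)"
  by (auto intro!: poly_mapping_eqI
      simp: lookup_add lookup_sum algebra_simps sum_distrib_left sum_distrib_right)

definition is_linear :: "(('b \<Rightarrow>\<^sub>0 complex) \<Rightarrow> ('c \<Rightarrow>\<^sub>0 complex)) \<Rightarrow> bool" where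
  "is_linear T \<longleftrightarrow> (\<forall>v w. T (v + w) = T v + T w) \<and> (\<forall>c v. T (smul c v) = smul c (T v))"

lemma is_linear_add: "is_linear T \<Longrightarrow> T (v + w) = T v + T w"
  and is_linear_smul: "is_linear T \<Longrightarrow> T (smul c v) = smul c (T v)"
  by (simp_all add: is_linear_def)

lemma is_linear_0: "is_linear T \<Longrightarrow> T 0 = 0"
  using is_linear_smul[of T 0 0] by simp

lemma is_linear_sum: "is_linear T \<Longrightarrow> T (sum f A) = (\<Sum>x\<in>A. T (f x))"
  by (induction A rule: infinite_finite_induct) (simp_all add: is_linear_0 is_linear_add)

lemma is_linear_compose: "is_linear S \<Longrightarrow> is_linear T \<Longrightarrow> is_linear (\<lambda>v. S (T v))"
  by (simp add: is_linear_def)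

lemma is_linear_smul_op: "is_linear T \<Longrightarrow> is_linear (\<lambda>v. smul c (T v))"
  by (simp add: is_linear_def smul_add_right mult.commute)

lemma is_linear_sum_op: "(\<And>i. i \<in> I \<Longrightarrow> is_linear (T i)) \<Longrightarrow> is_linear (\<lambda>v. \<Sum>i\<in>I. T i v)"
  by (simp add: is_linear_def smul_sum_right sum.distrib)

lemma is_linear_foldr: "(\<And>n. is_linear (X n)) \<Longrightarrow> is_linear (foldr X ns)"
  by (induction ns) (auto simp: is_linear_def)

lemma basis_expansion:
  "v = (\<Sum>b\<in>Poly_Mapping.keys v. smul (Poly_Mapping.lookup v b) (Poly_Mapping.single b 1))"
proof (rule poly_mapping_eqI)
  fix b
  have "(\<Sum>x\<in>Poly_Mapping.keys v. Poly_Mapping.lookup v x * (1 when x = b)) =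
      (\<Sum>x\<in>Poly_Mapping.keys v. if x = b then Poly_Mapping.lookup v x else 0)"
    by (intro sum.cong) auto
  thus "Poly_Mapping.lookup v b = Poly_Mapping.lookup
      (\<Sum>b\<in>Poly_Mapping.keys v. smul (Poly_Mapping.lookup v b) (Poly_Mapping.single b 1)) b"
    by (simp add: lookup_sum lookup_single in_keys_iff)
qed

lemma is_linear_expand:
  assumes "is_linear T"
  shows "T v = (\<Sum>b\<in>Poly_Mapping.keys v. smul (Poly_Mapping.lookup v b) (T (Poly_Mapping.single b 1)))"
  by (subst basis_expansion[of v]) (simp add: is_linear_sum[OF assms] is_linear_smul[OF assms])

lemma lin_ext_superset:
  assumes "finite S" "Poly_Mapping.keys v \<subseteq> S"
  shows "lin_ext f v = (\<Sum>b\<in>S. smul (Poly_Mapping.lookup v b) (f b))"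
  unfolding lin_ext_def using assms
  by (intro sum.mono_neutral_left) (auto simp: in_keys_iff)

lemma is_linear_lin_ext: "is_linear (lin_ext f)"
  unfolding is_linear_def
proof safe
  fix v w :: "'a \<Rightarrow>\<^sub>0 complex" and c
  let ?S = "Poly_Mapping.keys v \<union> Poly_Mapping.keys w"
  have "lin_ext f (v + w) = (\<Sum>b\<in>?S. smul (Poly_Mapping.lookup (v + w) b) (f b))"
    by (rule lin_ext_superset) (use keys_add[of v w] in auto)
  thus "lin_ext f (v + w) = lin_ext f v + lin_ext f w"
    by (simp add: lin_ext_superset[of ?S v] lin_ext_superset[of ?S w]
        lookup_add smul_add_left sum.distrib)
  have "lin_ext f (smul c v) = (\<Sum>b\<in>Poly_Mapping.keys v. smul (Poly_Mapping.lookup (smul c v) b) (f b))"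
    by (rule lin_ext_superset) (auto simp: in_keys_iff)
  thus "lin_ext f (smul c v) = smul c (lin_ext f v)"
    by (simp add: lin_ext_def smul_sum_right)
qed

lemma lin_ext_single [simp]: "lin_ext f (Poly_Mapping.single b 1) = f b"
  by (simp add: lin_ext_def)

lemma lookup_bvec: "Poly_Mapping.lookup (bvec \<mu> \<gamma>) (\<rho>, \<delta>) = (if \<rho> = \<mu> \<and> \<delta> = \<gamma> then 1 else 0)"
  by (auto simp: bvec_def lookup_single when_def)

section \<open>Exponential series of commuting modes\<close>

lemma is_linear_exp_series_coeff:
  "(\<And>n. is_linear (X n)) \<Longrightarrow> is_linear (exp_series_coeff X k)"
  unfolding exp_series_coeff_def
  by (intro is_linear_sum_op is_linear_smul_op is_linear_foldr) auto

lemma weight_bounds: "k \<in># \<mu> \<Longrightarrow> k < weight \<mu>" "size \<mu> \<le> weight \<mu>"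
  by (induction \<mu>) auto

lemma finite_weight_lists: "finite {ks. weight (mset ks) = j}"
  by (rule finite_subset[OF _ finite_lists_length_le[of "{..j}" j]])
     (auto dest: weight_bounds(1)[of _ "mset _", simplified]
       intro: less_imp_le order.trans[OF _ weight_bounds(2)] simp flip: size_mset)

lemma finite_weight: "finite {\<nu>. weight \<nu> = j}"
proof -
  have "{\<nu>. weight \<nu> = j} = mset ` {ks. weight (mset ks) = j}"
    by (auto simp: image_iff) (metis ex_mset)
  thus ?thesis using finite_weight_lists[of j] by simp
qed

text \<open>By the assumption a word acts through its multiset of letters. A multiset
  \<open>\<nu>\<close> has \<open>fact (size \<nu>)\<close> divided by the product of the
  \<open>fact (count \<nu> k)\<close> orderings, which cancels \<open>1 / fact (length ns)\<close>.
  The letter \<open>k\<close> stands for the mode of index \<open>Suc k\<close>.\<close>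

lemma exp_series_coeff_multiset:
  assumes X: "\<And>ks. foldr X (map Suc ks) v = \<Phi> (mset ks)"
  shows "exp_series_coeff X j v =
    (\<Sum>\<nu> | weight \<nu> = j. smul (1 / (\<Prod>k\<in>set_mset \<nu>. fact (count \<nu> k))) (\<Phi> \<nu>))"
proof -
  let ?A = "{ks. weight (mset ks) = j}"
  have w: "sum_list (map Suc ks) = weight (mset ks)" for ks by (induction ks) auto
  have r: "map Suc (map (\<lambda>n. n - 1) ns) = ns" if "0 \<notin> set ns" for ns
    using that by (induction ns) auto
  have img: "{ns. sum_list ns = j \<and> 0 \<notin> set ns} = map Suc ` ?A"
  proof (intro equalityI subsetI)
    fix ns assume "ns \<in> {ns. sum_list ns = j \<and> 0 \<notin> set ns}"
    thus "ns \<in> map Suc ` ?A"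
      using r[of ns] w[of "map (\<lambda>n. n - 1) ns"] by (intro image_eqI[where x = "map (\<lambda>n. n - 1) ns"]) (auto simp del: map_map)
  qed (auto simp: w[symmetric])
  have "exp_series_coeff X j v = (\<Sum>ks\<in>?A. smul (1 / fact (length ks)) (\<Phi> (mset ks)))"
    unfolding exp_series_coeff_def img
    by (subst sum.reindex) (auto simp: X inj_on_def inj_map_eq_map)
  also have "\<dots> = (\<Sum>\<nu>\<in>mset ` ?A. \<Sum>ks | ks \<in> ?A \<and> mset ks = \<nu>. smul (1 / fact (length ks)) (\<Phi> (mset ks)))"
    by (rule sum.image_gen[OF finite_weight_lists])
  also have "mset ` ?A = {\<nu>. weight \<nu> = j}"
    by (auto simp: image_iff) (metis ex_mset)
  also have "(\<Sum>\<nu> | weight \<nu> = j. \<Sum>ks | ks \<in> ?A \<and> mset ks = \<nu>. smul (1 / fact (length ks)) (\<Phi> (mset ks)))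
      = (\<Sum>\<nu> | weight \<nu> = j. smul (1 / (\<Prod>k\<in>set_mset \<nu>. fact (count \<nu> k))) (\<Phi> \<nu>))"
  proof (rule sum.cong[OF refl])
    fix \<nu> assume \<nu>: "\<nu> \<in> {\<nu>. weight \<nu> = j}"
    have "(\<Sum>ks | ks \<in> ?A \<and> mset ks = \<nu>. smul (1 / fact (length ks)) (\<Phi> (mset ks))) =
        (\<Sum>ks\<in>permutations_of_multiset \<nu>. smul (1 / fact (size \<nu>)) (\<Phi> \<nu>))"
      using \<nu> by (intro sum.cong) (auto simp: permutations_of_multiset_def simp flip: size_mset)
    also have "\<dots> = smul (of_nat (card (permutations_of_multiset \<nu>)) / fact (size \<nu>)) (\<Phi> \<nu>)"
      by (rule poly_mapping_eqI) (simp add: lookup_sum)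
    also have "of_nat (card (permutations_of_multiset \<nu>)) / fact (size \<nu>) =
        1 / (\<Prod>k\<in>set_mset \<nu>. fact (count \<nu> k) :: complex)"
      using arg_cong[OF card_permutations_of_multiset_aux[of \<nu>], of "of_nat :: nat \<Rightarrow> complex"]
      by (simp add: divide_simps prod_zero_iff)
    finally show "(\<Sum>ks | ks \<in> ?A \<and> mset ks = \<nu>. smul (1 / fact (length ks)) (\<Phi> (mset ks))) =
        smul (1 / (\<Prod>k\<in>set_mset \<nu>. fact (count \<nu> k))) (\<Phi> \<nu>)" .
  qed
  finally show ?thesis .
qed

section \<open>Matrix coefficients of the exponential fields\<close>

lemma double_diff_mset: "\<tau> \<subseteq># \<sigma> \<Longrightarrow> \<sigma> - (\<sigma> - \<tau>) = (\<tau>::'b multiset)"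
  by (simp add: multiset_eq_iff subseteq_mset_def)

context lattice_voa
begin

abbreviation basis_lookup :: "'l voa \<Rightarrow> nat multiset \<Rightarrow> 'l \<Rightarrow> complex" where
  "basis_lookup v \<mu> \<gamma> \<equiv> Poly_Mapping.lookup v (\<mu>, \<gamma>)"

definition charge :: "'l \<Rightarrow> complex" where
  "charge \<alpha> = form (1, \<alpha>) a"

lemma is_linear_heis: "is_linear (heis h n)"
  unfolding heis_def by (rule is_linear_lin_ext)

lemma is_linear_e_op: "is_linear (e_op \<alpha>)"
  unfolding e_op_def by (rule is_linear_lin_ext)

lemma is_linear_z_op: "is_linear (z_op \<alpha> p)"
  unfolding z_op_def by (rule is_linear_lin_ext)

lemma is_linear_Y_minus: "is_linear (Y_minus \<alpha> j)"
  unfolding Y_minus_def by (intro is_linear_exp_series_coeff is_linear_smul_op is_linear_heis)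

lemma is_linear_Y_plus: "is_linear (Y_plus \<alpha> k)"
  unfolding Y_plus_def by (intro is_linear_exp_series_coeff is_linear_smul_op is_linear_heis)

lemma heis_bvec_neg: "heis h (- int (Suc k)) (bvec \<mu> \<gamma>) = smul (form h a) (bvec (add_mset k \<mu>) \<gamma>)"
  unfolding heis_def bvec_def by (simp del: of_nat_Suc)

lemma heis_bvec_0: "heis h 0 (bvec \<mu> \<gamma>) = smul (form h (1, \<gamma>)) (bvec \<mu> \<gamma>)"
  unfolding heis_def bvec_def by simp

lemma heis_bvec_pos: "heis h (int (Suc k)) (bvec \<mu> \<gamma>) =
    smul (form h a * of_nat (Suc k) * of_nat (count \<mu> k)) (bvec (\<mu> - {#k#}) \<gamma>)"
  unfolding heis_def bvec_def by (simp del: of_nat_Suc)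

lemma e_op_bvec: "e_op \<alpha> (bvec \<mu> \<gamma>) = smul (of_int (\<epsilon> \<alpha> \<gamma>)) (bvec \<mu> (\<alpha> + \<gamma>))"
  unfolding e_op_def bvec_def by simp

lemma z_op_bvec: "z_op \<alpha> p (bvec \<mu> \<gamma>) = (if B \<alpha> \<gamma> = p then bvec \<mu> \<gamma> else 0)"
  unfolding z_op_def bvec_def by simp

definition creation_coeff :: "'l \<Rightarrow> nat multiset \<Rightarrow> complex" where
  "creation_coeff \<alpha> \<nu> = (\<Prod>k\<in>set_mset \<nu>. (charge \<alpha> / of_nat (Suc k)) ^ count \<nu> k / fact (count \<nu> k))"

definition annihilation_coeff :: "'l \<Rightarrow> nat multiset \<Rightarrow> nat multiset \<Rightarrow> complex" where
  "annihilation_coeff \<alpha> \<sigma> \<nu> =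
     (\<Prod>k\<in>set_mset \<nu>. (- charge \<alpha>) ^ count \<nu> k * of_nat (count \<sigma> k choose count \<nu> k))"

lemma annihilation_coeff_eq_0:
  assumes "\<not> \<nu> \<subseteq># \<sigma>"
  shows "annihilation_coeff \<alpha> \<sigma> \<nu> = 0"
proof -
  from assms obtain k where k: "count \<nu> k > count \<sigma> k"
    by (auto simp: subseteq_mset_def not_le)
  hence "k \<in># \<nu>" by (metis count_inI not_less0)
  with k show ?thesis by (auto simp: annihilation_coeff_def binomial_eq_0 intro!: bexI[of _ k])
qed

lemma Y_minus_bvec:
  "Y_minus \<alpha> j (bvec \<sigma> \<gamma>) = (\<Sum>\<nu> | weight \<nu> = j. smul (creation_coeff \<alpha> \<nu>) (bvec (\<sigma> + \<nu>) \<gamma>))"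
proof -
  define \<Phi> where "\<Phi> \<nu> = smul (\<Prod>k\<in>#\<nu>. charge \<alpha> / of_nat (Suc k)) (bvec (\<sigma> + \<nu>) \<gamma>)" for \<nu>
  let ?X = "\<lambda>n v. smul (1 / of_nat n) (heis (1, \<alpha>) (- int n) v)"
  have "foldr ?X (map Suc ks) (bvec \<sigma> \<gamma>) = \<Phi> (mset ks)" for ks
  proof (induction ks)
    case (Cons k ks)
    have "foldr ?X (map Suc (k # ks)) (bvec \<sigma> \<gamma>) =
        smul (1 / of_nat (Suc k)) (heis (1, \<alpha>) (- int (Suc k)) (\<Phi> (mset ks)))"
      using Cons by simp
    also have "\<dots> = \<Phi> (mset (k # ks))"
      unfolding \<Phi>_def is_linear_smul[OF is_linear_heis] heis_bvec_neg
      by (simp add: charge_def field_simps)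
    finally show ?case .
  qed (simp add: \<Phi>_def)
  from exp_series_coeff_multiset[OF this, of j]
  have "Y_minus \<alpha> j (bvec \<sigma> \<gamma>) =
      (\<Sum>\<nu> | weight \<nu> = j. smul (1 / (\<Prod>k\<in>set_mset \<nu>. fact (count \<nu> k))) (\<Phi> \<nu>))"
    by (simp add: Y_minus_def)
  also have "\<dots> = (\<Sum>\<nu> | weight \<nu> = j. smul (creation_coeff \<alpha> \<nu>) (bvec (\<sigma> + \<nu>) \<gamma>))"
    by (intro sum.cong refl)
       (simp add: \<Phi>_def creation_coeff_def image_prod_mset_multiplicity prod_dividef)
  finally show ?thesis .
qed

text \<open>Repeated derivation in one mode produces falling factorials of its multiplicity;
  dividing by the factorials from \<open>exp_series_coeff_multiset\<close> leaves binomial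
  coefficients. The factor \<open>n\<close> in \<open>heis\<close> cancels the \<open>1 / n\<close>
  in the exponent.\<close>

lemma Y_plus_bvec:
  "Y_plus \<alpha> j (bvec \<sigma> \<gamma>) = (\<Sum>\<nu> | \<nu> \<subseteq># \<sigma> \<and> weight \<nu> = j.
     smul (annihilation_coeff \<alpha> \<sigma> \<nu>) (bvec (\<sigma> - \<nu>) \<gamma>))"
proof -
  \<comment> \<open>The falling factorial is written as \<open>fact\<close> times
    \<open>choose\<close>. It vanishes once a mode is derived too often, which makes the truncated
    difference \<open>\<sigma> - \<nu>\<close> harmless.\<close>
  define A :: "nat multiset \<Rightarrow> complex" where "A \<nu> = Prod_any (\<lambda>k. (- charge \<alpha>) ^ count \<nu> k *
      of_nat (fact (count \<nu> k) * (count \<sigma> k choose count \<nu> k)))" for \<nu>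
  have A: "A \<nu> = (\<Prod>k\<in>K. (- charge \<alpha>) ^ count \<nu> k *
      of_nat (fact (count \<nu> k) * (count \<sigma> k choose count \<nu> k)))"
    if "set_mset \<nu> \<subseteq> K" "finite K" for K \<nu>
    unfolding A_def
    by (rule Prod_any.expand_superset[OF that(2)]) (use that(1) in \<open>auto simp: not_in_iff[symmetric]\<close>, metis (no_types, lifting) binomial_n_0 fact_0 in_mono mult.right_neutral not_in_iff of_nat_1 power_0)
  have A_add: "A (add_mset k \<nu>) = - charge \<alpha> * of_nat (count (\<sigma> - \<nu>) k) * A \<nu>" for k \<nu>
  proof -
    let ?K = "insert k (set_mset \<nu>)" and ?K' = "set_mset \<nu> - {k}"
    let ?n = "count \<nu> k" and ?s = "count \<sigma> k"
    have b: "Suc ?n * (?s choose Suc ?n) = (?s - ?n) * (?s choose ?n)"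
      using binomial_absorption[of ?n ?s] binomial_absorb_comp[of ?s ?n] by simp
    have "fact (Suc ?n) * (?s choose Suc ?n) = fact ?n * (Suc ?n * (?s choose Suc ?n))"
      by (simp add: algebra_simps)
    hence f: "fact (Suc ?n) * (?s choose Suc ?n) = (?s - ?n) * (fact ?n * (?s choose ?n))"
      unfolding b by (simp add: mult_ac)
    have K: "?K = insert k ?K'" by auto
    have "A (add_mset k \<nu>) = (\<Prod>i\<in>?K. (- charge \<alpha>) ^ count (add_mset k \<nu>) i *
        of_nat (fact (count (add_mset k \<nu>) i) * (count \<sigma> i choose count (add_mset k \<nu>) i)))"
      by (rule A) auto
    also have "\<dots> = (- charge \<alpha>) ^ Suc ?n * of_nat (fact (Suc ?n) * (?s choose Suc ?n)) *
        (\<Prod>i\<in>?K'. (- charge \<alpha>) ^ count \<nu> i * of_nat (fact (count \<nu> i) * (count \<sigma> i choose count \<nu> i)))"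
      unfolding K by (subst prod.insert) (auto intro!: prod.cong simp del: of_nat_mult)
    also have "\<dots> = - charge \<alpha> * of_nat (count (\<sigma> - \<nu>) k) *
        (\<Prod>i\<in>?K. (- charge \<alpha>) ^ count \<nu> i * of_nat (fact (count \<nu> i) * (count \<sigma> i choose count \<nu> i)))"
      unfolding f unfolding K by (subst prod.insert) (auto simp: mult_ac)
    also have "\<dots> = - charge \<alpha> * of_nat (count (\<sigma> - \<nu>) k) * A \<nu>"
      by (subst A[of \<nu> ?K]) auto
    finally show ?thesis .
  qed
  define \<Phi> where "\<Phi> \<nu> = smul (A \<nu>) (bvec (\<sigma> - \<nu>) \<gamma>)" for \<nu>
  let ?X = "\<lambda>n v. smul (- 1 / of_nat n) (heis (1, \<alpha>) (int n) v)"
  have "foldr ?X (map Suc ks) (bvec \<sigma> \<gamma>) = \<Phi> (mset ks)" for ks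
  proof (induction ks)
    case (Cons k ks)
    have "foldr ?X (map Suc (k # ks)) (bvec \<sigma> \<gamma>) =
        smul (- 1 / of_nat (Suc k)) (heis (1, \<alpha>) (int (Suc k)) (\<Phi> (mset ks)))"
      using Cons by simp
    also have "\<dots> = \<Phi> (mset (k # ks))"
      unfolding \<Phi>_def is_linear_smul[OF is_linear_heis] heis_bvec_pos smul_smul mset.simps A_add
      by (rule arg_cong2[where f = smul]) (simp_all add: charge_def field_simps del: of_nat_Suc)
    finally show ?case .
  qed (simp add: \<Phi>_def A_def)
  from exp_series_coeff_multiset[OF this, of j]
  have "Y_plus \<alpha> j (bvec \<sigma> \<gamma>) =
      (\<Sum>\<nu> | weight \<nu> = j. smul (1 / (\<Prod>k\<in>set_mset \<nu>. fact (count \<nu> k))) (\<Phi> \<nu>))"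
    by (simp add: Y_plus_def)
  also have "\<dots> = (\<Sum>\<nu> | weight \<nu> = j. smul (annihilation_coeff \<alpha> \<sigma> \<nu>) (bvec (\<sigma> - \<nu>) \<gamma>))"
  proof (intro sum.cong refl)
    fix \<nu>
    have "A \<nu> = (\<Prod>k\<in>set_mset \<nu>. fact (count \<nu> k)) * annihilation_coeff \<alpha> \<sigma> \<nu>"
      unfolding A[OF order.refl finite_set_mset] annihilation_coeff_def prod.distrib[symmetric]
      by (intro prod.cong) auto
    moreover have "(\<Prod>k\<in>set_mset \<nu>. fact (count \<nu> k)) \<noteq> (0::complex)" by simp
    ultimately show "smul (1 / (\<Prod>k\<in>set_mset \<nu>. fact (count \<nu> k))) (\<Phi> \<nu>) =
        smul (annihilation_coeff \<alpha> \<sigma> \<nu>) (bvec (\<sigma> - \<nu>) \<gamma>)"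
      by (simp add: \<Phi>_def)
  qed
  also have "\<dots> = (\<Sum>\<nu> | \<nu> \<subseteq># \<sigma> \<and> weight \<nu> = j.
      smul (annihilation_coeff \<alpha> \<sigma> \<nu>) (bvec (\<sigma> - \<nu>) \<gamma>))"
  proof (rule sum.mono_neutral_right)
    show "finite {\<nu>. weight \<nu> = j}" by (rule finite_weight)
  qed (auto, metis annihilation_coeff_eq_0 smul_zero_left)
  finally show ?thesis .
qed

lemma lookup_Y_minus:
  "basis_lookup (Y_minus \<alpha> j (bvec \<sigma> \<gamma>)) \<rho> \<delta> =
     (if \<delta> = \<gamma> \<and> \<sigma> \<subseteq># \<rho> \<and> weight (\<rho> - \<sigma>) = j then creation_coeff \<alpha> (\<rho> - \<sigma>) else 0)"
proof -
  have "basis_lookup (Y_minus \<alpha> j (bvec \<sigma> \<gamma>)) \<rho> \<delta> =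
      (\<Sum>\<nu> | weight \<nu> = j. if \<nu> = \<rho> - \<sigma> then (if \<delta> = \<gamma> \<and> \<sigma> \<subseteq># \<rho> then creation_coeff \<alpha> (\<rho> - \<sigma>) else 0) else 0)"
    unfolding Y_minus_bvec lookup_sum lookup_smul lookup_bvec by (intro sum.cong refl) auto
  thus ?thesis using finite_weight by (auto simp: sum.delta)
qed


definition Y_exp_term :: "'l \<Rightarrow> int \<Rightarrow> nat \<Rightarrow> nat \<Rightarrow> 'l voa \<Rightarrow> 'l voa" where
  "Y_exp_term \<alpha> m j k v = Y_minus \<alpha> j (Y_plus \<alpha> k (e_op \<alpha> (z_op \<alpha> (m - int j + int k) v)))"

lemma is_linear_Y_exp_term: "is_linear (Y_exp_term \<alpha> m j k)"
  unfolding Y_exp_term_def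
  by (intro is_linear_compose[OF is_linear_Y_minus] is_linear_compose[OF is_linear_Y_plus]
      is_linear_compose[OF is_linear_e_op] is_linear_z_op)

lemma Y_plus_eq_0: "k > weight \<sigma> \<Longrightarrow> Y_plus \<alpha> k (bvec \<sigma> \<gamma>) = 0"
proof -
  assume k: "k > weight \<sigma>"
  have "weight \<nu> \<le> weight \<sigma>" if "\<nu> \<subseteq># \<sigma>" for \<nu>
    using weight_simps(3)[of \<nu> "\<sigma> - \<nu>"] that by simp
  hence "{\<nu>. \<nu> \<subseteq># \<sigma> \<and> weight \<nu> = k} = {}" using k by force
  thus ?thesis unfolding Y_plus_bvec by (simp only: sum.empty)
qed

lemma Y_exp_term_bvec:
  "Y_exp_term \<alpha> m j k (bvec \<sigma> \<gamma>) = (if int j = m + int k - B \<alpha> \<gamma> \<and> k \<le> weight \<sigma>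
     then smul (of_int (\<epsilon> \<alpha> \<gamma>)) (Y_minus \<alpha> j (Y_plus \<alpha> k (bvec \<sigma> (\<alpha> + \<gamma>)))) else 0)"
  unfolding Y_exp_term_def z_op_bvec
  by (auto simp: e_op_bvec is_linear_smul is_linear_0 is_linear_Y_minus is_linear_Y_plus is_linear_e_op
      Y_plus_eq_0 not_le)

text \<open>On a basis vector the annihilated degree \<open>k\<close> is at most the weight, and
  \<open>j\<close> is then determined by \<open>m\<close>. This finiteness makes the
  \<open>Sum_any\<close> in \<open>Y_exp\<close> additive.\<close>

lemma finite_Y_exp_term: "finite {p. Y_exp_term \<alpha> m (fst p) (snd p) v \<noteq> 0}"
proof -
  let ?S = "\<lambda>b. {p. Y_exp_term \<alpha> m (fst p) (snd p) (Poly_Mapping.single b 1) \<noteq> 0}"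
  have "finite (?S b)" for b
  proof -
    obtain \<sigma> \<gamma> where b: "b = (\<sigma>, \<gamma>)" by force
    have "?S b \<subseteq> (\<lambda>k. (nat (m + int k - B \<alpha> \<gamma>), k)) ` {..weight \<sigma>}"
      unfolding b bvec_def[symmetric] Y_exp_term_bvec by (force split: if_splits)
    thus ?thesis by (rule finite_subset) simp
  qed
  moreover have "{p. Y_exp_term \<alpha> m (fst p) (snd p) v \<noteq> 0} \<subseteq> (\<Union>b\<in>Poly_Mapping.keys v. ?S b)"
  proof (rule subsetI, rule ccontr)
    fix p assume p: "p \<in> {p. Y_exp_term \<alpha> m (fst p) (snd p) v \<noteq> 0}"
      "p \<notin> (\<Union>b\<in>Poly_Mapping.keys v. ?S b)"
    have "Y_exp_term \<alpha> m (fst p) (snd p) v = 0"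
      by (subst is_linear_expand[OF is_linear_Y_exp_term]) (use p(2) in auto)
    with p(1) show False by simp
  qed
  ultimately show ?thesis by (meson finite_UN_I finite_keys finite_subset)
qed

lemma Y_exp_eq: "Y_exp \<alpha> m v = Sum_any (\<lambda>p. Y_exp_term \<alpha> m (fst p) (snd p) v)"
  by (simp add: Y_exp_def Y_exp_term_def case_prod_unfold)

lemma is_linear_Y_exp: "is_linear (Y_exp \<alpha> m)"
  unfolding is_linear_def Y_exp_eq
proof safe
  fix v w :: "'l voa" and c
  show "Sum_any (\<lambda>p. Y_exp_term \<alpha> m (fst p) (snd p) (v + w)) =
    Sum_any (\<lambda>p. Y_exp_term \<alpha> m (fst p) (snd p) v) + Sum_any (\<lambda>p. Y_exp_term \<alpha> m (fst p) (snd p) w)"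
    unfolding is_linear_add[OF is_linear_Y_exp_term] by (intro Sum_any.distrib finite_Y_exp_term)
  let ?K = "{p. Y_exp_term \<alpha> m (fst p) (snd p) v \<noteq> 0}"
  show "Sum_any (\<lambda>p. Y_exp_term \<alpha> m (fst p) (snd p) (smul c v)) =
    smul c (Sum_any (\<lambda>p. Y_exp_term \<alpha> m (fst p) (snd p) v))"
    unfolding is_linear_smul[OF is_linear_Y_exp_term]
    by (subst (1 2) Sum_any.expand_superset[OF finite_Y_exp_term[of \<alpha> m v]])
       (auto simp: smul_sum_right)
qed

lemma Y_exp_bvec:
  "Y_exp \<alpha> m (bvec \<sigma> \<gamma>) = (\<Sum>\<nu> | \<nu> \<subseteq># \<sigma>. if m + int (weight \<nu>) - B \<alpha> \<gamma> \<ge> 0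
     then smul (of_int (\<epsilon> \<alpha> \<gamma>) * annihilation_coeff \<alpha> \<sigma> \<nu>)
       (Y_minus \<alpha> (nat (m + int (weight \<nu>) - B \<alpha> \<gamma>)) (bvec (\<sigma> - \<nu>) (\<alpha> + \<gamma>)))
     else 0)" (is "_ = (\<Sum>\<nu> | _. ?R \<nu>)")
proof -
  let ?g = "\<lambda>k. (nat (m + int k - B \<alpha> \<gamma>), k)"
  have "Y_exp \<alpha> m (bvec \<sigma> \<gamma>) =
      (\<Sum>p\<in>?g ` {..weight \<sigma>}. Y_exp_term \<alpha> m (fst p) (snd p) (bvec \<sigma> \<gamma>))"
    unfolding Y_exp_eq
    by (rule Sum_any.expand_superset) (force simp: Y_exp_term_bvec split: if_splits)+
  also have "\<dots> = (\<Sum>k\<le>weight \<sigma>. Y_exp_term \<alpha> m (nat (m + int k - B \<alpha> \<gamma>)) k (bvec \<sigma> \<gamma>))"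
    by (subst sum.reindex) (auto simp: inj_on_def)
  also have "\<dots> = (\<Sum>k\<le>weight \<sigma>. \<Sum>\<nu> | \<nu> \<in> {\<nu>. \<nu> \<subseteq># \<sigma>} \<and> weight \<nu> = k. ?R \<nu>)"
  proof (rule sum.cong[OF refl])
    fix k assume k: "k \<in> {..weight \<sigma>}"
    show "Y_exp_term \<alpha> m (nat (m + int k - B \<alpha> \<gamma>)) k (bvec \<sigma> \<gamma>) =
        (\<Sum>\<nu> | \<nu> \<in> {\<nu>. \<nu> \<subseteq># \<sigma>} \<and> weight \<nu> = k. ?R \<nu>)"
    proof (cases "m + int k - B \<alpha> \<gamma> \<ge> 0")
      case True
      thus ?thesis using k
        by (auto simp: Y_exp_term_bvec Y_plus_bvec is_linear_sum[OF is_linear_Y_minus]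
            is_linear_smul[OF is_linear_Y_minus] smul_sum_right intro!: sum.cong)
    next
      case False
      thus ?thesis by (auto simp: Y_exp_term_bvec intro!: sum.neutral[symmetric])
    qed
  qed
  also have "\<dots> = (\<Sum>\<nu> | \<nu> \<subseteq># \<sigma>. ?R \<nu>)"
  proof (rule sum.group[OF finite_subset_mset finite_atMost], safe)
    fix \<nu> assume "\<nu> \<subseteq># \<sigma>"
    thus "weight \<nu> \<le> weight \<sigma>"
      using weight_simps(3)[of \<nu> "\<sigma> - \<nu>"] by simp
  qed
  finally show ?thesis .
qed

text \<open>The grading forces the exponent \<open>m\<close>, so the matrix entry is that of the
  kernel at \<open>z = 1\<close>; the powers of \<open>z\<close> are restored later by
  \<open>fock_kernel_scale\<close>.\<close>

lemma lookup_Y_exp: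
  "basis_lookup (Y_exp \<alpha> m (bvec \<sigma> \<gamma>)) \<rho> \<delta> =
     (if \<delta> = \<alpha> + \<gamma> \<and> m = B \<alpha> \<gamma> + int (weight \<rho>) - int (weight \<sigma>)
      then of_int (\<epsilon> \<alpha> \<gamma>) * fock_kernel (\<lambda>k. charge \<alpha> / of_nat (Suc k)) (\<lambda>_. - charge \<alpha>) \<rho> \<sigma> else 0)"
proof -
  let ?c = "\<delta> = \<alpha> + \<gamma> \<and> m = B \<alpha> \<gamma> + int (weight \<rho>) - int (weight \<sigma>)"
  have "basis_lookup (Y_exp \<alpha> m (bvec \<sigma> \<gamma>)) \<rho> \<delta> =
    (\<Sum>\<nu> | \<nu> \<subseteq># \<sigma>. if ?c \<and> \<sigma> - \<nu> \<subseteq># \<rho> then of_int (\<epsilon> \<alpha> \<gamma>) *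
        (creation_coeff \<alpha> (\<rho> - (\<sigma> - \<nu>)) * annihilation_coeff \<alpha> \<sigma> \<nu>) else 0)"
    unfolding Y_exp_bvec lookup_sum
  proof (intro sum.cong refl)
    fix \<nu> assume "\<nu> \<in> {\<nu>. \<nu> \<subseteq># \<sigma>}"
    hence 1: "weight \<sigma> = weight \<nu> + weight (\<sigma> - \<nu>)"
      using weight_simps(3)[of \<nu> "\<sigma> - \<nu>"] by simp
    have 2: "weight \<rho> = weight (\<sigma> - \<nu>) + weight (\<rho> - (\<sigma> - \<nu>))" if "\<sigma> - \<nu> \<subseteq># \<rho>"
      using weight_simps(3)[of "\<sigma> - \<nu>" "\<rho> - (\<sigma> - \<nu>)"] that by simp
    let ?n = "m + int (weight \<nu>) - B \<alpha> \<gamma>"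
    have 3: "(0 \<le> ?n \<and> weight (\<rho> - (\<sigma> - \<nu>)) = nat ?n) \<longleftrightarrow>
        m = B \<alpha> \<gamma> + int (weight \<rho>) - int (weight \<sigma>)" if "\<sigma> - \<nu> \<subseteq># \<rho>"
      using 1 2[OF that] by auto
    have "basis_lookup (if 0 \<le> ?n then smul (of_int (\<epsilon> \<alpha> \<gamma>) * annihilation_coeff \<alpha> \<sigma> \<nu>)
         (Y_minus \<alpha> (nat ?n) (bvec (\<sigma> - \<nu>) (\<alpha> + \<gamma>))) else 0) \<rho> \<delta> =
      (if \<delta> = \<alpha> + \<gamma> \<and> \<sigma> - \<nu> \<subseteq># \<rho> \<and> (0 \<le> ?n \<and> weight (\<rho> - (\<sigma> - \<nu>)) = nat ?n)
       then of_int (\<epsilon> \<alpha> \<gamma>) * (creation_coeff \<alpha> (\<rho> - (\<sigma> - \<nu>)) * annihilation_coeff \<alpha> \<sigma> \<nu>) else 0)"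
      by (auto simp: lookup_Y_minus)
    also have "\<dots> = (if ?c \<and> \<sigma> - \<nu> \<subseteq># \<rho> then of_int (\<epsilon> \<alpha> \<gamma>) *
        (creation_coeff \<alpha> (\<rho> - (\<sigma> - \<nu>)) * annihilation_coeff \<alpha> \<sigma> \<nu>) else 0)"
      by (rule if_cong) (use 3 in auto)
    finally show "basis_lookup (if 0 \<le> ?n then smul (of_int (\<epsilon> \<alpha> \<gamma>) * annihilation_coeff \<alpha> \<sigma> \<nu>)
         (Y_minus \<alpha> (nat ?n) (bvec (\<sigma> - \<nu>) (\<alpha> + \<gamma>))) else 0) \<rho> \<delta> = \<dots>" .
  qed
  also have "\<dots> = (if ?c then of_int (\<epsilon> \<alpha> \<gamma>) * (\<Sum>\<nu> | \<nu> \<subseteq># \<sigma> \<and> \<sigma> - \<nu> \<subseteq># \<rho>.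
      creation_coeff \<alpha> (\<rho> - (\<sigma> - \<nu>)) * annihilation_coeff \<alpha> \<sigma> \<nu>) else 0)"
  proof (cases ?c)
    case True
    have "(\<Sum>\<nu> | \<nu> \<subseteq># \<sigma> \<and> \<sigma> - \<nu> \<subseteq># \<rho>. creation_coeff \<alpha> (\<rho> - (\<sigma> - \<nu>)) * annihilation_coeff \<alpha> \<sigma> \<nu>) =
       (\<Sum>\<nu> | \<nu> \<subseteq># \<sigma>. if \<sigma> - \<nu> \<subseteq># \<rho> then creation_coeff \<alpha> (\<rho> - (\<sigma> - \<nu>)) * annihilation_coeff \<alpha> \<sigma> \<nu> else 0)"
      using sum.inter_filter[OF finite_subset_mset, of "\<lambda>\<nu>. creation_coeff \<alpha> (\<rho> - (\<sigma> - \<nu>)) * annihilation_coeff \<alpha> \<sigma> \<nu>"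
          \<sigma> "\<lambda>\<nu>. \<sigma> - \<nu> \<subseteq># \<rho>"] by simp
    with True show ?thesis by (simp add: sum_distrib_left if_distrib cong: if_cong)
  qed (auto intro!: sum.neutral)
  \<comment> \<open>Change from the annihilated part \<open>\<nu>\<close> to the surviving part
    \<open>\<sigma> - \<nu>\<close>, the index in \<open>fock_kernel_altdef\<close>.\<close>
  also have "(\<Sum>\<nu> | \<nu> \<subseteq># \<sigma> \<and> \<sigma> - \<nu> \<subseteq># \<rho>. creation_coeff \<alpha> (\<rho> - (\<sigma> - \<nu>)) * annihilation_coeff \<alpha> \<sigma> \<nu>) =
      (\<Sum>\<tau> | \<tau> \<subseteq># \<rho> \<and> \<tau> \<subseteq># \<sigma>. creation_coeff \<alpha> (\<rho> - \<tau>) * annihilation_coeff \<alpha> \<sigma> (\<sigma> - \<tau>))"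
    by (rule sum.reindex_bij_witness[of _ "\<lambda>\<tau>. \<sigma> - \<tau>" "\<lambda>\<nu>. \<sigma> - \<nu>"])
       (auto simp: double_diff_mset)
  also have "\<dots> = fock_kernel (\<lambda>k. charge \<alpha> / of_nat (Suc k)) (\<lambda>_. - charge \<alpha>) \<rho> \<sigma>"
    unfolding fock_kernel_altdef creation_coeff_def annihilation_coeff_def ..
  finally show ?thesis .
qed

end

lemma additive_int:
  fixes f :: "int \<Rightarrow> 'a::comm_ring_1"
  assumes "\<And>m n. f (m + n) = f m + f n"
  shows "f m = of_int m * f 1"
proof -
  have 0: "f 0 = 0" using assms[of 0 0] by simp
  have neg: "f (- m) = - f m" for m using assms[of m "- m"] 0 by (simp add: eq_neg_iff_add_eq_0 add.commute)
  have "f (int n) = of_nat n * f 1" for n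
    by (induction n) (simp_all add: 0 assms algebra_simps)
  thus ?thesis by (cases m rule: int_cases2) (simp_all add: neg)
qed

text \<open>The hypothesis speaks of the line through one basis vector, as the powers of
  \<open>T\<close> never leave it.\<close>

lemma exp_op_eigenvector:
  assumes "\<And>c. T (smul c (Poly_Mapping.single b 1)) = smul (c * w) (Poly_Mapping.single b 1)"
  shows "exp_op T (Poly_Mapping.single b 1) = smul (exp w) (Poly_Mapping.single b 1)"
proof -
  have pow: "(T ^^ k) (Poly_Mapping.single b 1) = smul (w ^ k) (Poly_Mapping.single b 1)" for k
    by (induction k) (simp_all add: assms mult.commute)
  have "(\<lambda>k. w ^ k / fact k) sums exp w"
    using exp_converges[of w] by (simp add: scaleR_conv_of_real field_simps)
  hence "suminf (\<lambda>k. w ^ k / fact k) = exp w" by (rule sums_unique[symmetric])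
  hence "(\<lambda>b'. suminf (\<lambda>k. Poly_Mapping.lookup ((T ^^ k) (Poly_Mapping.single b 1)) b' / fact k)) =
      Poly_Mapping.lookup (smul (exp w) (Poly_Mapping.single b 1))"
    by (auto simp: pow lookup_single when_def)
  thus ?thesis unfolding exp_op_def by (simp add: lookup_inverse)
qed

lemma weight_sum:
  "set_mset \<mu> \<subseteq> {..<N} \<Longrightarrow> (\<Sum>k<N. Suc k * count \<mu> k) = weight \<mu>"
proof (induction \<mu>)
  case (add x \<mu>)
  have "(\<Sum>k<N. Suc k * count (add_mset x \<mu>) k) = (\<Sum>k<N. Suc k * count \<mu> k + (if k = x then Suc x else 0))"
    by (intro sum.cong) auto
  also have "\<dots> = weight \<mu> + Suc x" using add by (simp add: sum.distrib)
  finally show ?case by simp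
qed simp

section \<open>Even lattices of rank one and the sign cocycle\<close>

locale rank_one_lattice_voa = lattice_voa B \<epsilon> a
  for B :: "'l::ab_group_add \<Rightarrow> 'l \<Rightarrow> int" and \<epsilon> :: "'l \<Rightarrow> 'l \<Rightarrow> int" and a :: "complex \<times> 'l" +
  assumes lattice: "pos_def_even_lattice_rank_one B"
    and norm_a: "form a a = 1"
    and cocycle: is_sign_cocycle
begin

lemma B_sym: "B x y = B y x"
  and B_add_left: "B (x + y) z = B x z + B y z"
  and B_even: "even (B x x)"
  using lattice by (auto simp: pos_def_even_lattice_rank_one_def)

lemma B_add_right: "B x (y + z) = B x y + B x z"
  using B_add_left[of y z x] by (simp add: B_sym)

lemma B_0_left [simp]: "B 0 x = 0" and B_0_right [simp]: "B x 0 = 0"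
  using B_add_left[of 0 0 x] B_add_right[of x 0 0] by simp_all

lemma B_sum_right: "B x (sum f A) = (\<Sum>i\<in>A. B x (f i))"
  by (induction A rule: infinite_finite_induct) (auto simp: B_add_right)

lemma B_generator:
  obtains \<phi> :: "int \<Rightarrow> 'l" and N where "surj \<phi>" "\<And>m n. B (\<phi> m) (\<phi> n) = m * n * N" "even N"
proof -
  obtain \<phi> :: "int \<Rightarrow> 'l" where \<phi>: "bij \<phi>" "\<And>m n. \<phi> (m + n) = \<phi> m + \<phi> n"
    using lattice by (auto simp: pos_def_even_lattice_rank_one_def)
  have "B (\<phi> m) y = m * B (\<phi> 1) y" for m y
    using additive_int[of "\<lambda>m. B (\<phi> m) y" m] by (simp add: \<phi> B_add_left)
  hence "B (\<phi> m) (\<phi> n) = m * n * B (\<phi> 1) (\<phi> 1)" for m n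
    by (metis B_sym mult.assoc)
  from that[OF bij_is_surj[OF \<phi>(1)] this B_even] show ?thesis .
qed

text \<open>Even norms do not force this in higher rank; here every pairing is an integer multiple
  of the norm of a generator.\<close>

lemma even_B: "even (B x y)"
proof -
  obtain \<phi> N where \<phi>: "surj \<phi>" "\<And>m n. B (\<phi> m) (\<phi> n) = m * n * N" "even N"
    using B_generator by metis
  obtain m n where "x = \<phi> m" "y = \<phi> n" using \<phi>(1) by (metis surj_def)
  thus ?thesis using \<phi>(2,3) by simp
qed

text \<open>The ambient space is the line spanned by \<open>a\<close>, and
  \<open>(a, a) = 1\<close>. Single charges may be irrational, but every formula below contains them
  in products of two.\<close>

lemma charge_mult: "charge x * charge y = of_int (B x y)"
proof -
  obtain \<phi> N where \<phi>: "surj \<phi>" "\<And>m n. B (\<phi> m) (\<phi> n) = m * n * N" "even N"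
    using B_generator by metis
  obtain m n k where "x = \<phi> m" "y = \<phi> n" "snd a = \<phi> k" using \<phi>(1) by (metis surj_def)
  hence "charge x * charge y = of_int (B x y) * form a a"
    by (simp add: charge_def form_def \<phi>(2))
  thus ?thesis by (simp add: norm_a)
qed

lemma charge_0 [simp]: "charge 0 = 0"
  by (simp add: charge_def form_def)

lemma eps_cases: "\<epsilon> x y = 1 \<or> \<epsilon> x y = -1"
  and eps_add_right: "\<epsilon> x (y + z) = \<epsilon> x y * \<epsilon> x z"
  and e_op_commute: "e_op x (e_op y v) = smul ((-1) powi B x y) (e_op y (e_op x v))"
  using cocycle unfolding is_sign_cocycle_def by blast+

lemma eps_0_right [simp]: "\<epsilon> x 0 = 1"
  using eps_add_right[of x 0 0] eps_cases[of x 0] by auto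

text \<open>By \<open>even_B\<close> the sign in the commutation relation is 1. Comparing both
  orders on the vacuum leaves the two cocycle values, and multiplicativity in the first argument
  follows.\<close>

lemma eps_sym: "\<epsilon> x y = \<epsilon> y x"
proof -
  have "(-1::complex) powi B x y = 1" using even_B by simp
  hence "Poly_Mapping.lookup (e_op x (e_op y (evec 0))) ({#}, x + y) =
      Poly_Mapping.lookup (e_op y (e_op x (evec 0))) ({#}, x + y)"
    by (simp add: e_op_commute[of x y])
  thus ?thesis
    by (simp add: evec_def e_op_bvec is_linear_smul[OF is_linear_e_op] lookup_bvec add.commute)
qed

lemma eps_add_left: "\<epsilon> (x + y) z = \<epsilon> x z * \<epsilon> y z"
  by (simp add: eps_sym[of _ z] eps_add_right)

lemma eps_0_left [simp]: "\<epsilon> 0 x = 1"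
  by (simp add: eps_sym[of 0])

lemma eps_sum_left: "finite A \<Longrightarrow> \<epsilon> (sum f A) x = (\<Prod>i\<in>A. \<epsilon> (f i) x)"
  by (induction A rule: finite_induct) (auto simp: eps_add_left)

lemma eps_sum_right: "finite A \<Longrightarrow> \<epsilon> x (sum f A) = (\<Prod>i\<in>A. \<epsilon> x (f i))"
  by (induction A rule: finite_induct) (auto simp: eps_add_right)

section \<open>The spectrum of L(0)\<close>

lemma Y_exp_0: "Y_exp 0 m v = (if m = 0 then v else 0)"
proof -
  have "Y_exp 0 m (bvec \<sigma> \<gamma>) = (if m = 0 then bvec \<sigma> \<gamma> else 0)" for \<sigma> \<gamma>
  proof (rule poly_mapping_eqI)
    fix b :: "nat multiset \<times> 'l"
    obtain \<rho> \<delta> where b: "b = (\<rho>, \<delta>)" by force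
    show "Poly_Mapping.lookup (Y_exp 0 m (bvec \<sigma> \<gamma>)) b =
        Poly_Mapping.lookup (if m = 0 then bvec \<sigma> \<gamma> else 0) b"
      unfolding b lookup_Y_exp using fock_kernel_zero[of \<rho> \<sigma>, where 'a = complex]
      by (auto simp: lookup_bvec)
  qed
  hence "Y_exp 0 m (Poly_Mapping.single b 1) = (if m = 0 then Poly_Mapping.single b 1 else 0)" for b
    by (cases b) (simp add: bvec_def)
  thus ?thesis
    by (subst is_linear_expand[OF is_linear_Y_exp]) (auto simp flip: basis_expansion)
qed

lemma conformal_vector_eq: "conformal_vector = smul (1 / 2) (bvec {#0, 0#} 0)"
proof -
  have "heis a (- 1) (bvec \<mu> \<gamma>) = bvec (add_mset 0 \<mu>) \<gamma>" for \<mu> \<gamma>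
    using heis_bvec_neg[of a 0 \<mu> \<gamma>] by (simp add: norm_a)
  thus ?thesis by (simp add: conformal_vector_def evec_def)
qed

text \<open>The field of the vacuum is the identity, so one \<open>normal_prod 0\<close> gives
  \<open>a(z)\<close> and two give its normally ordered square. The coefficient at
  \<open>z^(-2)\<close> pairs \<open>a(-l-1)\<close> with \<open>a(l+1)\<close>.\<close>

lemma L0_eq: "L0 v = smul (1 / 2) (Sum_any (\<lambda>l::int. if l \<ge> 0 then heis a (- l - 1) (heis a (l + 1) v)
    else heis a (l + 1) (heis a (- l - 1) v)))"
proof -
  have 1: "normal_prod 0 (Y_exp 0) m v = heis a (- m - 1) v" for m v
  proof -
    have "normal_prod 0 (Y_exp 0) m v = Sum_any (\<lambda>l. if l = m then heis a (- m - 1) v else 0)"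
      unfolding normal_prod_def Y_exp_0 by (intro arg_cong[of _ _ Sum_any]) (auto simp: is_linear_0[OF is_linear_heis])
    thus ?thesis by (simp add: Sum_any.delta)
  qed
  have "L0 v = smul (1 / 2) (normal_prod 0 (normal_prod 0 (Y_exp 0)) (- 2) v)"
    unfolding L0_def Y_def conformal_vector_eq is_linear_smul[OF is_linear_lin_ext]
    by (simp add: bvec_def)
  also have "normal_prod 0 (normal_prod 0 (Y_exp 0)) (- 2) v =
      Sum_any (\<lambda>l::int. if l \<ge> 0 then heis a (- l - 1) (heis a (l + 1) v)
        else heis a (l + 1) (heis a (- l - 1) v))"
    unfolding normal_prod_def[of 0 "normal_prod 0 (Y_exp 0)"] 1
    by (intro arg_cong[of _ _ Sum_any] ext) (auto simp: algebra_simps)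
  finally show ?thesis .
qed

text \<open>The summands \<open>l = k\<close> and \<open>l = - 2 - k\<close> both give
  \<open>a(-k-1) a(k+1)\<close>, which contributes \<open>Suc k\<close> for each occurrence of
  \<open>k\<close>. This double counting cancels the factor 1/2, and \<open>l = -1\<close> leaves
  half of the square of \<open>a(0)\<close>, that is half the norm of
  \<open>\<gamma>\<close>.\<close>

lemma L0_eigenvector:
  "L0 (smul c (bvec \<mu> \<gamma>)) = smul (c * (of_int (B \<gamma> \<gamma>) / 2 + of_nat (weight \<mu>))) (bvec \<mu> \<gamma>)"
proof -
  define C where "C l = (if l \<ge> 0 then of_nat (Suc (nat l) * count \<mu> (nat l))
    else if l = -1 then of_int (B \<gamma> \<gamma>)
    else of_nat (Suc (nat (- l - 2)) * count \<mu> (nat (- l - 2))) :: complex)" for l :: int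
  have pair: "heis a (- int (Suc k)) (heis a (int (Suc k)) (smul c (bvec \<mu> \<gamma>))) =
      smul (c * of_nat (Suc k * count \<mu> k)) (bvec \<mu> \<gamma>)" for k
  proof (cases "k \<in># \<mu>")
    case True
    thus ?thesis
      by (simp add: is_linear_smul[OF is_linear_heis] heis_bvec_pos heis_bvec_neg norm_a mult.assoc
          del: of_nat_Suc mult_Suc)
  next
    case False
    thus ?thesis
      by (simp add: is_linear_smul[OF is_linear_heis] heis_bvec_pos not_in_iff is_linear_0[OF is_linear_heis]
          del: of_nat_Suc mult_Suc)
  qed
  have T: "(if l \<ge> 0 then heis a (- l - 1) (heis a (l + 1) (smul c (bvec \<mu> \<gamma>)))
    else heis a (l + 1) (heis a (- l - 1) (smul c (bvec \<mu> \<gamma>)))) = smul (c * C l) (bvec \<mu> \<gamma>)" for l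
  proof -
    consider k where "l = int k" | "l = -1" | k where "l = - 2 - int k"
    proof (cases "l \<ge> -1")
      case True
      thus ?thesis using that(1)[of "nat l"] that(2) by linarith
    next
      case False
      thus ?thesis using that(3)[of "nat (- l - 2)"] by linarith
    qed
    thus ?thesis
    proof cases
      case 1
      have l: "- l - 1 = - int (Suc k)" "l + 1 = int (Suc k)" "l \<ge> 0" using 1 by auto
      have C: "C l = of_nat (Suc k * count \<mu> k)" using 1 by (simp add: C_def)
      show ?thesis unfolding if_P[OF l(3)] l(1,2) C by (rule pair)
    next
      case 2
      have "form a (1, \<gamma>) * form a (1, \<gamma>) = of_int (B \<gamma> \<gamma>)"
        using charge_mult[of \<gamma> \<gamma>] by (simp add: charge_def form_def B_sym[of "snd a"])
      thus ?thesis using 2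
        by (simp add: C_def is_linear_smul[OF is_linear_heis] heis_bvec_0 mult.assoc)
    next
      case 3
      have l: "- l - 1 = int (Suc k)" "l + 1 = - int (Suc k)" "\<not> l \<ge> 0" using 3 by auto
      have C: "C l = of_nat (Suc k * count \<mu> k)" using 3 by (simp add: C_def)
      show ?thesis unfolding if_not_P[OF l(3)] l(1,2) C by (rule pair)
    qed
  qed
  obtain N where N: "set_mset \<mu> \<subseteq> {..<N}" using finite_nat_iff_bounded[of "set_mset \<mu>"] by auto
  let ?S1 = "int ` {..<N}" and ?S2 = "{-1::int}" and ?S3 = "(\<lambda>k. - 2 - int k) ` {..<N}"
  have z: "count \<mu> k = 0" if "\<not> k < N" for k using N that by (auto simp: not_in_iff[symmetric])
  have supp: "C l = 0" if "l \<notin> ?S1 \<union> (?S2 \<union> ?S3)" for l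
  proof (cases "l \<ge> 0")
    case True
    hence "\<not> nat l < N" using that by (metis UnCI image_eqI int_nat_eq lessThan_iff)
    thus ?thesis using True by (simp add: C_def z)
  next
    case False
    have "\<not> nat (- l - 2) < N"
    proof
      assume "nat (- l - 2) < N"
      moreover have "l = - 2 - int (nat (- l - 2))" using False that by auto
      ultimately show False using that by blast
    qed
    thus ?thesis using False that by (simp add: C_def z)
  qed
  have w: "(\<Sum>k<N. of_nat (Suc k * count \<mu> k)) = (of_nat (weight \<mu>) :: complex)"
    unfolding weight_sum[OF N, symmetric] by simp
  have "sum C (?S1 \<union> (?S2 \<union> ?S3)) = sum C ?S1 + (sum C ?S2 + sum C ?S3)"
    by (subst sum.union_disjoint; (subst sum.union_disjoint)?) auto
  also have "sum C ?S1 = of_nat (weight \<mu>)"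
    unfolding w[symmetric] by (subst sum.reindex) (auto simp: C_def inj_on_def)
  also have "sum C ?S3 = of_nat (weight \<mu>)"
    unfolding w[symmetric] by (subst sum.reindex) (auto simp: C_def inj_on_def)
  also have "sum C ?S2 = of_int (B \<gamma> \<gamma>)" by (simp add: C_def)
  finally have C: "sum C (?S1 \<union> (?S2 \<union> ?S3)) = of_int (B \<gamma> \<gamma>) + 2 * of_nat (weight \<mu>)" by simp
  have "L0 (smul c (bvec \<mu> \<gamma>)) = smul (1 / 2) (Sum_any (\<lambda>l. smul (c * C l) (bvec \<mu> \<gamma>)))"
    unfolding L0_eq T ..
  also have "Sum_any (\<lambda>l. smul (c * C l) (bvec \<mu> \<gamma>)) =
      (\<Sum>l\<in>?S1 \<union> (?S2 \<union> ?S3). smul (c * C l) (bvec \<mu> \<gamma>))"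
    by (rule Sum_any.expand_superset) (use supp in fastforce)+
  also have "\<dots> = smul (c * (of_int (B \<gamma> \<gamma>) + 2 * of_nat (weight \<mu>))) (bvec \<mu> \<gamma>)"
    unfolding smul_sum_left[symmetric] sum_distrib_left[symmetric] C ..
  finally show ?thesis by (simp add: algebra_simps)
qed

lemma exp_L0_evec: "exp_L0 z (evec \<alpha>) = smul (exp (z * of_int (B \<alpha> \<alpha>) / 2)) (evec \<alpha>)"
  unfolding exp_L0_def evec_def bvec_def
  by (rule exp_op_eigenvector)
     (simp add: L0_eigenvector[unfolded bvec_def] algebra_simps)

lemma q_L0_bvec: "q_L0 \<tau> (bvec \<mu> \<gamma>) =
    smul (exp (2 * of_real pi * \<i> * \<tau> * (of_int (B \<gamma> \<gamma>) / 2 + of_nat (weight \<mu>) - 1 / 24))) (bvec \<mu> \<gamma>)"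
  unfolding q_L0_def bvec_def
proof (rule exp_op_eigenvector, rule poly_mapping_eqI)
  fix c b
  show "Poly_Mapping.lookup (smul (2 * of_real pi * \<i> * \<tau>) (L0 (smul c (Poly_Mapping.single (\<mu>, \<gamma>) 1)) -
      smul (1 / 24) (smul c (Poly_Mapping.single (\<mu>, \<gamma>) 1)))) b =
    Poly_Mapping.lookup (smul (c * (2 * of_real pi * \<i> * \<tau> * (of_int (B \<gamma> \<gamma>) / 2 + of_nat (weight \<mu>) - 1 / 24)))
      (Poly_Mapping.single (\<mu>, \<gamma>) 1)) b"
    by (simp add: L0_eigenvector[unfolded bvec_def] lookup_minus algebra_simps)
qed

lemma Y_evec: "Y (smul c (evec \<alpha>)) m v = smul c (Y_exp \<alpha> m v)"
  unfolding Y_def evec_def bvec_def is_linear_smul[OF is_linear_lin_ext] by simp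

end

section \<open>Traces of products of exponential fields\<close>

abbreviation q_log_term :: "'a::{banach, real_normed_field} \<Rightarrow> 'a \<Rightarrow> nat \<Rightarrow> 'a" where
  "q_log_term t x k \<equiv> x ^ Suc k / of_nat (Suc k) * lambert t k"

definition q_log :: "complex \<Rightarrow> complex \<Rightarrow> complex" where
  "q_log t x = suminf (\<lambda>k. q_log_term t x k)"

lemma has_abs_sum_cong_neutral:
  assumes "S \<subseteq> T" "\<And>x. x \<in> T - S \<Longrightarrow> f x = 0"
  shows "has_abs_sum f s C S \<longleftrightarrow> has_abs_sum f s C T"
proof -
  have "(f has_sum s) S \<longleftrightarrow> (f has_sum s) T"
    by (rule has_sum_cong_neutral) (use assms in auto)
  moreover have "(\<lambda>x. norm (f x)) summable_on S \<longleftrightarrow> (\<lambda>x. norm (f x)) summable_on T"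
    by (rule summable_on_cong_neutral) (use assms in auto)
  moreover have "infsum (\<lambda>x. norm (f x)) S = infsum (\<lambda>x. norm (f x)) T"
    by (rule infsum_cong_neutral) (use assms in auto)
  ultimately show ?thesis by (simp add: has_abs_sum_def)
qed

text \<open>Adjoins an exponent \<open>n\<close> whose value is forced by the grading, so that it
  can be summed along with the remaining indices.\<close>

lemma has_abs_sum_slice:
  assumes "has_abs_sum h s C A"
  shows "has_abs_sum (\<lambda>(n, g). if n = n0 then h g else 0) s C (UNIV \<times> A)"
proof -
  let ?F = "\<lambda>(n, g). if n = n0 then h g else 0"
  have bij: "bij_betw (\<lambda>g. (n0, g)) A ({n0} \<times> A)" by (auto simp: bij_betw_def inj_on_def)
  have "has_abs_sum (\<lambda>g. ?F (n0, g)) s C A" using assms by simp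
  hence "has_abs_sum ?F s C ({n0} \<times> A)"
    using has_abs_sum_reindex_bij_betw[OF bij, of ?F] by simp
  thus ?thesis
    by (subst (asm) has_abs_sum_cong_neutral[of _ "UNIV \<times> A"]) (auto split: if_splits)
qed

text \<open>Stated through \<open>exp\<close>, so that integer powers of \<open>1 - x\<close> arise
  without a choice of branch.\<close>

lemma log_series:
  fixes x :: complex
  assumes "norm x < 1"
  shows "summable (\<lambda>k. x ^ Suc k / of_nat (Suc k))"
    and "exp (- suminf (\<lambda>k. x ^ Suc k / of_nat (Suc k))) = 1 - x"
proof -
  have "(\<lambda>n. ((-1) ^ Suc n / of_nat n) * (-x) ^ n) sums Ln (1 + (-x))"
    by (rule Ln_series) (use assms in auto)
  hence "(\<lambda>n. ((-1) ^ Suc (Suc n) / of_nat (Suc n)) * (-x) ^ Suc n) sums Ln (1 - x)"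
    by (subst sums_Suc_iff) simp
  hence "(\<lambda>n. - (((-1) ^ Suc (Suc n) / of_nat (Suc n)) * (-x) ^ Suc n)) sums - Ln (1 - x)"
    by (rule sums_minus)
  also have "(\<lambda>n. - (((-1) ^ Suc (Suc n) / of_nat (Suc n)) * (-x) ^ Suc n)) = (\<lambda>k. x ^ Suc k / of_nat (Suc k))"
  proof
    fix k
    have "(- x) ^ Suc k = (-1) ^ Suc k * x ^ Suc k" by (rule power_minus)
    moreover have "(-1::complex) ^ Suc (Suc k) * (-1) ^ Suc k = -1" by simp
    ultimately have "(-1) ^ Suc (Suc k) * (- x) ^ Suc k = - (x ^ Suc k)"
      by (metis mult.assoc mult_minus1)
    thus "- (((-1) ^ Suc (Suc k) / of_nat (Suc k)) * (- x) ^ Suc k) = x ^ Suc k / of_nat (Suc k)"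
      by (metis minus_divide_left minus_minus times_divide_eq_left)
  qed
  finally have *: "(\<lambda>k. x ^ Suc k / of_nat (Suc k)) sums - Ln (1 - x)" .
  show "summable (\<lambda>k. x ^ Suc k / of_nat (Suc k))" using * by (rule sums_summable)
  have "1 - x \<noteq> 0" using assms by auto
  thus "exp (- suminf (\<lambda>k. x ^ Suc k / of_nat (Suc k))) = 1 - x"
    unfolding sums_unique[OF *, symmetric] by simp
qed

lemma summable_power_quotient:
  fixes r :: real
  assumes "0 \<le> r" "r < 1"
  shows "summable (\<lambda>k. C * r ^ Suc k)"
  using assms by (intro summable_mult) (simp add: summable_mult summable_geometric)

lemma sum_product_mult:
  fixes f :: "'b \<Rightarrow> 'a::comm_semiring_0"
  shows "sum f I * sum g J * c = (\<Sum>i\<in>I. \<Sum>j\<in>J. f i * g j * c)"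
  unfolding sum_product unfolding sum_distrib_right ..

context rank_one_lattice_voa
begin

section \<open>Paths through intermediate states\<close>

context
  fixes \<alpha> :: "'n::{finite,linorder} \<Rightarrow> 'l" and \<beta> :: 'l and Q :: "'n \<Rightarrow> complex"
begin

definition cre :: "'n \<Rightarrow> nat \<Rightarrow> complex" where
  "cre i k = charge (\<alpha> i) / of_nat (Suc k) * Q i ^ Suc k"

definition ann :: "'n \<Rightarrow> nat \<Rightarrow> complex" where
  "ann i k = - charge (\<alpha> i) / Q i ^ Suc k"

abbreviation sum_kernel :: "'n set \<Rightarrow> nat multiset \<Rightarrow> nat multiset \<Rightarrow> complex" where
  "sum_kernel S \<equiv> fock_kernel (\<lambda>k. \<Sum>i\<in>S. cre i k) (\<lambda>k. \<Sum>i\<in>S. ann i k)"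

abbreviation norm_kernel :: "'n set \<Rightarrow> nat multiset \<Rightarrow> nat multiset \<Rightarrow> real" where
  "norm_kernel S \<equiv> fock_kernel (\<lambda>k. \<Sum>i\<in>S. norm (cre i k)) (\<lambda>k. \<Sum>i\<in>S. norm (ann i k))"

definition total_charge :: "'n list \<Rightarrow> 'l" where
  "total_charge xs = (\<Sum>i\<in>set xs. \<alpha> i) + \<beta>"

text \<open>A single coefficient of the product, read off in the one lattice sector that the product
  can reach. Arbitrary lists and two independent basis states, instead of the full product on the
  diagonal, allow induction on the list.\<close>

definition path_coeff :: "'n list \<Rightarrow> ('n \<Rightarrow> int) \<Rightarrow> nat multiset \<Rightarrow> nat multiset \<Rightarrow> complex" where
  "path_coeff xs m \<rho> \<mu> = basis_lookup (foldr (\<lambda>i. Y_exp (\<alpha> i) (m i)) xs (bvec \<mu> \<beta>)) \<rho> (total_charge xs) *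
     (\<Prod>i\<in>set xs. Q i powi m i)"

text \<open>For nonzero \<open>Q i\<close> this is the sign times a power of
  \<open>Q i - Q j\<close>. The two powers are kept apart because the first comes from
  \<open>z^\<alpha>\<close> and the second from contracting annihilation with creation
  operators.\<close>

definition pair_factor :: "'n \<Rightarrow> 'n \<Rightarrow> complex" where
  "pair_factor i j = of_int (\<epsilon> (\<alpha> i) (\<alpha> j)) * Q i powi B (\<alpha> i) (\<alpha> j) * (1 - Q j / Q i) powi B (\<alpha> i) (\<alpha> j)"

definition single_factor :: "'n \<Rightarrow> complex" where
  "single_factor i = of_int (\<epsilon> (\<alpha> i) \<beta>) * Q i powi B (\<alpha> i) \<beta>"

text \<open>The scalar that remains when all \<open>z\<^sup>\<alpha>\<close>, \<open>e\<^sup>\<alpha>\<close> and annihilation operators are moved to the right.\<close>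

definition path_factor :: "'n set \<Rightarrow> complex" where
  "path_factor S = (\<Prod>i\<in>S. single_factor i) * (\<Prod>(i, j)\<in>{(i, j). i \<in> S \<and> j \<in> S \<and> i < j}. pair_factor i j)"

context
  assumes Q_nz: "\<And>i. Q i \<noteq> 0"
    and Q_mono: "\<And>i j. i < j \<Longrightarrow> norm (Q j) < norm (Q i)"
begin

text \<open>The contraction is dominated by a geometric series in \<open>Q j / Q i\<close>; here the
  ordering of the absolute values is used.\<close>

lemma summable_ann_cre:
  assumes "i < j"
  shows "summable (\<lambda>k. norm (ann i k) * norm (cre j k))"
proof (rule summable_comparison_test)
  let ?r = "norm (Q j) / norm (Q i)"
  show "summable (\<lambda>k. (norm (charge (\<alpha> i)) * norm (charge (\<alpha> j))) * ?r ^ Suc k)"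
    by (rule summable_power_quotient) (use Q_mono[OF assms] Q_nz[of i] in \<open>auto simp: divide_simps\<close>)
  have "norm (cre j k) \<le> norm (charge (\<alpha> j)) * norm (Q j) ^ Suc k" for k
  proof -
    have "norm (charge (\<alpha> j)) / real (Suc k) \<le> norm (charge (\<alpha> j))"
      by (simp add: divide_le_eq mult_le_cancel_left1 del: of_nat_Suc)
    thus ?thesis unfolding cre_def norm_mult norm_divide norm_power
      by (intro mult_right_mono) (auto simp del: of_nat_Suc)
  qed
  hence "norm (ann i k) * norm (cre j k) \<le>
      (norm (charge (\<alpha> i)) / norm (Q i) ^ Suc k) * (norm (charge (\<alpha> j)) * norm (Q j) ^ Suc k)" for k
    unfolding ann_def norm_divide norm_minus_cancel norm_power by (intro mult_left_mono) auto
  thus "\<exists>N. \<forall>k\<ge>N. norm (norm (ann i k) * norm (cre j k)) \<le>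
      norm (charge (\<alpha> i)) * norm (charge (\<alpha> j)) * ?r ^ Suc k"
    by (intro exI[of _ 0]) (simp add: power_divide mult_ac)
qed

lemma exp_suminf_ann_cre:
  assumes "i < j"
  shows "exp (suminf (\<lambda>k. ann i k * cre j k)) = (1 - Q j / Q i) powi B (\<alpha> i) (\<alpha> j)"
proof -
  let ?x = "Q j / Q i"
  have x: "norm ?x < 1" using Q_mono[OF assms] Q_nz[of i] by (simp add: norm_divide divide_simps)
  have "ann i k * cre j k = - (charge (\<alpha> i) * charge (\<alpha> j)) * (?x ^ Suc k / of_nat (Suc k))" for k
    unfolding ann_def cre_def by (simp add: power_divide del: of_nat_Suc power_Suc)
  hence "suminf (\<lambda>k. ann i k * cre j k) = suminf (\<lambda>k. - of_int (B (\<alpha> i) (\<alpha> j)) * (?x ^ Suc k / of_nat (Suc k)))"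
    by (simp only: charge_mult)
  also have "\<dots> = - of_int (B (\<alpha> i) (\<alpha> j)) * suminf (\<lambda>k. ?x ^ Suc k / of_nat (Suc k))"
    by (rule suminf_mult[OF log_series(1)[OF x]])
  finally have "exp (suminf (\<lambda>k. ann i k * cre j k)) =
      exp (of_int (B (\<alpha> i) (\<alpha> j)) * (- suminf (\<lambda>k. ?x ^ Suc k / of_nat (Suc k))))" by simp
  thus ?thesis unfolding exp_power_int[symmetric] log_series(2)[OF x] .
qed

text \<open>A new least index \<open>x\<close> adds exactly the pairs \<open>(x, j)\<close>. The
  factors displayed are what the operator of \<open>x\<close> contributes when it acts on the sector
  reached by the others: cocycle, power of \<open>Q x\<close>, contractions.\<close>

lemma path_factor_insert:
  assumes "finite S" "\<And>j. j \<in> S \<Longrightarrow> x < j"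
  shows "path_factor (insert x S) = of_int (\<epsilon> (\<alpha> x) ((\<Sum>i\<in>S. \<alpha> i) + \<beta>)) *
    Q x powi B (\<alpha> x) ((\<Sum>i\<in>S. \<alpha> i) + \<beta>) * exp (suminf (\<lambda>k. ann x k * (\<Sum>j\<in>S. cre j k))) * path_factor S"
proof -
  have x: "x \<notin> S" using assms(2) by blast
  have P: "{(i, j). i \<in> insert x S \<and> j \<in> insert x S \<and> i < j} =
      {(i, j). i \<in> S \<and> j \<in> S \<and> i < j} \<union> {x} \<times> S"
    using assms(2) by (auto dest: order.asym)
  have fin: "finite {(i, j). i \<in> S \<and> j \<in> S \<and> i < j}"
    by (rule finite_subset[of _ "S \<times> S"]) (use assms in auto)
  have prod: "(\<Prod>(i, j)\<in>{(i, j). i \<in> insert x S \<and> j \<in> insert x S \<and> i < j}. pair_factor i j) =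
      (\<Prod>(i, j)\<in>{(i, j). i \<in> S \<and> j \<in> S \<and> i < j}. pair_factor i j) * (\<Prod>j\<in>S. pair_factor x j)"
  proof -
    have "(\<Prod>(i, j)\<in>{x} \<times> S. pair_factor i j) = (\<Prod>j\<in>S. pair_factor x j)"
      by (subst prod.cartesian_product[symmetric]) simp
    thus ?thesis unfolding P
      by (subst prod.union_disjoint) (use fin assms(1) x in auto)
  qed
  have powi: "Q x powi (\<Sum>j\<in>A. f j) = (\<Prod>j\<in>A. Q x powi f j)" for f :: "'n \<Rightarrow> int" and A
    by (induction A rule: infinite_finite_induct) (simp_all add: power_int_add Q_nz)
  have sm: "summable (\<lambda>k. ann x k * cre j k)" if "j \<in> S" for j
    by (rule summable_norm_cancel) (use summable_ann_cre[OF assms(2)[OF that]] in \<open>simp add: norm_mult\<close>)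
  have "suminf (\<lambda>k. ann x k * (\<Sum>j\<in>S. cre j k)) = (\<Sum>j\<in>S. suminf (\<lambda>k. ann x k * cre j k))"
    unfolding sum_distrib_left by (rule suminf_sum[OF sm])
  hence e: "exp (suminf (\<lambda>k. ann x k * (\<Sum>j\<in>S. cre j k))) =
      (\<Prod>j\<in>S. (1 - Q j / Q x) powi B (\<alpha> x) (\<alpha> j))"
    using assms by (simp add: exp_sum exp_suminf_ann_cre)
  have "of_int (\<epsilon> (\<alpha> x) ((\<Sum>i\<in>S. \<alpha> i) + \<beta>)) * Q x powi B (\<alpha> x) ((\<Sum>i\<in>S. \<alpha> i) + \<beta>) =
      single_factor x * (\<Prod>j\<in>S. of_int (\<epsilon> (\<alpha> x) (\<alpha> j)) * Q x powi B (\<alpha> x) (\<alpha> j))"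
    by (simp add: eps_add_right eps_sum_right[OF assms(1)] B_add_right B_sum_right power_int_add Q_nz
        powi single_factor_def prod.distrib)
  thus ?thesis
    unfolding path_factor_def prod e
    using x assms(1) by (simp add: pair_factor_def prod.distrib mult_ac)
qed

lemma lookup_Y_exp_general:
  "basis_lookup (Y_exp \<gamma> n v) \<rho> \<delta> =
     (\<Sum>b\<in>Poly_Mapping.keys v. Poly_Mapping.lookup v b * basis_lookup (Y_exp \<gamma> n (Poly_Mapping.single b 1)) \<rho> \<delta>)"
  by (subst is_linear_expand[OF is_linear_Y_exp]) (simp add: lookup_sum)

lemma lookup_foldr_Y_exp_eq_0:
  assumes "distinct xs" "\<delta> \<noteq> total_charge xs"
  shows "basis_lookup (foldr (\<lambda>i. Y_exp (\<alpha> i) (m i)) xs (bvec \<mu> \<beta>)) \<rho> \<delta> = 0"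
  using assms
proof (induction xs arbitrary: \<rho> \<delta>)
  case Nil
  thus ?case by (simp add: lookup_bvec total_charge_def)
next
  case (Cons x xs)
  have tc: "total_charge (x # xs) = \<alpha> x + total_charge xs"
    using Cons.prems(1) by (simp add: total_charge_def add.assoc)
  show ?case
    unfolding foldr.simps o_def lookup_Y_exp_general[of _ _ "foldr _ _ _"]
  proof (intro sum.neutral ballI)
    fix b assume "b \<in> Poly_Mapping.keys (foldr (\<lambda>i. Y_exp (\<alpha> i) (m i)) xs (bvec \<mu> \<beta>))"
    obtain \<sigma> \<gamma> where b: "b = (\<sigma>, \<gamma>)" by force
    show "Poly_Mapping.lookup (foldr (\<lambda>i. Y_exp (\<alpha> i) (m i)) xs (bvec \<mu> \<beta>)) b *
        basis_lookup (Y_exp (\<alpha> x) (m x) (Poly_Mapping.single b 1)) \<rho> \<delta> = 0"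
    proof (cases "\<gamma> = total_charge xs")
      case True
      thus ?thesis using Cons.prems(2) tc lookup_Y_exp[of "\<alpha> x" "m x" \<sigma> \<gamma> \<rho> \<delta>] by (simp add: b bvec_def)
    qed (use Cons.IH[of \<gamma> \<sigma>] Cons.prems(1) b in auto)
  qed
qed

text \<open>Insertion of the intermediate states \<open>\<sigma>\<close> between the first operator
  and the rest. Only those whose weight fits the exponent \<open>n\<close> contribute.\<close>

lemma path_coeff_Cons:
  assumes "distinct (x # xs)"
  shows "((\<lambda>\<sigma>. if n = B (\<alpha> x) (total_charge xs) + int (weight \<rho>) - int (weight \<sigma>)
      then of_int (\<epsilon> (\<alpha> x) (total_charge xs)) * Q x powi B (\<alpha> x) (total_charge xs) *
        fock_kernel (cre x) (ann x) \<rho> \<sigma> * path_coeff xs g \<sigma> \<mu> else 0)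
      has_sum path_coeff (x # xs) (g(x := n)) \<rho> \<mu>) UNIV"
proof -
  let ?v = "foldr (\<lambda>i. Y_exp (\<alpha> i) (g i)) xs (bvec \<mu> \<beta>)" and ?c = "total_charge xs"
  let ?F = "\<lambda>\<sigma>. if n = B (\<alpha> x) ?c + int (weight \<rho>) - int (weight \<sigma>)
      then of_int (\<epsilon> (\<alpha> x) ?c) * Q x powi B (\<alpha> x) ?c *
        fock_kernel (cre x) (ann x) \<rho> \<sigma> * path_coeff xs g \<sigma> \<mu> else 0"
  have x: "x \<notin> set xs" using assms by simp
  have tc: "total_charge (x # xs) = \<alpha> x + ?c"
    using assms by (simp add: total_charge_def add.assoc)
  have f: "foldr (\<lambda>i. Y_exp (\<alpha> i) ((g(x := n)) i)) xs w = foldr (\<lambda>i. Y_exp (\<alpha> i) (g i)) xs w" for w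
    using x by (induction xs) auto
  have p: "(\<Prod>i\<in>set (x # xs). Q i powi (g(x := n)) i) = Q x powi n * (\<Prod>i\<in>set xs. Q i powi g i)"
  proof -
    have "(\<Prod>i\<in>set xs. Q i powi (g(x := n)) i) = (\<Prod>i\<in>set xs. Q i powi g i)"
      by (rule prod.cong) (use x in auto)
    thus ?thesis using x by simp
  qed
  have F: "?F \<sigma> = basis_lookup ?v \<sigma> ?c * basis_lookup (Y_exp (\<alpha> x) n (bvec \<sigma> ?c)) \<rho> (\<alpha> x + ?c) *
      (Q x powi n * (\<Prod>i\<in>set xs. Q i powi g i))" for \<sigma>
  proof (cases "n = B (\<alpha> x) ?c + int (weight \<rho>) - int (weight \<sigma>)")
    case True
    \<comment> \<open>The first power stays a scalar; the quotient by weights is absorbed into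
      \<open>cre\<close> and \<open>ann\<close> by \<open>fock_kernel_scale\<close>.\<close>
    have "Q x powi n = Q x powi B (\<alpha> x) ?c * (Q x ^ weight \<rho> / Q x ^ weight \<sigma>)"
      by (simp add: True power_int_add power_int_diff Q_nz)
    hence "Q x powi n * fock_kernel (\<lambda>k. charge (\<alpha> x) / of_nat (Suc k)) (\<lambda>_. - charge (\<alpha> x)) \<rho> \<sigma> =
        Q x powi B (\<alpha> x) ?c * fock_kernel (cre x) (ann x) \<rho> \<sigma>"
      unfolding cre_def[abs_def] ann_def[abs_def] fock_kernel_scale[OF Q_nz] by simp
    moreover have "basis_lookup (Y_exp (\<alpha> x) n (bvec \<sigma> ?c)) \<rho> (\<alpha> x + ?c) = of_int (\<epsilon> (\<alpha> x) ?c) *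
        fock_kernel (\<lambda>k. charge (\<alpha> x) / of_nat (Suc k)) (\<lambda>_. - charge (\<alpha> x)) \<rho> \<sigma>"
      unfolding lookup_Y_exp using True by simp
    moreover have "e * c * d * (u * w) = u * r * (p * w)" if "p * b = c * d" "r = e * b"
      for p b c d e u w r :: complex using that by algebra
    ultimately show ?thesis unfolding if_P[OF True] path_coeff_def by blast
  qed (simp add: lookup_Y_exp)
  have "(?F has_sum (\<Sum>\<sigma>\<in>fst ` Poly_Mapping.keys ?v. ?F \<sigma>)) UNIV"
  proof (rule has_sum_finite_neutralI)
    fix \<sigma> assume "\<sigma> \<in> UNIV - fst ` Poly_Mapping.keys ?v"
    hence "(\<sigma>, ?c) \<notin> Poly_Mapping.keys ?v" by force
    thus "?F \<sigma> = 0" unfolding F by (simp add: in_keys_iff)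
  qed auto
  also have "(\<Sum>\<sigma>\<in>fst ` Poly_Mapping.keys ?v. ?F \<sigma>) = (\<Sum>b\<in>Poly_Mapping.keys ?v. ?F (fst b))"
  \<comment> \<open>All keys of \<open>?v\<close> lie in the sector \<open>?c\<close>, so they are
    determined by their first component.\<close>
  proof (subst sum.reindex)
    have "snd b = ?c" if "b \<in> Poly_Mapping.keys ?v" for b
      using that lookup_foldr_Y_exp_eq_0[of xs "snd b" g \<mu> "fst b"] assms by (auto simp: in_keys_iff)
    thus "inj_on fst (Poly_Mapping.keys ?v)" by (auto simp: inj_on_def prod_eq_iff)
  qed simp
  also have "\<dots> = (\<Sum>b\<in>Poly_Mapping.keys ?v. Poly_Mapping.lookup ?v b *
      basis_lookup (Y_exp (\<alpha> x) n (Poly_Mapping.single b 1)) \<rho> (\<alpha> x + ?c)) * (Q x powi n * (\<Prod>i\<in>set xs. Q i powi g i))"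
    unfolding sum_distrib_right
  proof (rule sum.cong[OF refl])
    fix b assume b: "b \<in> Poly_Mapping.keys ?v"
    have "snd b = ?c"
      using b lookup_foldr_Y_exp_eq_0[of xs "snd b" g \<mu> "fst b"] assms by (auto simp: in_keys_iff)
    hence "b = (fst b, ?c)" by (simp add: prod_eq_iff)
    thus "?F (fst b) = Poly_Mapping.lookup ?v b *
      basis_lookup (Y_exp (\<alpha> x) n (Poly_Mapping.single b 1)) \<rho> (\<alpha> x + ?c) * (Q x powi n * (\<Prod>i\<in>set xs. Q i powi g i))"
      unfolding F bvec_def by metis
  qed
  also have "\<dots> = path_coeff (x # xs) (g(x := n)) \<rho> \<mu>"
    unfolding path_coeff_def p tc lookup_Y_exp_general[symmetric]
    by (simp only: foldr.simps o_apply f fun_upd_same)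
  finally show ?thesis .
qed


lemma path_coeff_Nil: "path_coeff [] m \<rho> \<mu> = (if \<rho> = \<mu> then 1 else 0)"
  by (simp add: path_coeff_def total_charge_def lookup_bvec)

lemma bij_betw_fun_upd:
  assumes "x \<notin> S"
  shows "bij_betw (\<lambda>(n, g). g(x := n)) (UNIV \<times> PiE S (\<lambda>_. UNIV)) (PiE (insert x S) (\<lambda>_. UNIV))"
proof (rule bij_betwI[where g = "\<lambda>m. (m x, m(x := undefined))"], goal_cases)
  case 3
  then show ?case using assms by (auto simp: fun_eq_iff PiE_def extensional_def)
qed (use assms in \<open>auto simp: PiE_def extensional_def\<close>)

abbreviation path_sum :: "'n list \<Rightarrow> real \<Rightarrow> nat multiset \<Rightarrow> nat multiset \<Rightarrow> bool" where
  "path_sum xs N \<rho> \<mu> \<equiv> has_abs_sum (\<lambda>m. path_coeff xs m \<rho> \<mu>)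
     (path_factor (set xs) * sum_kernel (set xs) \<rho> \<mu>) (N * norm_kernel (set xs) \<rho> \<mu>) (PiE (set xs) (\<lambda>_. UNIV))"

text \<open>The constant \<open>N\<close> is chosen before \<open>\<rho>\<close> and
  \<open>\<mu>\<close>, so the bound in the induction hypothesis is a multiple of a kernel and can
  itself be composed by \<open>fock_kernel_compose\<close>. This is what keeps the induction
  going.\<close>

lemma path_coeff_has_abs_sum:
  assumes "sorted xs" "distinct xs"
  shows "\<exists>N\<ge>0. \<forall>\<rho> \<mu>. path_sum xs N \<rho> \<mu>"
  using assms
proof (induction xs)
  case Nil
  show ?case
  proof (intro exI[of _ 1] conjI allI)
    fix \<rho> \<mu>
    show "path_sum [] 1 \<rho> \<mu>"
      by (auto simp: has_abs_sum_def path_coeff_Nil fock_kernel_zero path_factor_def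
          intro: has_sum_finiteI)
  qed simp
next
  case (Cons x xs)
  define S where "S = set xs"
  have S: "finite S" "x \<notin> S" "\<And>j. j \<in> S \<Longrightarrow> x < j"
    using Cons.prems by (auto simp: S_def order.strict_iff_order)
  have "sorted xs" "distinct xs" using Cons.prems by auto
  from Cons.IH[OF this] obtain N where N: "N \<ge> 0" "\<And>\<rho> \<mu>. has_abs_sum (\<lambda>m. path_coeff xs m \<rho> \<mu>)
    (path_factor S * sum_kernel S \<rho> \<mu>)
    (N * norm_kernel S \<rho> \<mu>)
    (PiE S (\<lambda>_. UNIV))" unfolding S_def by blast
  define e where "e = of_int (\<epsilon> (\<alpha> x) (total_charge xs)) * Q x powi B (\<alpha> x) (total_charge xs)"
  \<comment> \<open>Norms inside the sum, because the majorant kernels add the norms of the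
    parameters.\<close>
  have smn: "summable (\<lambda>k. norm (ann x k) * (\<Sum>j\<in>S. norm (cre j k)))"
    unfolding sum_distrib_left by (intro summable_sum summable_ann_cre S)
  have sm: "summable (\<lambda>k. norm (ann x k) * norm (\<Sum>j\<in>S. cre j k))"
    by (rule summable_comparison_test[OF _ smn])
       (auto intro!: exI[of _ 0] mult_left_mono norm_sum)
  define E where "E = exp (suminf (\<lambda>k. norm (ann x k) * (\<Sum>j\<in>S. norm (cre j k))))"
  define N' where "N' = norm e * (E * N)"
  show ?case
  proof (intro exI[of _ N'] conjI allI)
    show "N' \<ge> 0" using N(1) by (simp add: N'_def E_def)
    fix \<rho> \<mu>
    \<comment> \<open>For fixed \<open>\<sigma>\<close> a single \<open>n\<close> survives and the
      induction hypothesis sums over \<open>g\<close>; for fixed \<open>(n, g)\<close> the sum over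
      \<open>\<sigma>\<close> is \<open>path_coeff_Cons\<close>. Fubini exchanges the two.\<close>
    define F where "F p \<sigma> = (case p of (n, g) \<Rightarrow>
        if n = B (\<alpha> x) (total_charge xs) + int (weight \<rho>) - int (weight \<sigma>)
        then e * fock_kernel (cre x) (ann x) \<rho> \<sigma> * path_coeff xs g \<sigma> \<mu> else 0)" for p \<sigma>
    define G :: "nat multiset \<Rightarrow> complex" where "G \<sigma> = (e * fock_kernel (cre x) (ann x) \<rho> \<sigma>) *
        (path_factor S * sum_kernel S \<sigma> \<mu>)" for \<sigma>
    define H where "H \<sigma> = (norm e * fock_kernel (\<lambda>k. norm (cre x k)) (\<lambda>k. norm (ann x k)) \<rho> \<sigma>) *
        (N * norm_kernel S \<sigma> \<mu>)" for \<sigma>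
    have col: "has_abs_sum (\<lambda>p. F p \<sigma>) (G \<sigma>) (H \<sigma>) (UNIV \<times> PiE S (\<lambda>_. UNIV))" for \<sigma>
      unfolding F_def G_def
    proof (rule has_abs_sum_slice, rule has_abs_sum_mono[OF has_abs_sum_cmult[OF N(2)]])
      show "norm (e * fock_kernel (cre x) (ann x) \<rho> \<sigma>) *
          (N * norm_kernel S \<sigma> \<mu>) \<le> H \<sigma>"
        unfolding H_def norm_mult using N(1)
        by (intro mult_right_mono mult_left_mono norm_fock_kernel_le mult_nonneg_nonneg fock_kernel_nonneg)
           (auto intro!: sum_nonneg)
    qed
    have sumG: "(G has_sum path_factor (set (x # xs)) * sum_kernel (set (x # xs)) \<rho> \<mu>) UNIV"
    proof -
      have "((\<lambda>\<sigma>. e * path_factor S * (fock_kernel (cre x) (ann x) \<rho> \<sigma> *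
            sum_kernel S \<sigma> \<mu>)) has_sum
          e * path_factor S * (exp (suminf (\<lambda>k. ann x k * (\<Sum>j\<in>S. cre j k))) *
            fock_kernel (\<lambda>k. cre x k + (\<Sum>i\<in>S. cre i k)) (\<lambda>k. ann x k + (\<Sum>i\<in>S. ann i k)) \<rho> \<mu>)) UNIV"
        using fock_kernel_compose[OF sm] by (intro has_sum_cmult_right) (simp add: has_abs_sum_def)
      moreover have "path_factor (set (x # xs)) = e * path_factor S * exp (suminf (\<lambda>k. ann x k * (\<Sum>j\<in>S. cre j k)))"
        using path_factor_insert[OF S(1,3)] by (simp add: e_def total_charge_def mult_ac flip: S_def)
      ultimately show ?thesis using S(1,2) unfolding G_def by (simp add: mult_ac flip: S_def)
    qed
    have sumH: "(H has_sum N' * norm_kernel (set (x # xs)) \<rho> \<mu>) UNIV"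
    proof -
      have "((\<lambda>\<sigma>. norm e * N * (fock_kernel (\<lambda>k. norm (cre x k)) (\<lambda>k. norm (ann x k)) \<rho> \<sigma> *
            norm_kernel S \<sigma> \<mu>)) has_sum
          norm e * N * (E * fock_kernel (\<lambda>k. norm (cre x k) + (\<Sum>i\<in>S. norm (cre i k)))
            (\<lambda>k. norm (ann x k) + (\<Sum>i\<in>S. norm (ann i k))) \<rho> \<mu>)) UNIV"
        using fock_kernel_compose[of "\<lambda>k. norm (ann x k)" "\<lambda>k. \<Sum>j\<in>S. norm (cre j k)"] smn
        by (intro has_sum_cmult_right) (simp add: has_abs_sum_def E_def sum_nonneg)
      thus ?thesis using S(1,2) unfolding H_def N'_def by (simp add: mult_ac flip: S_def)
    qed
    have row: "(F p has_sum path_coeff (x # xs) (case p of (n, g) \<Rightarrow> g(x := n)) \<rho> \<mu>) UNIV" for p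
      using path_coeff_Cons[OF Cons.prems(2)] unfolding F_def e_def by (cases p) simp
    have "has_abs_sum (\<lambda>p. path_coeff (x # xs) (case p of (n, g) \<Rightarrow> g(x := n)) \<rho> \<mu>)
      (path_factor (set (x # xs)) * sum_kernel (set (x # xs)) \<rho> \<mu>)
      (N' * norm_kernel (set (x # xs)) \<rho> \<mu>)
      (UNIV \<times> PiE S (\<lambda>_. UNIV))"
      by (rule has_sum_fubini[OF col sumG sumH row])
    thus "path_sum (x # xs) N' \<rho> \<mu>"
      using has_abs_sum_reindex_bij_betw[OF bij_betw_fun_upd[OF S(2)],
          of "\<lambda>m. path_coeff (x # xs) m \<rho> \<mu>"] by (simp add: S_def)
  qed
qed

text \<open>Closing the product to a trace lets every annihilation part meet every creation part, in
  either order and also for \<open>i = j\<close>; \<open>lambert t k\<close> sums over the number of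
  turns. Hence all pairs occur in the exponent, while \<open>path_factor\<close> keeps the direct
  contractions.\<close>

lemma trace_path_coeff:
  assumes t: "norm t < 1" and tQ: "\<And>i j. norm t * norm (Q i) < norm (Q j)"
  shows "((\<lambda>(\<mu>, m). t ^ weight \<mu> * path_coeff (sorted_list_of_set UNIV) m \<mu> \<mu>) has_sum
    path_factor UNIV * exp (- (\<Sum>i\<in>UNIV. \<Sum>j\<in>UNIV. of_int (B (\<alpha> i) (\<alpha> j)) * q_log t (Q i / Q j))) /
      prodinf (\<lambda>k. 1 - t ^ Suc k)) (UNIV \<times> UNIV)"
proof -
  let ?xs = "sorted_list_of_set (UNIV :: 'n set)"
  define C D where "C k = (\<Sum>i\<in>UNIV. cre i k)" and "D k = (\<Sum>i\<in>UNIV. ann i k)" for k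
  define C' D' where "C' k = (\<Sum>i\<in>UNIV. norm (cre i k))" and "D' k = (\<Sum>i\<in>UNIV. norm (ann i k))" for k
  obtain N where N: "N \<ge> 0" "\<And>\<rho> \<mu>. has_abs_sum (\<lambda>m. path_coeff ?xs m \<rho> \<mu>)
    (path_factor UNIV * fock_kernel C D \<rho> \<mu>) (N * fock_kernel C' D' \<rho> \<mu>) UNIV"
    using path_coeff_has_abs_sum[of ?xs] unfolding C_def[abs_def] D_def[abs_def] C'_def[abs_def] D'_def[abs_def]
    by auto
  have cre_ann: "cre i k * ann j k = - of_int (B (\<alpha> i) (\<alpha> j)) * ((Q i / Q j) ^ Suc k / of_nat (Suc k))" for i j k
    unfolding ann_def cre_def charge_mult[symmetric]
    by (simp add: power_divide mult_ac del: of_nat_Suc power_Suc)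
  have sij: "summable (\<lambda>k. norm (cre i k) * norm (ann j k) * norm t ^ Suc k)" for i j
  proof (rule summable_comparison_test)
    let ?r = "norm t * norm (Q i) / norm (Q j)"
    show "summable (\<lambda>k. norm (of_int (B (\<alpha> i) (\<alpha> j)) :: complex) * ?r ^ Suc k)"
      by (rule summable_power_quotient) (use tQ[of i j] Q_nz[of j] in \<open>auto simp: divide_simps\<close>)
    have "norm (cre i k) * norm (ann j k) * norm t ^ Suc k =
        norm (of_int (B (\<alpha> i) (\<alpha> j)) :: complex) * (?r ^ Suc k / of_nat (Suc k))" for k
      unfolding norm_mult[symmetric] cre_ann
      unfolding norm_mult norm_divide norm_power norm_minus_cancel power_mult_distrib power_divide norm_of_nat
      by (simp del: of_nat_Suc power_Suc)
    moreover have "?r ^ Suc k / of_nat (Suc k) \<le> ?r ^ Suc k" for k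
      using divide_left_mono[of 1 "real (Suc k)" "?r ^ Suc k"] by (simp del: power_Suc)
    ultimately have "norm (cre i k) * norm (ann j k) * norm t ^ Suc k \<le>
        norm (of_int (B (\<alpha> i) (\<alpha> j)) :: complex) * ?r ^ Suc k" for k
      by (metis mult_left_mono norm_ge_zero)
    thus "\<exists>N. \<forall>k\<ge>N. norm (norm (cre i k) * norm (ann j k) * norm t ^ Suc k) \<le>
        norm (of_int (B (\<alpha> i) (\<alpha> j)) :: complex) * ?r ^ Suc k"
      by (intro exI[of _ 0]) (simp add: abs_mult del: power_Suc)
  qed
  have sm': "summable (\<lambda>k. norm (C' k) * norm (D' k) * norm (norm t) ^ Suc k)"
  proof -
    have "summable (\<lambda>k. \<Sum>i\<in>UNIV. \<Sum>j\<in>UNIV. norm (cre i k) * norm (ann j k) * norm t ^ Suc k)"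
      by (intro summable_sum sij)
    also have "(\<lambda>k. \<Sum>i\<in>UNIV. \<Sum>j\<in>UNIV. norm (cre i k) * norm (ann j k) * norm t ^ Suc k) =
        (\<lambda>k. norm (C' k) * norm (D' k) * norm (norm t) ^ Suc k)"
    proof
      fix k
      have "norm (C' k) = C' k" "norm (D' k) = D' k" by (simp_all add: C'_def D'_def sum_nonneg)
      thus "(\<Sum>i\<in>UNIV. \<Sum>j\<in>UNIV. norm (cre i k) * norm (ann j k) * norm t ^ Suc k) =
          norm (C' k) * norm (D' k) * norm (norm t) ^ Suc k"
        by (simp only: C'_def D'_def sum_product_mult real_norm_def abs_norm_cancel)
    qed
    finally show ?thesis .
  qed
  have sm: "summable (\<lambda>k. norm (C k) * norm (D k) * norm t ^ Suc k)"
  proof (rule summable_comparison_test[OF _ sm'])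
    have "norm (C k) * norm (D k) * norm t ^ Suc k \<le> norm (C' k) * norm (D' k) * norm (norm t) ^ Suc k" for k
      unfolding C_def D_def C'_def D'_def
      by (intro mult_mono) (auto intro!: order.trans[OF norm_sum] abs_ge_self mult_nonneg_nonneg sum_nonneg simp del: power_Suc)
    thus "\<exists>N. \<forall>k\<ge>N. norm (norm (C k) * norm (D k) * norm t ^ Suc k) \<le> norm (C' k) * norm (D' k) * norm (norm t) ^ Suc k"
      by (intro exI[of _ 0]) (simp add: abs_mult del: power_Suc)
  qed
  have t': "norm (norm t) < 1" using t by simp
  obtain H where H: "((\<lambda>\<mu>. norm t ^ weight \<mu> * fock_kernel C' D' \<mu> \<mu>) has_sum H) UNIV"
    using fock_kernel_trace(1)[OF t' sm'] by (auto simp: has_abs_sum_def)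
  let ?V = "exp (suminf (\<lambda>k. C k * D k * lambert t k)) / prodinf (\<lambda>k. 1 - t ^ Suc k)"
  have T: "((\<lambda>\<mu>. path_factor UNIV * (t ^ weight \<mu> * fock_kernel C D \<mu> \<mu>)) has_sum path_factor UNIV * ?V) UNIV"
    using fock_kernel_trace(1)[OF t sm] by (intro has_sum_cmult_right) (auto simp: has_abs_sum_def)
  have F: "has_abs_sum (\<lambda>m. t ^ weight \<mu> * path_coeff ?xs m \<mu> \<mu>)
      (path_factor UNIV * (t ^ weight \<mu> * fock_kernel C D \<mu> \<mu>))
      (N * (norm t ^ weight \<mu> * fock_kernel C' D' \<mu> \<mu>)) UNIV" for \<mu>
    using has_abs_sum_cmult[OF N(2), of "t ^ weight \<mu>" \<mu> \<mu>] by (simp add: norm_power mult_ac)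
  have "((\<lambda>(\<mu>, m). t ^ weight \<mu> * path_coeff ?xs m \<mu> \<mu>) has_sum path_factor UNIV * ?V) (UNIV \<times> UNIV)"
    by (rule has_sum_Times(1)[OF F T has_sum_cmult_right[OF H]])
  moreover have "suminf (\<lambda>k. C k * D k * lambert t k) =
      - (\<Sum>i\<in>UNIV. \<Sum>j\<in>UNIV. of_int (B (\<alpha> i) (\<alpha> j)) * q_log t (Q i / Q j))"
  proof -
    let ?g = "\<lambda>i j k. cre i k * ann j k * lambert t k"
    have s: "summable (?g i j)" for i j
      by (rule fock_kernel_trace(2)[OF t sij])
    have "suminf (\<lambda>k. C k * D k * lambert t k) = suminf (\<lambda>k. \<Sum>i\<in>UNIV. \<Sum>j\<in>UNIV. ?g i j k)"
      unfolding C_def D_def sum_product_mult ..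
    also have "\<dots> = (\<Sum>i\<in>UNIV. \<Sum>j\<in>UNIV. suminf (?g i j))"
      by (subst suminf_sum[OF summable_sum[OF s]], subst suminf_sum[OF s], rule refl)
    also have "\<dots> = (\<Sum>i\<in>UNIV. \<Sum>j\<in>UNIV. - (of_int (B (\<alpha> i) (\<alpha> j)) * q_log t (Q i / Q j)))"
    proof (intro sum.cong refl)
      fix i j
      let ?b = "of_int (B (\<alpha> i) (\<alpha> j)) :: complex"
      let ?h = "\<lambda>k. (Q i / Q j) ^ Suc k / of_nat (Suc k) * lambert t k"
      have g: "?g i j k = - ?b * ?h k" for k unfolding cre_ann by (simp only: mult.assoc)
      \<comment> \<open>For nonzero \<open>?b\<close>, summability of \<open>?h\<close> is recovered
        from that of \<open>?g\<close> by division; otherwise both sides vanish.\<close>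
      show "suminf (?g i j) = - (?b * q_log t (Q i / Q j))"
      proof (cases "?b = 0")
        case False
        have "summable (\<lambda>k. (- 1 / ?b) * ?g i j k)" by (rule summable_mult[OF s])
        hence "summable ?h" unfolding g using False by (simp del: power_Suc of_nat_Suc)
        thus ?thesis unfolding g q_log_def by (subst suminf_mult) (simp_all del: power_Suc of_nat_Suc)
      qed (simp only: g, simp)
    qed
    finally show ?thesis by (simp add: sum_negf)
  qed
  ultimately show ?thesis by simp
qed

end

end

end

section \<open>The product formula for the prime form\<close>

text \<open>The q-Pochhammer symbol \<open>(t x; t)\<close> of infinite length.\<close>

definition q_prod :: "complex \<Rightarrow> complex \<Rightarrow> complex" where
  "q_prod t x = prodinf (\<lambda>n. 1 - t ^ Suc n * x)"

lemma convergent_q_prod: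
  fixes t x :: complex
  assumes "norm t < 1"
  shows "convergent_prod (\<lambda>n. 1 - t ^ Suc n * x)"
proof -
  have "summable (\<lambda>n. norm x * norm t * norm t ^ n)"
    using assms by (intro summable_mult summable_geometric) auto
  moreover have "norm (1 - t ^ Suc n * x - 1) = norm x * norm t * norm t ^ n" for n
    by (simp add: norm_mult norm_power)
  ultimately have "abs_convergent_prod (\<lambda>n. 1 - t ^ Suc n * x)"
    by (simp only: abs_convergent_prod_conv_summable)
  thus ?thesis by (rule abs_convergent_prod_imp_convergent_prod)
qed

lemma q_prod_nonzero:
  assumes "norm t < 1" "\<And>n. t ^ Suc n * x \<noteq> 1"
  shows "q_prod t x \<noteq> 0"
  unfolding q_prod_def by (rule prodinf_nonzero[OF convergent_q_prod[OF assms(1)]]) (use assms(2) in auto)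

lemma holomorphic_q_prod:
  assumes "norm t < 1"
  shows "q_prod t holomorphic_on A"
proof -
  let ?P = "\<lambda>N x. \<Prod>n<N. 1 - t ^ Suc n * x"
  have unif: "uniform_limit (cball 0 R) ?P (q_prod t) sequentially" for R
  proof -
    have "uniformly_convergent_on (cball 0 R) ?P"
    proof (rule uniformly_convergent_on_prod')
      show "uniformly_convergent_on (cball 0 R) (\<lambda>N x. \<Sum>n<N. norm (1 - t ^ Suc n * x - 1))"
      proof (rule Weierstrass_m_test')
        show "summable (\<lambda>n. norm t * R * norm t ^ n)"
          using assms by (intro summable_mult summable_geometric) auto
        fix n x assume "x \<in> cball (0::complex) R"
        hence "norm (t ^ Suc n) * norm x \<le> norm (t ^ Suc n) * R" by (intro mult_left_mono) auto
        thus "norm (norm (1 - t ^ Suc n * x - 1)) \<le> norm t * R * norm t ^ n"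
          by (simp add: norm_mult norm_power mult_ac)
      qed
    qed (auto intro!: continuous_intros)
    then obtain g where g: "uniform_limit (cball 0 R) ?P g sequentially"
      by (auto simp: uniformly_convergent_on_def)
    have "g x = q_prod t x" if "x \<in> cball 0 R" for x
    proof -
      have "(\<lambda>N. ?P N x) \<longlonglongrightarrow> q_prod t x"
        using convergent_prod_LIMSEQ[OF convergent_q_prod[OF assms, of x]]
        unfolding q_prod_def by (subst LIMSEQ_lessThan_iff_atMost)
      moreover have "(\<lambda>N. ?P N x) \<longlonglongrightarrow> g x" by (rule tendsto_uniform_limitI[OF g that])
      ultimately show ?thesis using LIMSEQ_unique by blast
    qed
    thus ?thesis using g by (subst (asm) uniform_limit_cong'[of _ _ ?P _ "q_prod t"]) auto
  qed
  have "q_prod t holomorphic_on UNIV"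
  proof (rule holomorphic_uniform_sequence[of _ ?P])
    fix z :: complex
    have "uniform_limit (cball z 1) ?P (q_prod t) sequentially"
      by (rule uniform_limit_on_subset[OF unif[of "norm z + 1"]]) (simp add: cball_subset_cball_iff)
    thus "\<exists>d>0. cball z d \<subseteq> UNIV \<and> uniform_limit (cball z d) ?P (q_prod t) sequentially"
      by (intro exI[of _ 1]) auto
  qed (auto intro!: holomorphic_intros)
  thus ?thesis using holomorphic_on_subset by blast
qed

lemma has_sum_geometric_Suc:
  fixes y :: "'a::{banach, real_normed_field}"
  assumes "norm y < 1"
  shows "((\<lambda>n. y ^ Suc n) has_sum y / (1 - y)) UNIV"
proof -
  have "((\<lambda>n. y * y ^ n) has_sum y * (1 / (1 - y))) UNIV"
    using has_sum_choose_power[OF assms, of 0] by (intro has_sum_cmult_right) simp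
  thus ?thesis by simp
qed

lemma norm_power_Suc_less_1: "norm t < 1 \<Longrightarrow> norm (t ^ Suc k) < 1" for t :: "'a::real_normed_field"
  unfolding norm_power using power_Suc_less_one[of "norm t" k] by (cases "t = 0") auto

lemma norm_lambert_le:
  fixes t :: complex
  assumes "norm t < 1"
  shows "norm (lambert t k) \<le> lambert (norm t) k"
proof -
  have "1 - norm t ^ Suc k \<le> norm (1 - t ^ Suc k)"
    using norm_triangle_ineq2[of 1 "t ^ Suc k"] by (simp add: norm_power del: power_Suc)
  moreover have "norm t ^ Suc k < 1" using norm_power_Suc_less_1[OF assms, of k] by (simp only: norm_power)
  ultimately show ?thesis unfolding norm_divide norm_power
    by (intro divide_left_mono mult_pos_pos) (auto simp del: power_Suc)
qed

lemma q_log_terms: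
  assumes t: "norm t < 1" and tx: "norm t * norm x < 1"
  shows "((\<lambda>k. q_log_term t x k) has_sum q_log t x) UNIV"
    and "summable (\<lambda>k. q_log_term (norm t) (norm x) k)"
proof -
  have s: "summable (\<lambda>k. norm (norm x ^ Suc k / of_nat (Suc k)) * norm (1::real) * norm (norm t) ^ Suc k)"
  proof (rule summable_comparison_test)
    show "summable (\<lambda>k. 1 * (norm t * norm x) ^ Suc k)"
      by (rule summable_power_quotient) (use tx in auto)
    have "norm x ^ Suc k / of_nat (Suc k) * norm t ^ Suc k \<le> (norm t * norm x) ^ Suc k" for k
      using divide_left_mono[of 1 "real (Suc k)" "(norm t * norm x) ^ Suc k"]
      by (simp add: power_mult_distrib mult_ac del: power_Suc of_nat_Suc)
    thus "\<exists>N. \<forall>k\<ge>N. norm (norm (norm x ^ Suc k / of_nat (Suc k)) * norm (1::real) * norm (norm t) ^ Suc k) \<le>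
        1 * (norm t * norm x) ^ Suc k"
      by (intro exI[of _ 0]) (simp add: abs_mult del: power_Suc of_nat_Suc)
  qed
  have "norm (norm t) < 1" using t by simp
  \<comment> \<open>The summability part of the trace formula, with 1 in place of the annihilation
    parameters, accounts for the denominators \<open>1 - norm t ^ Suc k\<close>.\<close>
  from fock_kernel_trace(2)[OF this s]
  show S: "summable (\<lambda>k. q_log_term (norm t) (norm x) k)"
    by (simp del: power_Suc of_nat_Suc)
  have "norm (q_log_term t x k) \<le>
      q_log_term (norm t) (norm x) k" for k
    unfolding norm_mult[of "_ / _"] norm_divide[of _ "of_nat _"] norm_power norm_of_nat
    by (intro mult_left_mono norm_lambert_le t) (simp del: power_Suc of_nat_Suc)
  hence "summable (\<lambda>k. norm (q_log_term t x k))"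
    by (intro summable_comparison_test[OF _ S] exI[of _ 0] allI impI) (simp only: real_norm_def abs_norm_cancel)
  moreover from this have "(\<lambda>k. q_log_term t x k) sums q_log t x"
    unfolding q_log_def by (rule summable_sums[OF summable_norm_cancel])
  ultimately show "((\<lambda>k. q_log_term t x k) has_sum q_log t x) UNIV"
    by (rule norm_summable_imp_has_sum)
qed

lemma has_abs_sum_geometric:
  assumes "norm (t::complex) < 1"
  shows "has_abs_sum (\<lambda>n. c * (t ^ Suc k) ^ Suc n) (c * lambert t k) (norm c * lambert (norm t) k) UNIV"
proof (rule has_abs_sum_comparison)
  show "((\<lambda>n. c * (t ^ Suc k) ^ Suc n) has_sum c * lambert t k) UNIV"
    by (intro has_sum_cmult_right has_sum_geometric_Suc norm_power_Suc_less_1 assms)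
  show "((\<lambda>n. norm c * (norm t ^ Suc k) ^ Suc n) has_sum norm c * lambert (norm t) k) UNIV"
    by (intro has_sum_cmult_right has_sum_geometric_Suc norm_power_Suc_less_1) (use assms in auto)
qed (simp only: norm_mult norm_power order.refl)

text \<open>Expand \<open>lambert t k\<close> as a geometric series and sum over \<open>k\<close>
  first: the inner sums are logarithms of the factors of \<open>q_prod\<close>.\<close>

lemma exp_q_log:
  assumes t: "norm t < 1" and tx: "norm t * norm x < 1"
  shows "exp (- q_log t x) = q_prod t x"
proof -
  define F where "F n k = x ^ Suc k / of_nat (Suc k) * (t ^ Suc k) ^ Suc n" for n k
  define L where "L n = suminf (\<lambda>k. (t ^ Suc n * x) ^ Suc k / of_nat (Suc k))" for n
  have lt: "norm (t ^ Suc n * x) < 1" for n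
  proof -
    have "norm (t ^ Suc n * x) = norm t ^ n * (norm t * norm x)"
      by (simp add: norm_mult norm_power)
    also have "\<dots> \<le> 1 * (norm t * norm x)"
      using t by (intro mult_right_mono power_le_one) auto
    finally show ?thesis using tx by simp
  qed
  have col: "has_abs_sum (\<lambda>n. F n k) (q_log_term t x k)
      (q_log_term (norm t) (norm x) k) UNIV" for k
    using has_abs_sum_geometric[OF t, of "x ^ Suc k / of_nat (Suc k)" k]
    unfolding F_def by (simp only: norm_divide norm_power norm_of_nat)
  have "q_log_term (norm t) (norm x) k \<ge> 0" for k
    using norm_power_Suc_less_1[OF t, of k] by (simp add: norm_power norm_mult del: of_nat_Suc)
  hence H: "((\<lambda>k. q_log_term (norm t) (norm x) k) has_sum
      suminf (\<lambda>k. q_log_term (norm t) (norm x) k)) UNIV"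
    by (intro norm_summable_imp_has_sum summable_sums q_log_terms[OF t tx])
       (simp only: real_norm_def abs_of_nonneg q_log_terms(2)[OF t tx])
  have row: "(F n has_sum L n) UNIV" for n
  proof -
    let ?y = "t ^ Suc n * x"
    have F: "F n = (\<lambda>k. ?y ^ Suc k / of_nat (Suc k))"
      unfolding F_def by (intro ext) (simp add: power_mult_distrib mult_ac flip: power_mult del: power_Suc of_nat_Suc)
    have "summable (\<lambda>k. 1 * norm ?y ^ Suc k)" by (rule summable_power_quotient) (use lt[of n] in auto)
    hence "summable (\<lambda>k. norm (?y ^ Suc k / of_nat (Suc k)))"
    proof (rule summable_comparison_test'[where N = 0])
      fix k :: nat
      show "norm (norm (?y ^ Suc k / of_nat (Suc k))) \<le> 1 * norm ?y ^ Suc k"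
        using divide_left_mono[of 1 "real (Suc k)" "norm ?y ^ Suc k"]
        unfolding norm_divide norm_power norm_of_nat by (simp del: power_Suc of_nat_Suc)
    qed
    thus ?thesis unfolding F L_def
      by (rule norm_summable_imp_has_sum) (rule summable_sums[OF log_series(1)[OF lt]])
  qed
  have "(L has_sum q_log t x) UNIV"
    using has_sum_fubini[OF col q_log_terms(1)[OF t tx] H row] by (simp add: has_abs_sum_def)
  hence "L sums q_log t x" by (rule has_sum_imp_sums)
  hence S: "(\<lambda>n. - L n) sums - q_log t x" by (rule sums_minus)
  have "exp (- q_log t x) = prodinf (\<lambda>n. exp (- L n))"
    using prodinf_exp[OF sums_summable[OF S]] sums_unique[OF S] by simp
  also have "\<dots> = q_prod t x"
    unfolding q_prod_def L_def log_series(2)[OF lt] ..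
  finally show ?thesis .
qed

section \<open>Bernoulli numbers and the logarithm of sinh\<close>

definition bernoulli_fps :: "complex fps" where
  "bernoulli_fps = fps_X / (fps_exp 1 - 1)"

lemma exp_minus_1_fps: "fps_exp 1 - 1 \<noteq> (0 :: complex fps)" "subdegree (fps_exp 1 - 1 :: complex fps) = 1"
proof -
  have 1: "fps_nth (fps_exp 1 - 1 :: complex fps) 1 \<noteq> 0" by simp
  thus "fps_exp 1 - 1 \<noteq> (0 :: complex fps)" by (metis fps_zero_nth)
  show "subdegree (fps_exp 1 - 1 :: complex fps) = 1"
    by (rule subdegreeI[OF 1]) (simp del: subdegree_minus_commute)
qed

lemma bernoulli_fps_mult: "bernoulli_fps * (fps_exp 1 - 1) = fps_X"
  unfolding bernoulli_fps_def
  by (rule dvd_div_mult_self) (simp add: fps_dvd_iff exp_minus_1_fps del: subdegree_minus_commute)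

lemma bernoulli_fps_conv_radius: "fps_conv_radius bernoulli_fps > 0"
proof -
  have "(\<lambda>x. if x = 0 then 1 else x / (exp (1 * x) - 1)) has_fps_expansion bernoulli_fps"
    unfolding bernoulli_fps_def
    by (rule has_fps_expansion_divide)
       (auto intro!: fps_expansion_intros simp: exp_minus_1_fps simp del: subdegree_minus_commute)
  thus ?thesis by (simp add: has_fps_expansion_def)
qed

text \<open>Both sides agree after multiplication by the nonzero series
  \<open>fps_exp 1 - 1\<close>, which can be cancelled. The odd coefficients are read off from this
  symmetry.\<close>

lemma bernoulli_fps_reflect: "bernoulli_fps oo - fps_X = bernoulli_fps + fps_X"
proof -
  let ?F = "bernoulli_fps" and ?E = "fps_exp 1 :: complex fps"
  have "(?F * (?E - 1)) oo - fps_X = (?F oo - fps_X) * (fps_exp (- 1) - 1)"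
    by (simp add: fps_compose_mult_distrib fps_compose_sub_distrib)
  hence *: "(?F oo - fps_X) * (fps_exp (- 1) - 1) = - fps_X"
    by (simp add: bernoulli_fps_mult)
  have EE: "fps_exp (- 1) * ?E = 1" by (simp flip: fps_exp_add_mult)
  have "(?F oo - fps_X) * (?E - 1) = - ((?F oo - fps_X) * (fps_exp (- 1) * ?E - ?E))"
    unfolding EE by (simp add: algebra_simps)
  also have "\<dots> = - ((?F oo - fps_X) * (fps_exp (- 1) - 1) * ?E)" by (simp add: algebra_simps)
  also have "\<dots> = fps_X * ?E" unfolding * by simp
  also have "\<dots> = (?F + fps_X) * (?E - 1)"
    unfolding distrib_right bernoulli_fps_mult by (simp add: algebra_simps)
  finally show ?thesis using exp_minus_1_fps(1) by simp
qed

lemma bernoulli_fps_odd: "odd k \<Longrightarrow> k \<noteq> 1 \<Longrightarrow> fps_nth bernoulli_fps k = 0"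
  using arg_cong[OF bernoulli_fps_reflect, of "\<lambda>f. fps_nth f k"]
  unfolding fps_compose_uminus' by simp

lemma bernoulli_fps_0: "fps_nth bernoulli_fps 0 = 1"
  and bernoulli_fps_1: "fps_nth bernoulli_fps 1 = - 1 / 2"
proof -
  have "fps_nth (bernoulli_fps * (fps_exp 1 - 1)) 1 = 1" by (simp add: bernoulli_fps_mult)
  thus "fps_nth bernoulli_fps 0 = 1" by (simp add: fps_mult_nth)
  define x where "x = fps_nth bernoulli_fps 1"
  have "- x = x + 1"
    using arg_cong[OF bernoulli_fps_reflect, of "\<lambda>f. fps_nth f 1"]
    unfolding fps_compose_uminus' x_def by simp
  hence "2 * x + 1 = 0" by algebra
  hence "x = - 1 / 2" by (simp add: field_simps eq_neg_iff_add_eq_0)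
  thus "fps_nth bernoulli_fps 1 = - 1 / 2" by (simp add: x_def)
qed

text \<open>The series of the logarithm of \<open>2 sinh (x/2) / x\<close>: \<open>x\<close> times
  its derivative is the Bernoulli series without its first two terms, which is
  \<open>(x/2) coth (x/2) - 1\<close>.\<close>

definition sinh_log_fps :: "complex fps" where
  "sinh_log_fps = Abs_fps (\<lambda>k. if even k \<and> k \<noteq> 0 then fps_nth bernoulli_fps k / of_nat k else 0)"

lemma sinh_log_fps_deriv: "fps_X * fps_deriv sinh_log_fps = bernoulli_fps - 1 + fps_const (1 / 2) * fps_X"
proof (rule fps_ext)
  fix k
  show "fps_nth (fps_X * fps_deriv sinh_log_fps) k = fps_nth (bernoulli_fps - 1 + fps_const (1 / 2) * fps_X) k"
  proof (cases k)
    case 0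
    thus ?thesis by (simp add: bernoulli_fps_0)
  next
    case (Suc m)
    thus ?thesis using bernoulli_fps_odd[of k] bernoulli_fps_1
      by (cases "k = 1") (auto simp: sinh_log_fps_def simp del: of_nat_Suc)
  qed
qed

lemma sinh_log_fps_conv_radius: "fps_conv_radius sinh_log_fps > 0"
proof -
  obtain r where r: "r > 0" "ereal r < fps_conv_radius bernoulli_fps"
    using bernoulli_fps_conv_radius ereal_dense2[of 0 "fps_conv_radius bernoulli_fps"] by (auto simp: zero_ereal_def)
  have "summable (\<lambda>k. norm (fps_nth bernoulli_fps k * of_real r ^ k))"
    by (rule norm_summable_fps) (use r in simp)
  hence "summable (\<lambda>k. fps_nth sinh_log_fps k * of_real r ^ k)"
  proof (rule summable_comparison_test'[where N = 0])
    fix k :: nat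
    show "norm (fps_nth sinh_log_fps k * of_real r ^ k) \<le> norm (fps_nth bernoulli_fps k * of_real r ^ k)"
      unfolding norm_mult
      by (rule mult_right_mono)
         (auto simp: sinh_log_fps_def norm_divide divide_le_eq mult_le_cancel_left1 Suc_le_eq)
  qed
  hence "conv_radius (fps_nth sinh_log_fps) \<ge> norm (of_real r :: complex)" by (rule conv_radius_geI)
  thus ?thesis using r unfolding fps_conv_radius_def
    by (metis abs_of_pos ereal_less(2) less_le_trans norm_of_real)
qed

text \<open>The quotient \<open>N\<close> of the two sides, up to the factor \<open>x\<close>,
  satisfies \<open>x N' = N\<close> as a formal power series. Hence only its coefficient of degree 1
  is nonzero, and this coefficient is 1. Positive radii of convergence carry the identity over to
  functions near 0.\<close>

lemma exp_sinh_log: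
  "\<forall>\<^sub>F w in nhds 0. exp (w / 2) - exp (- w / 2) = w * exp (eval_fps sinh_log_fps w)"
proof -
  let ?P = sinh_log_fps
  define G where "G = fps_exp 1 oo (- ?P)"
  define SH :: "complex fps" where "SH = fps_exp (1 / 2) - fps_exp (- 1 / 2)"
  have P0: "fps_nth (- ?P) 0 = 0" by (simp add: sinh_log_fps_def)
  have dG: "fps_deriv G = - G * fps_deriv ?P"
    unfolding G_def by (subst fps_compose_deriv[OF P0]) simp
  have SHF: "bernoulli_fps * SH = fps_X * fps_exp (- 1 / 2)"
  proof -
    have "fps_exp (1 / 2) = fps_exp (1 :: complex) * fps_exp (- 1 / 2)" by (simp flip: fps_exp_add_mult)
    hence "SH = (fps_exp 1 - 1) * fps_exp (- 1 / 2)" by (simp add: SH_def algebra_simps)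
    thus ?thesis by (simp flip: mult.assoc add: bernoulli_fps_mult)
  qed
  have dSH: "fps_deriv SH = fps_const (1 / 2) * (fps_exp (1 / 2) + fps_exp (- 1 / 2))"
  proof -
    have "fps_deriv SH = fps_const (1 / 2) * fps_exp (1 / 2) - fps_const (- 1 / 2) * fps_exp (- 1 / 2)"
      unfolding SH_def by (simp only: fps_deriv_sub fps_exp_deriv)
    also have "\<dots> = fps_const (1 / 2) * (fps_exp (1 / 2) + fps_exp (- 1 / 2))"
      by (rule fps_ext) (simp add: ring_distribs)
    finally show ?thesis .
  qed
  define N where "N = SH * G"
  have "fps_X * fps_deriv N = fps_X * fps_deriv SH * G - SH * (fps_X * fps_deriv ?P) * G"
    by (simp add: N_def dG algebra_simps)
  also have "SH * (fps_X * fps_deriv ?P) = bernoulli_fps * SH - SH + fps_const (1 / 2) * fps_X * SH"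
    unfolding sinh_log_fps_deriv by (simp add: algebra_simps)
  also have "\<dots> = fps_X * fps_deriv SH - SH"
  proof -
    have h: "fps_exp (- 1 / 2) = fps_const (1 / 2) * fps_exp (- 1 / 2) + fps_const (1 / 2) * fps_exp (- 1 / 2 :: complex)"
      by (rule fps_ext) simp
    show ?thesis unfolding SHF dSH by (subst h) (simp add: SH_def algebra_simps)
  qed
  finally have XN: "fps_X * fps_deriv N = N" by (simp add: N_def algebra_simps)
  have "fps_nth N k = fps_nth fps_X k" for k
  proof -
    have k: "of_nat k * fps_nth N k = fps_nth N k"
      using arg_cong[OF XN, of "\<lambda>f. fps_nth f k"] by (cases k) auto
    have G0: "fps_nth G 0 = 1" by (simp add: G_def fps_compose_nth)
    show ?thesis
    proof (cases "k = 1")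
      case True
      thus ?thesis by (simp add: N_def fps_mult_nth SH_def G0)
    next
      case False
      hence "of_nat k \<noteq> (1::complex)" by (metis of_nat_1 of_nat_eq_iff)
      thus ?thesis using k False by (simp add: fps_X_def)
    qed
  qed
  hence NX: "N = fps_X" by (rule fps_ext)
  have "eval_fps ?P has_fps_expansion ?P"
    by (rule eval_fps_has_fps_expansion[OF sinh_log_fps_conv_radius])
  hence "(\<lambda>w. - eval_fps ?P w) has_fps_expansion - ?P" by (rule has_fps_expansion_minus)
  from has_fps_expansion_compose[OF has_fps_expansion_exp[of 1] this P0]
  have "(\<lambda>w. exp (- eval_fps ?P w)) has_fps_expansion G" by (simp add: G_def o_def)
  moreover have "(\<lambda>w. exp (1 / 2 * w) - exp (- 1 / 2 * w)) has_fps_expansion SH"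
    unfolding SH_def by (intro fps_expansion_intros)
  ultimately have "(\<lambda>w. (exp (1 / 2 * w) - exp (- 1 / 2 * w)) * exp (- eval_fps ?P w)) has_fps_expansion fps_X"
    unfolding NX[symmetric] N_def by (rule has_fps_expansion_mult[rotated])
  hence "\<forall>\<^sub>F w in nhds 0. eval_fps fps_X w = (exp (1 / 2 * w) - exp (- 1 / 2 * w)) * exp (- eval_fps ?P w)"
    by (simp add: has_fps_expansion_def)
  thus ?thesis
  proof eventually_elim
    case (elim w)
    thus ?case by (simp add: exp_minus field_simps)
  qed
qed

section \<open>Divisor sums as Lambert series\<close>

lemma summable_nat_power_mult_power:
  "norm (x::real) < 1 \<Longrightarrow> summable (\<lambda>n. of_nat n ^ p * x ^ n)"
proof (induction p arbitrary: x)
  case 0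
  thus ?case by (simp add: summable_geometric)
next
  case (Suc p)
  have "summable (\<lambda>n. diffs (\<lambda>n. of_nat n ^ p :: real) n * x ^ n)"
    by (rule termdiff_converges[OF Suc.prems Suc.IH])
  hence "summable (\<lambda>n. x * (of_nat (Suc n) ^ Suc p * x ^ n))"
    by (intro summable_mult) (simp add: diffs_def)
  hence "summable (\<lambda>n. of_nat (Suc n) ^ Suc p * x ^ Suc n)"
    by (simp add: mult_ac del: of_nat_Suc)
  thus ?case by (subst (asm) summable_Suc_iff)
qed

lemma has_sum_diff:
  fixes f g :: "'a \<Rightarrow> 'b::real_normed_vector"
  assumes "(f has_sum a) A" "(g has_sum b) A"
  shows "((\<lambda>x. f x - g x) has_sum a - b) A"
  using has_sum_add[OF assms(1), of "\<lambda>x. - g x" "- b"] assms(2) by (simp add: has_sum_uminus)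

text \<open>Expanding the Lambert terms gives a double series over pairs of positive integers;
  collecting the pairs with a given product leaves a sum over its divisors.\<close>

lemma has_sum_divisor_sigma:
  assumes t: "norm (t::complex) < 1"
  shows "((\<lambda>m. of_nat (Suc m) ^ p * lambert t m) has_sum
    suminf (\<lambda>n. of_nat (sigma p (Suc n)) * t ^ Suc n)) UNIV"
proof -
  define f where "f m n = of_nat (Suc m) ^ p * (t ^ Suc m) ^ Suc n" for m n
  define h where "h m = of_nat (Suc m) ^ p * lambert (norm t) m" for m
  have h0: "h m \<ge> 0" for m
    using norm_power_Suc_less_1[OF t, of m] by (simp add: h_def norm_power norm_mult del: of_nat_Suc)
  have "norm (norm t) < 1" using t by simp
  moreover have "summable (\<lambda>k. norm (of_nat (Suc k) ^ p :: real) * norm (1::real) * norm (norm t) ^ Suc k)"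
    using iffD2[OF summable_Suc_iff, OF summable_nat_power_mult_power[of "norm t" p]] t
    by (simp del: of_nat_Suc power_Suc)
  ultimately have sh: "summable h"
    using fock_kernel_trace(2)[of "norm t" "\<lambda>k. of_nat (Suc k) ^ p" "\<lambda>_. 1"]
    unfolding h_def by (simp del: of_nat_Suc power_Suc)
  hence hs: "(h has_sum suminf h) UNIV"
    by (intro norm_summable_imp_has_sum) (auto simp: h0 summable_sums)
  have fm: "has_abs_sum (f m) (of_nat (Suc m) ^ p * lambert t m) (h m) UNIV" for m
    using has_abs_sum_geometric[OF t, of "of_nat (Suc m) ^ p" m]
    unfolding f_def h_def by (simp only: norm_power norm_of_nat)
  have "norm (of_nat (Suc m) ^ p * lambert t m) \<le> h m" for m
  proof -
    have "norm (of_nat (Suc m) ^ p * lambert t m) \<le> infsum (\<lambda>n. norm (f m n)) UNIV"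
      by (rule norm_has_sum_bound) (use fm[of m] in \<open>auto simp: has_abs_sum_def\<close>)
    also have "\<dots> \<le> h m" using fm[of m] by (simp only: has_abs_sum_def)
    finally show ?thesis .
  qed
  hence "(\<lambda>m. norm (of_nat (Suc m) ^ p * lambert t m)) summable_on UNIV"
    by (rule Infinite_Sum.abs_summable_on_comparison_test'[OF has_sum_imp_summable[OF hs]])
  hence "(\<lambda>m. of_nat (Suc m) ^ p * lambert t m) summable_on UNIV"
    by (rule abs_summable_summable)
  then obtain s where s: "((\<lambda>m. of_nat (Suc m) ^ p * lambert t m) has_sum s) UNIV"
    by (auto simp: summable_on_def)
  let ?D = "\<lambda>N. {d. d dvd Suc N}"
  have S: "Suc (Suc m * Suc n - 1) = Suc m * Suc n" for m n by simp
  have "((\<lambda>(m, n). f m n) has_sum s) (UNIV \<times> UNIV)"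
    by (rule has_sum_Times(1)[OF fm s hs])
  also have "?this \<longleftrightarrow> ((\<lambda>(N, d). of_nat d ^ p * t ^ Suc N) has_sum s) (Sigma UNIV ?D)"
  \<comment> \<open>Here \<open>Suc N = Suc m * Suc n\<close> and \<open>d = Suc m\<close>; the
    predecessors undo the shift of the indices by one.\<close>
  proof (rule has_sum_reindex_bij_witness[of _ "\<lambda>(N, d). (d - 1, Suc N div d - 1)"
        "\<lambda>(m, n). (Suc m * Suc n - 1, Suc m)"], goal_cases)
    case (1 a)
    obtain m n where a: "a = (m, n)" by force
    have "Suc m * Suc n div Suc m = Suc n" by (rule nonzero_mult_div_cancel_left) simp
    thus ?case unfolding a prod.case S by (simp only: diff_Suc_1)
  next
    case (2 a)
    obtain m n where a: "a = (m, n)" by force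
    show ?case unfolding a prod.case by (simp only: S mem_Sigma_iff mem_Collect_eq dvd_triv_left UNIV_I simp_thms)
  next
    case (3 b)
    obtain N d where b: "b = (N, d)" by force
    with 3 obtain e where e: "Suc N = d * e" by auto
    hence "d > 0" "e > 0" by (metis Zero_not_Suc gr0I mult_0, metis Zero_not_Suc gr0I mult_0_right)
    then obtain d' e' where de: "d = Suc d'" "e = Suc e'" using gr0_implies_Suc by metis
    have "Suc N div d = Suc e'" unfolding e de by (rule nonzero_mult_div_cancel_left) simp
    moreover have "N = Suc d' * Suc e' - 1" using e unfolding de by simp
    ultimately show ?case unfolding b de by simp
  next
    case (5 a)
    obtain m n where a: "a = (m, n)" by force
    have "Suc (Suc m * Suc n - 1) = Suc m * Suc n" by simp
    hence "t ^ Suc (Suc m * Suc n - 1) = (t ^ Suc m) ^ Suc n" by (simp only: power_mult)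
    thus ?case by (simp only: a prod.case f_def)
  qed auto
  finally have "((\<lambda>(N, d). of_nat d ^ p * t ^ Suc N) has_sum s) (Sigma UNIV ?D)" .
  hence "((\<lambda>N. \<Sum>d\<in>?D N. of_nat d ^ p * t ^ Suc N) has_sum s) UNIV"
    by (rule has_sum_SigmaD) auto
  also have "(\<lambda>N. \<Sum>d\<in>?D N. of_nat d ^ p * t ^ Suc N) = (\<lambda>N. of_nat (sigma p (Suc N)) * t ^ Suc N)"
    by (simp add: sigma_def sum_distrib_right del: power_Suc)
  finally have "suminf (\<lambda>n. of_nat (sigma p (Suc n)) * t ^ Suc n) = s"
    using has_sum_imp_sums sums_unique by metis
  thus ?thesis using s by simp
qed

text \<open>The terms of \<open>2 cosh y - 2\<close>, with \<open>j\<close> matching the summation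
  index in the exponent of \<open>prime_form\<close>.\<close>

abbreviation cosh_term :: "'a::{banach, real_normed_field} \<Rightarrow> nat \<Rightarrow> 'a" where
  "cosh_term y j \<equiv> (if even j then 2 else 0) * y ^ (j + 2) / fact (j + 2)"

lemma has_sum_cosh_term: "(cosh_term y has_sum exp y + exp (- y) - 2) UNIV"
proof -
  define g where "g k = y ^ k / fact k + (- y) ^ k / fact k" for k
  have "(g has_sum exp y + exp (- y)) UNIV"
    unfolding g_def by (intro has_sum_add has_sum_exp)
  moreover have "(g has_sum (\<Sum>k<2. g k)) {..<2}" by (rule has_sum_finite) simp
  ultimately have "(g has_sum exp y + exp (- y) - (\<Sum>k<2. g k)) (UNIV - {..<2})"
    by (intro has_sum_Diff) auto
  also have "(\<Sum>k<2. g k) = 2" by (simp add: g_def numeral_2_eq_2)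
  also have "(g has_sum exp y + exp (- y) - 2) (UNIV - {..<2}) \<longleftrightarrow>
      ((\<lambda>j. g (j + 2)) has_sum exp y + exp (- y) - 2) UNIV"
  proof (rule has_sum_reindex_bij_witness[of _ "\<lambda>j. j + 2" "\<lambda>k. k - 2"], goal_cases)
    case (5 k)
    hence "k - 2 + 2 = k" by auto
    thus ?case by (simp only:)
  qed auto
  also have "(\<lambda>j. g (j + 2)) = cosh_term y" by (auto simp: g_def fun_eq_iff)
  finally show ?thesis .
qed

lemma q_log_term_combination:
  "lambert t m / of_nat (Suc m) * (exp (of_nat (Suc m) * y) + exp (- (of_nat (Suc m) * y)) - 2) =
     q_log_term t (exp y) m + q_log_term t (exp (- y)) m - 2 * q_log_term t 1 m"
proof -
  have "exp (of_nat (Suc m) * y) = exp y ^ Suc m" "exp (- (of_nat (Suc m) * y)) = exp (- y) ^ Suc m"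
    by (simp_all only: exp_of_nat_mult flip: mult_minus_right)
  moreover have "v / n * (a + b - 2) = a / n * v + b / n * v - 2 * (1 ^ Suc m / n * v)" for a b n v :: 'a
    by (simp add: diff_divide_distrib add_divide_distrib algebra_simps)
  ultimately show ?thesis by (simp only:)
qed

text \<open>The terms at \<open>exp w\<close>, \<open>exp (- w)\<close> and 1 combine to
  \<open>2 cosh - 2\<close> at multiples of \<open>w\<close>. Expanding this in powers of
  \<open>w\<close> and summing over \<open>m\<close> first gives the divisor sums. The condition on
  \<open>w\<close> makes the double series of norms converge.\<close>

lemma q_log_combination:
  assumes t: "norm t < 1" and tw: "norm t * exp (norm w) < 1"
  shows "((\<lambda>j. cosh_term w j * suminf (\<lambda>n. of_nat (sigma (j + 1) (Suc n)) * t ^ Suc n)) has_sum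
    q_log t (exp w) + q_log t (exp (- w)) - 2 * q_log t 1) UNIV"
proof -
  define F where "F j m = lambert t m / of_nat (Suc m) * cosh_term (of_nat (Suc m) * w) j" for j m
  define g where "g m = lambert t m / of_nat (Suc m) *
    (exp (of_nat (Suc m) * w) + exp (- (of_nat (Suc m) * w)) - 2)" for m
  define h where "h m = lambert (norm t) m / of_nat (Suc m) *
    (exp (of_nat (Suc m) * norm w) + exp (- (of_nat (Suc m) * norm w)) - 2)" for m
  have col: "has_abs_sum (\<lambda>j. F j m) (g m) (h m) UNIV" for m
    unfolding F_def g_def h_def
  proof (rule has_abs_sum_comparison[OF has_sum_cmult_right[OF has_sum_cosh_term] has_sum_cmult_right[OF has_sum_cosh_term]])
    fix j
    have a: "norm (lambert t m / of_nat (Suc m)) \<le> lambert (norm t) m / of_nat (Suc m)"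
      unfolding norm_divide[of _ "of_nat _"] norm_of_nat
      by (intro divide_right_mono norm_lambert_le t) (simp del: of_nat_Suc)
    have b: "norm (cosh_term (of_nat (Suc m) * w) j) = cosh_term (of_nat (Suc m) * norm w) j"
      by (simp add: norm_mult norm_divide norm_power del: of_nat_Suc fact_Suc power_Suc)
    show "norm (lambert t m / of_nat (Suc m) * cosh_term (of_nat (Suc m) * w) j) \<le>
        lambert (norm t) m / of_nat (Suc m) * cosh_term (of_nat (Suc m) * norm w) j"
      unfolding norm_mult[of "_ / _"] b by (rule mult_right_mono[OF a]) (simp del: of_nat_Suc)
  qed
  have tx: "norm t * norm (exp y) < 1" if "norm y \<le> norm w" for y :: complex
  proof -
    have "norm t * norm (exp y) \<le> norm t * exp (norm w)"
      using abs_Re_le_cmod[of y] that by (intro mult_left_mono) auto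
    thus ?thesis using tw by simp
  qed
  have t1: "norm t * norm (1::complex) < 1" using t by simp
  have gs: "(g has_sum q_log t (exp w) + q_log t (exp (- w)) - 2 * q_log t 1) UNIV"
    unfolding g_def q_log_term_combination
    by (intro has_sum_diff has_sum_add has_sum_cmult_right q_log_terms(1)[OF t] tx t1) auto
  have tr: "summable (q_log_term (norm t) (exp y))" if "\<bar>y\<bar> \<le> norm w" for y
    using q_log_terms(2)[OF t tx[of "of_real y"]] that by (simp only: norm_exp_eq_Re norm_of_real Re_complex_of_real)
  have "summable h"
    unfolding h_def q_log_term_combination
    using q_log_terms(2)[OF t t1] by (intro summable_diff summable_add summable_mult tr) (simp_all only: norm_one abs_minus_cancel abs_norm_cancel order.refl)
  moreover have "h m \<ge> 0" for m
    using col[of m] unfolding has_abs_sum_def by (meson infsum_nonneg norm_ge_zero order.trans)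
  ultimately have hs: "(h has_sum suminf h) UNIV"
    by (intro norm_summable_imp_has_sum) (auto simp: summable_sums)
  have row: "(F j has_sum cosh_term w j * suminf (\<lambda>n. of_nat (sigma (j + 1) (Suc n)) * t ^ Suc n)) UNIV" for j
  proof -
    have "F j = (\<lambda>m. cosh_term w j * (of_nat (Suc m) ^ (j + 1) * lambert t m))"
    proof
      fix m
      have *: "u / n * (c * (n * w) ^ (j + 2) / f) = c * w ^ (j + 2) / f * (n ^ (j + 1) * u)"
        if "n \<noteq> 0" for u n c f :: complex using that by (simp add: power_mult_distrib)
      show "F j m = cosh_term w j * (of_nat (Suc m) ^ (j + 1) * lambert t m)"
        unfolding F_def by (rule *) (simp del: of_nat_Suc)
    qed
    thus ?thesis by (simp only: has_sum_cmult_right[OF has_sum_divisor_sigma[OF t, of "j + 1"]])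
  qed
  show ?thesis
    using has_sum_fubini[OF col gs hs row] by (simp add: has_abs_sum_def)
qed

section \<open>Identification of the prime form\<close>

definition nome :: "complex \<Rightarrow> complex" where
  "nome \<tau> = exp (2 * of_real pi * \<i> * \<tau>)"

lemma norm_nome: "Im \<tau> > 0 \<Longrightarrow> norm (nome \<tau>) < 1"
  by (simp add: nome_def)

lemma nome_nonzero [simp]: "nome \<tau> \<noteq> 0"
  by (simp add: nome_def)

abbreviation prime_form_series :: "complex \<Rightarrow> complex \<Rightarrow> complex" where
  "prime_form_series \<tau> w \<equiv>
     w * exp (- suminf (\<lambda>k. 1 / of_nat (k + 2) * eisenstein (k + 2) \<tau> * w ^ (k + 2)))"

definition prime_form_prod :: "complex \<Rightarrow> complex \<Rightarrow> complex" where
  "prime_form_prod \<tau> z = (exp (z / 2) - exp (- z / 2)) *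
     (q_prod (nome \<tau>) (exp z) * q_prod (nome \<tau>) (exp (- z)) / q_prod (nome \<tau>) 1 ^ 2)"

lemma holomorphic_prime_form_prod:
  assumes "Im \<tau> > 0"
  shows "prime_form_prod \<tau> holomorphic_on A"
proof -
  have "exp holomorphic_on A" "(\<lambda>z. exp (- z)) holomorphic_on A" by (intro holomorphic_intros)+
  hence "(\<lambda>z. q_prod (nome \<tau>) (exp z)) holomorphic_on A" "(\<lambda>z. q_prod (nome \<tau>) (exp (- z))) holomorphic_on A"
    using holomorphic_on_compose[of exp A "q_prod (nome \<tau>)"]
      holomorphic_on_compose[of "\<lambda>z. exp (- z)" A "q_prod (nome \<tau>)"] holomorphic_q_prod[OF norm_nome[OF assms]]
    by (auto simp: o_def)
  thus ?thesis unfolding prime_form_prod_def[abs_def] by (intro holomorphic_intros) (auto intro: holomorphic_intros)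
qed

lemma q_prod_1_nonzero:
  assumes "norm t < 1"
  shows "q_prod t 1 \<noteq> 0"
proof (rule q_prod_nonzero[OF assms])
  show "t ^ Suc n * 1 \<noteq> 1" for n
    using norm_power_Suc_less_1[OF assms, of n] by auto
qed

text \<open>The exponent splits into two series: the Bernoulli parts are minus the terms of
  \<open>sinh_log_fps\<close>, the divisor sums are those of \<open>q_log_combination\<close>.
  Division by \<open>k + 2\<close> turns \<open>2 / fact (k + 1)\<close> into the coefficient
  \<open>2 / fact (k + 2)\<close> of \<open>cosh_term\<close>.\<close>

lemma prime_form_prod_local:
  assumes \<tau>: "Im \<tau> > 0"
  shows "\<forall>\<^sub>F w in nhds 0. prime_form_prod \<tau> w = prime_form_series \<tau> w"
proof -
  let ?t = "nome \<tau>"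
  have t: "norm ?t < 1" using \<tau> by (rule norm_nome)
  have "((\<lambda>w. norm ?t * exp (norm (w::complex))) \<longlongrightarrow> norm ?t * exp (norm (0::complex))) (nhds 0)"
    by (intro tendsto_intros filterlim_ident)
  hence "\<forall>\<^sub>F w in nhds (0::complex). norm ?t * exp (norm w) < 1"
    using t by (intro order_tendstoD) auto
  moreover have "\<forall>\<^sub>F w in nhds (0::complex). w \<in> eball 0 (fps_conv_radius sinh_log_fps)"
    using sinh_log_fps_conv_radius by (intro eventually_nhds_in_open) (auto simp: zero_ereal_def)
  ultimately show ?thesis using exp_sinh_log
  proof eventually_elim
    case (elim w)
    let ?r = "\<lambda>j. cosh_term w j *
      suminf (\<lambda>n. of_nat (sigma (j + 1) (Suc n)) * ?t ^ Suc n)"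
    let ?q = "q_log ?t (exp w) + q_log ?t (exp (- w)) - 2 * q_log ?t 1"
    have r: "?r sums ?q" using q_log_combination[OF t elim(1)] by (rule has_sum_imp_sums)
    have "(\<lambda>k. fps_nth sinh_log_fps k * w ^ k) sums eval_fps sinh_log_fps w"
      using elim(2) by (intro sums_eval_fps) auto
    hence "(\<lambda>k. fps_nth sinh_log_fps (k + 2) * w ^ (k + 2)) sums
        (eval_fps sinh_log_fps w - (\<Sum>k<2. fps_nth sinh_log_fps k * w ^ k))"
      by (rule sums_split_initial_segment)
    hence P: "(\<lambda>k. fps_nth sinh_log_fps (k + 2) * w ^ (k + 2)) sums eval_fps sinh_log_fps w"
      by (simp add: numeral_2_eq_2 sinh_log_fps_def)
    have "1 / of_nat (k + 2) * eisenstein (k + 2) \<tau> * w ^ (k + 2) =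
        ?r k - fps_nth sinh_log_fps (k + 2) * w ^ (k + 2)" for k
    proof (cases "even k")
      case True
      have f: "fact (k + 2) = of_nat (k + 2) * (fact (k + 1) :: complex)"
        by (metis add_2_eq_Suc' fact_Suc Suc_eq_plus1 of_nat_fact of_nat_mult)
      have "fps_nth sinh_log_fps (k + 2) = bernoulli (k + 2) / fact (k + 2) / of_nat (k + 2)"
        using True unfolding sinh_log_fps_def bernoulli_def bernoulli_fps_def by (simp del: fact_Suc of_nat_Suc of_nat_add)
      moreover have "eisenstein (k + 2) \<tau> = - bernoulli (k + 2) / fact (k + 2) + 2 / fact (k + 1) *
          suminf (\<lambda>n. of_nat (sigma (k + 1) (Suc n)) * ?t ^ Suc n)"
        using True unfolding eisenstein_def nome_def by simp
      moreover have "1 / n * (- b / c + 2 / f * s) * v = 2 * v / (n * f) * s - b / c / n * v" if "n \<noteq> 0"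
        for n b c f s v :: complex using that by (simp add: field_simps)
      ultimately show ?thesis using True f by (simp del: fact_Suc of_nat_Suc of_nat_add power_Suc)
    next
      case False
      thus ?thesis by (simp add: eisenstein_def sinh_log_fps_def)
    qed
    hence "suminf (\<lambda>k. 1 / of_nat (k + 2) * eisenstein (k + 2) \<tau> * w ^ (k + 2)) = ?q - eval_fps sinh_log_fps w"
      using sums_diff[OF r P] by (simp only: sums_iff)
    hence "prime_form_series \<tau> w =
        w * exp (eval_fps sinh_log_fps w) * (exp (- q_log ?t (exp w)) * exp (- q_log ?t (exp (- w))) / exp (- q_log ?t 1) ^ 2)"
    proof -
      have "exp (- (a + b - 2 * c - p)) = exp p * (exp (- a) * exp (- b) / exp (- c) ^ 2)" for a b c p :: complex
        using exp_double[of c] by (simp add: exp_diff exp_add exp_minus field_simps)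
      thus ?thesis using \<open>suminf _ = _\<close> by (simp only: mult.assoc)
    qed
    moreover have "norm ?t * norm (exp w) < 1" "norm ?t * norm (exp (- w)) < 1" "norm ?t * norm (1::complex) < 1"
    proof -
      have h: "norm ?t * norm (exp w) \<le> norm ?t * exp (norm w)" "norm ?t * norm (exp (- w)) \<le> norm ?t * exp (norm w)"
        using abs_Re_le_cmod[of w] by (auto intro!: mult_left_mono)
      show "norm ?t * norm (exp w) < 1" "norm ?t * norm (exp (- w)) < 1"
        by (rule le_less_trans[OF h(1) elim(1)], rule le_less_trans[OF h(2) elim(1)])
    qed (use t in simp)
    ultimately show ?case unfolding prime_form_prod_def elim(3) by (simp only: exp_q_log[OF t])
  qed
qed

text \<open>By the identity theorem an entire function is determined by its germ at 0, so the
  description in \<open>prime_form\<close> has exactly one solution.\<close>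

lemma prime_form_eq:
  assumes \<tau>: "Im \<tau> > 0"
  shows "prime_form z \<tau> = prime_form_prod \<tau> z"
proof -
  have "(THE K. K holomorphic_on UNIV \<and> (\<forall>\<^sub>F w in nhds 0. K w = prime_form_series \<tau> w)) = prime_form_prod \<tau>"
  proof (rule the_equality)
    show "prime_form_prod \<tau> holomorphic_on UNIV \<and> (\<forall>\<^sub>F w in nhds 0. prime_form_prod \<tau> w =
        prime_form_series \<tau> w)"
      using holomorphic_prime_form_prod[OF \<tau>] prime_form_prod_local[OF \<tau>] by blast
    fix K assume K: "K holomorphic_on UNIV \<and> (\<forall>\<^sub>F w in nhds 0. K w =
        prime_form_series \<tau> w)"
    hence "\<forall>\<^sub>F w in nhds 0. K w = prime_form_prod \<tau> w"
      using prime_form_prod_local[OF \<tau>] by (auto elim: eventually_elim2)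
    then obtain S where S: "open S" "0 \<in> S" "\<And>w. w \<in> S \<Longrightarrow> K w = prime_form_prod \<tau> w"
      by (auto simp: eventually_nhds)
    have "K w = prime_form_prod \<tau> w" for w
      by (rule analytic_continuation_open[of S UNIV])
         (use S K holomorphic_prime_form_prod[OF \<tau>] in auto)
    thus "K = prime_form_prod \<tau>" by blast
  qed
  thus ?thesis unfolding prime_form_def by (rule fun_cong)
qed

lemma dedekind_eta_eq: "dedekind_eta \<tau> = exp (2 * of_real pi * \<i> * \<tau> / 24) * q_prod (nome \<tau>) 1"
  by (simp add: dedekind_eta_def q_prod_def nome_def)

section \<open>Continuation to the configuration space\<close>

definition period_lattice :: "complex \<Rightarrow> complex set" where
  "period_lattice \<tau> = {w. \<exists>k l :: int. w = 2 * of_real pi * \<i> * (of_int k + of_int l * \<tau>)}"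

lemma countable_period_lattice: "countable (period_lattice \<tau>)"
proof -
  have "period_lattice \<tau> = range (\<lambda>(k, l). 2 * of_real pi * \<i> * (of_int k + of_int l * \<tau>))"
    by (auto simp: period_lattice_def)
  thus ?thesis by simp
qed

lemma config_space_altdef:
  "config_space \<tau> = {z :: complex ^ 'n::finite. \<forall>i j. i \<noteq> j \<longrightarrow> z $ i - z $ j \<notin> period_lattice \<tau>}"
  by (simp add: config_space_def period_lattice_def)

lemma exp_period: "exp (2 * of_real pi * \<i> * (of_int k + of_int l * \<tau>)) = nome \<tau> powi l"
proof -
  have "2 * of_real pi * \<i> * (of_int k + of_int l * \<tau>) =
      of_int l * (2 * of_real pi * \<i> * \<tau>) + 2 * of_int k * of_real pi * \<i>"
    by (simp add: algebra_simps)
  also have "exp \<dots> = exp (of_int l * (2 * of_real pi * \<i> * \<tau>)) * exp (2 * of_int k * of_real pi * \<i>)"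
    by (rule exp_add)
  also have "exp (2 * of_int k * of_real pi * \<i>) = 1"
    by (subst exp_eq_1) auto
  finally show ?thesis by (simp add: nome_def exp_power_int)
qed

lemma exp_eq_nome_powi:
  assumes "exp w = nome \<tau> powi l"
  shows "w \<in> period_lattice \<tau>"
proof -
  define x where "x = w - 2 * of_real pi * \<i> * (of_int 0 + of_int l * \<tau>)"
  have "exp x = 1" unfolding x_def exp_diff exp_period assms by simp
  then obtain n :: int where "Re x = 0" "Im x = of_int (2 * n) * pi"
    unfolding exp_eq_1 by blast
  hence "x = of_int (2 * n) * of_real pi * \<i>" by (simp add: complex_eq_iff)
  hence "w = 2 * of_real pi * \<i> * (of_int n + of_int l * \<tau>)" by (simp add: x_def algebra_simps)
  thus ?thesis by (auto simp: period_lattice_def)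
qed

lemma q_prod_eq_0_iff:
  assumes "norm t < 1"
  shows "q_prod t x = 0 \<longleftrightarrow> (\<exists>n. t ^ Suc n * x = 1)"
proof -
  have "(\<lambda>n. 1 - t ^ Suc n * x) has_prod q_prod t x"
    unfolding q_prod_def by (rule convergent_prod_has_prod[OF convergent_q_prod[OF assms]])
  from has_prod_eq_0_iff[OF this] show ?thesis by (auto simp: image_iff)
qed

text \<open>The three kinds of factors vanish where \<open>exp w\<close> is
  \<open>nome \<tau>\<close> to the power zero, to a negative power, or to a positive power. This
  controls the poles that come from negative exponents.\<close>

lemma prime_form_prod_eq_0_iff:
  assumes \<tau>: "Im \<tau> > 0"
  shows "prime_form_prod \<tau> w = 0 \<longleftrightarrow> w \<in> period_lattice \<tau>"
proof -
  let ?t = "nome \<tau>"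
  note t = norm_nome[OF \<tau>]
  have 1: "exp (w / 2) - exp (- w / 2) = 0 \<longleftrightarrow> exp w = 1"
  proof -
    have "exp w - 1 = exp (w / 2) * (exp (w / 2) - exp (- w / 2))"
      by (simp add: algebra_simps flip: exp_add)
    thus ?thesis by (metis eq_iff_diff_eq_0 exp_not_eq_zero mult_eq_0_iff)
  qed
  have "prime_form_prod \<tau> w = 0 \<longleftrightarrow> exp w = 1 \<or> (\<exists>n. ?t ^ Suc n * exp w = 1) \<or> (\<exists>n. ?t ^ Suc n * exp (- w) = 1)"
    unfolding prime_form_prod_def using q_prod_1_nonzero[OF t] 1 by (simp add: q_prod_eq_0_iff[OF t] del: power_Suc)
  also have "\<dots> \<longleftrightarrow> (\<exists>l::int. exp w = ?t powi l)"
  proof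
    assume "exp w = 1 \<or> (\<exists>n. ?t ^ Suc n * exp w = 1) \<or> (\<exists>n. ?t ^ Suc n * exp (- w) = 1)"
    thus "\<exists>l::int. exp w = ?t powi l"
    proof (elim disjE exE)
      assume "exp w = 1"
      thus ?thesis by (intro exI[of _ 0]) simp
    next
      fix n assume "?t ^ Suc n * exp w = 1"
      hence "exp w = inverse (?t ^ Suc n)" by (metis inverse_unique)
      also have "\<dots> = ?t powi (- int (Suc n))" by (simp only: power_int_minus power_int_of_nat)
      finally show ?thesis by blast
    next
      fix n assume "?t ^ Suc n * exp (- w) = 1"
      hence "exp w = ?t ^ Suc n" by (simp add: exp_minus field_simps)
      also have "\<dots> = ?t powi (int (Suc n))" by (simp only: power_int_of_nat)
      finally show ?thesis by blast
    qed
  next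
    assume "\<exists>l::int. exp w = ?t powi l"
    then obtain l :: int where l: "exp w = ?t powi l" by blast
    consider "l = 0" | n where "l = - int (Suc n)" | n where "l = int (Suc n)"
    proof (cases l rule: int_cases3)
      case (pos n)
      thus ?thesis using that(3)[of "n - 1"] by auto
    next
      case (neg n)
      thus ?thesis using that(2)[of "n - 1"] by auto
    qed (use that(1) in auto)
    thus "exp w = 1 \<or> (\<exists>n. ?t ^ Suc n * exp w = 1) \<or> (\<exists>n. ?t ^ Suc n * exp (- w) = 1)"
    proof cases
      case (2 n)
      hence "?t ^ Suc n * exp w = 1"
        unfolding l 2 by (simp only: power_int_minus power_int_of_nat) (simp del: power_Suc)
      thus ?thesis by blast
    next
      case (3 n)
      hence "?t ^ Suc n * exp (- w) = 1"
        unfolding exp_minus l 3 by (simp only: power_int_of_nat) (simp del: power_Suc)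
      thus ?thesis by blast
    qed (simp add: l)
  qed
  also have "\<dots> \<longleftrightarrow> w \<in> period_lattice \<tau>"
    using exp_eq_nome_powi by (auto simp: period_lattice_def exp_period)
  finally show ?thesis .
qed

text \<open>The forbidden differences are the zeros of a continuous function, so discreteness of the
  period lattice need not be argued separately.\<close>

lemma open_config_space:
  assumes \<tau>: "Im \<tau> > 0"
  shows "open (config_space \<tau> :: (complex ^ 'n::finite) set)"
proof -
  have cont: "continuous_on UNIV (prime_form_prod \<tau>)"
    by (rule holomorphic_on_imp_continuous_on[OF holomorphic_prime_form_prod[OF \<tau>]])
  have "open {z :: complex ^ 'n. i \<noteq> j \<longrightarrow> prime_form_prod \<tau> (z $ i - z $ j) \<noteq> 0}" for i j
    by (cases "i = j") (auto intro!: open_Collect_neq continuous_intros continuous_on_compose2[OF cont])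
  hence "open (\<Inter>i. \<Inter>j. {z :: complex ^ 'n. i \<noteq> j \<longrightarrow> prime_form_prod \<tau> (z $ i - z $ j) \<noteq> 0})"
    by (intro open_INT) auto
  also have "(\<Inter>i. \<Inter>j. {z :: complex ^ 'n. i \<noteq> j \<longrightarrow> prime_form_prod \<tau> (z $ i - z $ j) \<noteq> 0}) = config_space \<tau>"
    by (auto simp: config_space_altdef prime_form_prod_eq_0_iff[OF \<tau>])
  finally show ?thesis .
qed

lemma trace_region_bound:
  fixes z :: "complex ^ 'n::{finite,linorder}"
  assumes "z \<in> trace_region \<tau>"
  shows "norm (nome \<tau>) * norm (exp (z $ i)) < norm (exp (z $ j))"
proof -
  have le: "norm (exp (z $ j)) \<le> norm (exp (z $ i))" if "i \<le> j" for i j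
    using assms that by (cases "i = j") (auto simp: trace_region_def order.strict_iff_order)
  have "norm (nome \<tau>) * norm (exp (z $ i)) \<le> norm (nome \<tau>) * norm (exp (z $ Min UNIV))"
    by (intro mult_left_mono le) auto
  also have "\<dots> < norm (exp (z $ Max UNIV))"
    using assms by (simp add: trace_region_def nome_def norm_mult)
  also have "\<dots> \<le> norm (exp (z $ j))" by (intro le) auto
  finally show ?thesis .
qed

text \<open>A period has real part \<open>- l * 2 * pi * Im \<tau>\<close>, and the bounds on the
  trace region force \<open>l = 0\<close>. Then the two real parts agree, against the strict
  ordering of the absolute values.\<close>

lemma trace_region_subset:
  assumes \<tau>: "Im \<tau> > 0"
  shows "(trace_region \<tau> :: (complex ^ 'n::{finite,linorder}) set) \<subseteq> config_space \<tau>"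
  unfolding config_space_altdef
proof safe
  fix z :: "complex ^ 'n::{finite,linorder}" and i j
  assume z: "z \<in> trace_region \<tau>" and ij: "i \<noteq> j" and w: "z $ i - z $ j \<in> period_lattice \<tau>"
  obtain k l :: int where kl: "z $ i - z $ j = 2 * of_real pi * \<i> * (of_int k + of_int l * \<tau>)"
    using w by (auto simp: period_lattice_def)
  let ?y = "2 * pi * Im \<tau>"
  have y: "?y > 0" using \<tau> by simp
  have n: "norm (nome \<tau>) = exp (- ?y)" by (simp add: nome_def)
  have "exp (- ?y + Re (z $ i)) < exp (Re (z $ j))" "exp (- ?y + Re (z $ j)) < exp (Re (z $ i))"
    using trace_region_bound[OF z, of i j] trace_region_bound[OF z, of j i]
    unfolding n exp_add by (simp_all only: norm_exp_eq_Re)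
  hence "- ?y + Re (z $ i) < Re (z $ j)" "- ?y + Re (z $ j) < Re (z $ i)" by simp_all
  moreover have re: "Re (z $ i) - Re (z $ j) = - (of_int l * ?y)"
    using arg_cong[OF kl, of Re] by simp
  ultimately have "of_int l * ?y < 1 * ?y" "(- 1) * ?y < of_int l * ?y" by linarith+
  hence "of_int l < (1::real)" "(- 1 :: real) < of_int l"
    using y by (simp_all only: mult_less_cancel_right_pos)
  hence "l = 0" by linarith
  hence "Re (z $ i) = Re (z $ j)" using re by simp
  moreover have "Re (z $ j') < Re (z $ i')" if "i' < j'" for i' j'
    using z that by (simp add: trace_region_def)
  from this[of i j] this[of j i] have "Re (z $ i) \<noteq> Re (z $ j)"
    using ij by (cases i j rule: linorder_cases) auto
  ultimately show False by simp
qed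

lemma open_trace_region: "open (trace_region \<tau> :: (complex ^ 'n::{finite,linorder}) set)"
proof -
  have "open {z :: complex ^ 'n::{finite,linorder}. i < j \<longrightarrow> norm (exp (z $ i)) > norm (exp (z $ j))}" for i j
    by (cases "i < j") (auto intro!: open_Collect_less continuous_intros)
  hence "open ((\<Inter>i. \<Inter>j. {z :: complex ^ 'n::{finite,linorder}. i < j \<longrightarrow> norm (exp (z $ i)) > norm (exp (z $ j))}) \<inter>
    {z. norm (exp (2 * of_real pi * \<i> * \<tau>) * exp (z $ Min UNIV)) < norm (exp (z $ Max UNIV))})"
    by (intro open_Int open_INT open_Collect_less continuous_intros ballI) auto
  also have "\<dots> = trace_region \<tau>" by (auto simp: trace_region_def)
  finally show ?thesis .
qed

lemma trace_region_nonempty: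
  assumes \<tau>: "Im \<tau> > 0"
  shows "(trace_region \<tau> :: (complex ^ 'n::{finite,linorder}) set) \<noteq> {}"
proof -
  let ?y = "2 * pi * Im \<tau>"
  have y: "?y > 0" using \<tau> by simp
  define c where "c i = card {k::'n. k < i}" for i
  \<comment> \<open>Real, equally spaced and decreasing entries within an interval shorter than
    \<open>?y\<close>, the logarithmic width of the annulus.\<close>
  define z :: "complex ^ 'n::{finite,linorder}" where "z = (\<chi> i. of_real (- ?y * (real (c i) / real CARD('n))))"
  have c: "c i < c j" if "i < j" for i j
    unfolding c_def by (rule psubset_card_mono) (use that in auto)
  have lt: "c i < CARD('n)" for i
    unfolding c_def by (rule psubset_card_mono) auto
  have N: "real CARD('n) > 0" by simp
  have "z \<in> trace_region \<tau>"
    unfolding trace_region_def mem_Collect_eq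
  proof (intro conjI allI impI)
    fix i j :: 'n assume "i < j"
    hence "?y * (real (c i) / real CARD('n)) < ?y * (real (c j) / real CARD('n))"
      using c N y by (intro mult_strict_left_mono divide_strict_right_mono) auto
    thus "norm (exp (z $ j)) < norm (exp (z $ i))" by (simp add: z_def)
  next
    have "?y * (real (c (Max UNIV)) / real CARD('n)) < ?y * 1"
      using lt[of "Max UNIV"] N y by (intro mult_strict_left_mono) auto
    moreover have "0 \<le> ?y * (real (c (Min UNIV)) / real CARD('n))" using \<tau> by (intro mult_nonneg_nonneg) auto
    ultimately have "- ?y + - ?y * (real (c (Min UNIV)) / real CARD('n)) < - ?y * (real (c (Max UNIV)) / real CARD('n))"
      unfolding mult_minus_left by linarith
    thus "norm (exp (2 * of_real pi * \<i> * \<tau>) * exp (z $ Min UNIV)) < norm (exp (z $ Max UNIV))"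
      by (simp add: z_def norm_mult flip: exp_add)
  qed
  thus ?thesis by blast
qed

text \<open>A function on the configuration space is determined by its values on the trace region: restrict
  to the complex line through a point of the trace region, on which the configuration space is the
  complement of a countable set and hence connected.\<close>

lemma config_space_continuation:
  fixes F G :: "complex ^ 'n::{finite,linorder} \<Rightarrow> complex"
  assumes \<tau>: "Im \<tau> > 0"
    and F: "holomorphic_several F (config_space \<tau>)" and G: "holomorphic_several G (config_space \<tau>)"
    and eq: "\<And>z. z \<in> trace_region \<tau> \<Longrightarrow> F z = G z" and z: "z \<in> config_space \<tau>"
  shows "F z = G z"
proof -
  obtain w :: "complex ^ 'n::{finite,linorder}" where w: "w \<in> trace_region \<tau>" using trace_region_nonempty[OF \<tau>] by blast
  hence wc: "w \<in> config_space \<tau>" using trace_region_subset[OF \<tau>] by blast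
  \<comment> \<open>\<open>s = 0\<close> is the point of the trace region and \<open>s = 1\<close>
    is \<open>z\<close>.\<close>
  define \<gamma> where "\<gamma> s = w + s *s (z - w)" for s
  have lin: "bounded_linear (\<lambda>s. s *s (z - w))"
    by (rule linear_conv_bounded_linear[THEN iffD1]) (auto intro!: linearI simp: vec_eq_iff algebra_simps)
  have der: "(\<gamma> has_derivative (\<lambda>s. s *s (z - w))) (at s)" for s
    using has_derivative_add[OF has_derivative_const[of w] bounded_linear_imp_has_derivative[OF lin]]
    unfolding \<gamma>_def by (simp only: add_0)
  have cont: "continuous_on UNIV \<gamma>"
    by (rule continuous_at_imp_continuous_on) (auto intro: has_derivative_continuous[OF der])
  define D where "D = \<gamma> -` config_space \<tau>"
  define T where "T = \<gamma> -` trace_region \<tau>"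
  have openD: "open D" "open T"
    unfolding D_def T_def using open_config_space[OF \<tau>] open_trace_region cont
    by (auto intro: open_vimage)
  define E where "E i j = {s. i \<noteq> j \<and> \<gamma> s $ i - \<gamma> s $ j \<in> period_lattice \<tau>}" for i j
  have countE: "countable (E i j)" for i j
  proof -
    define b where "b = (z $ i - w $ i) - (z $ j - w $ j)"
    have g: "\<gamma> s $ i - \<gamma> s $ j = (w $ i - w $ j) + s * b" for s
      by (simp add: \<gamma>_def b_def algebra_simps)
    show ?thesis
    proof (cases "b = 0")
      \<comment> \<open>The difference is constant along the line, and at \<open>w\<close> it is not
        a period.\<close>
      case True
      hence "E i j = {}" using wc by (auto simp: E_def g config_space_altdef)
      thus ?thesis by simp
    next
      case False
      let ?f = "\<lambda>s. (w $ i - w $ j) + s * b"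
      have "?f ` E i j \<subseteq> period_lattice \<tau>" by (auto simp: E_def g)
      hence "countable (?f ` E i j)" by (rule countable_subset[OF _ countable_period_lattice])
      moreover have "inj_on ?f (E i j)" using False by (simp add: inj_on_def)
      ultimately show ?thesis by (rule countable_image_inj_on)
    qed
  qed
  have "D = UNIV - (\<Union>i. \<Union>j. E i j)" by (auto simp: D_def E_def config_space_altdef)
  moreover have "connected (UNIV - (\<Union>i. \<Union>j. E i j))"
    by (rule connected_open_diff_countable) (auto intro!: countable_UN countE)
  ultimately have conn: "connected D" by simp
  have hol: "(\<lambda>s. H (\<gamma> s)) holomorphic_on D" if H: "holomorphic_several H (config_space \<tau>)" for H
    unfolding holomorphic_on_open[OF openD(1)]
  proof
    fix s assume "s \<in> D"
    then obtain H' where H': "(H has_derivative H') (at (\<gamma> s))" "\<And>c v. H' (c *s v) = c * H' v"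
      using H by (auto simp: D_def holomorphic_several_def)
    have "((\<lambda>s. H (\<gamma> s)) has_derivative (\<lambda>h. H' (h *s (z - w)))) (at s)"
      by (rule has_derivative_compose[OF der H'(1)])
    hence "((\<lambda>s. H (\<gamma> s)) has_field_derivative H' (z - w)) (at s)"
      unfolding has_field_derivative_def H'(2)
      by (rule has_derivative_eq_rhs) (simp add: fun_eq_iff mult.commute)
    thus "\<exists>f'. ((\<lambda>s. H (\<gamma> s)) has_field_derivative f') (at s)" by blast
  qed
  have "F (\<gamma> 1) = G (\<gamma> 1)"
  proof (rule analytic_continuation_open[OF openD(2,1) _ conn _ hol[OF F] hol[OF G]])
    have "0 \<in> T" using w by (simp add: T_def \<gamma>_def)
    thus "T \<noteq> {}" by blast
    show "T \<subseteq> D" using trace_region_subset[OF \<tau>] by (auto simp: T_def D_def)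
    show "F (\<gamma> s) = G (\<gamma> s)" if "s \<in> T" for s using eq that by (simp add: T_def)
    show "1 \<in> D" using z by (simp add: D_def \<gamma>_def)
  qed
  thus ?thesis by (simp add: \<gamma>_def)
qed

section \<open>Complex differentiability in several variables\<close>

definition complex_differentiable_at :: "(complex ^ 'n::finite \<Rightarrow> complex) \<Rightarrow> complex ^ 'n \<Rightarrow> bool" where
  "complex_differentiable_at F z \<longleftrightarrow>
     (\<exists>F'. (F has_derivative F') (at z) \<and> (\<forall>c v. F' (c *s v) = c * F' v))"

lemma complex_differentiable_const: "complex_differentiable_at (\<lambda>_. c) z"
  unfolding complex_differentiable_at_def by (intro exI[of _ "\<lambda>_. 0"]) auto

lemma complex_differentiable_mult:
  assumes "complex_differentiable_at F z" "complex_differentiable_at G z"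
  shows "complex_differentiable_at (\<lambda>z. F z * G z) z"
proof -
  obtain F' G' where "(F has_derivative F') (at z)" "\<And>c v. F' (c *s v) = c * F' v"
    "(G has_derivative G') (at z)" "\<And>c v. G' (c *s v) = c * G' v"
    using assms by (auto simp: complex_differentiable_at_def)
  thus ?thesis unfolding complex_differentiable_at_def
    by (intro exI[of _ "\<lambda>v. F z * G' v + F' v * G z"] conjI has_derivative_mult) (auto simp: algebra_simps)
qed

lemma complex_differentiable_prod:
  "(\<And>i. i \<in> I \<Longrightarrow> complex_differentiable_at (F i) z) \<Longrightarrow>
     complex_differentiable_at (\<lambda>z. \<Prod>i\<in>I. F i z) z"
  by (induction I rule: infinite_finite_induct)
     (auto intro: complex_differentiable_const complex_differentiable_mult)

lemma complex_differentiable_compose: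
  assumes "g field_differentiable at (l z)" "bounded_linear l" "\<And>c v. l (c *s v) = c * l v"
  shows "complex_differentiable_at (\<lambda>z. g (l z)) z"
proof -
  obtain g' where "(g has_derivative (*) g') (at (l z))"
    using assms(1) by (auto simp: field_differentiable_def has_field_derivative_def)
  hence "((\<lambda>z. g (l z)) has_derivative (\<lambda>v. g' * l v)) (at z)"
    by (rule has_derivative_compose[OF bounded_linear_imp_has_derivative[OF assms(2)]])
  thus ?thesis unfolding complex_differentiable_at_def
    by (intro exI[of _ "\<lambda>v. g' * l v"]) (simp add: assms(3))
qed

lemma sum_pairs:
  fixes f :: "'n::{finite,linorder} \<Rightarrow> 'n \<Rightarrow> 'a::comm_monoid_add"
  shows "(\<Sum>i\<in>UNIV. \<Sum>j\<in>UNIV. f i j) = (\<Sum>i\<in>UNIV. f i i) + (\<Sum>(i, j)\<in>{(i, j). i < j}. f i j + f j i)"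
proof -
  let ?P = "{(i, j). i < j} :: ('n \<times> 'n) set" and ?P' = "{(i, j). j < i} :: ('n \<times> 'n) set"
  let ?d = "range (\<lambda>i::'n. (i, i))"
  have U: "UNIV \<times> UNIV = ?d \<union> (?P \<union> ?P')" by (auto simp: image_iff)
  have "(\<Sum>i\<in>UNIV. \<Sum>j\<in>UNIV. f i j) = (\<Sum>(i, j)\<in>?d \<union> (?P \<union> ?P'). f i j)"
    unfolding U[symmetric] by (rule sum.cartesian_product)
  also have "\<dots> = (\<Sum>(i, j)\<in>?d. f i j) + (\<Sum>(i, j)\<in>?P \<union> ?P'. f i j)"
    by (rule sum.union_disjoint) auto
  also have "(\<Sum>(i, j)\<in>?P \<union> ?P'. f i j) = (\<Sum>(i, j)\<in>?P. f i j) + (\<Sum>(i, j)\<in>?P'. f i j)"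
    by (rule sum.union_disjoint) auto
  also have "(\<Sum>(i, j)\<in>?P'. f i j) = (\<Sum>(i, j)\<in>?P. f j i)"
    by (rule sum.reindex_bij_witness[of _ prod.swap prod.swap]) auto
  also have "(\<Sum>(i, j)\<in>?d. f i j) = (\<Sum>i\<in>UNIV. f i i)"
    by (subst sum.reindex) (auto simp: inj_on_def)
  finally show ?thesis by (simp add: sum.distrib case_prod_unfold)
qed

section \<open>The n-point function\<close>

context rank_one_lattice_voa
begin

definition n_point_value :: "('n::{finite,linorder} \<Rightarrow> 'l) \<Rightarrow> 'l \<Rightarrow> complex \<Rightarrow> complex ^ 'n::{finite,linorder} \<Rightarrow> complex" where
  "n_point_value \<alpha> \<beta> \<tau> z = exp (2 * of_real pi * \<i> * \<tau> * (of_int (B \<beta> \<beta>) / 2)) / dedekind_eta \<tau> *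
     (\<Prod>r\<in>UNIV. exp (of_int (B \<beta> (\<alpha> r)) * z $ r)) *
     (\<Prod>(i, j)\<in>{(i, j). i < j}.
        of_int (\<epsilon> (\<alpha> i) (\<alpha> j)) * prime_form (z $ i - z $ j) \<tau> powi B (\<alpha> i) (\<alpha> j))"

lemma foldr_Y_evec:
  "foldr (\<lambda>i. Y (smul (e i) (evec (\<alpha> i))) (m i)) xs v =
     smul (prod_list (map e xs)) (foldr (\<lambda>i. Y_exp (\<alpha> i) (m i)) xs v)"
  by (induction xs) (simp_all add: Y_evec is_linear_smul[OF is_linear_Y_exp])

lemma is_linear_foldr_Y_exp: "is_linear (foldr (\<lambda>i. Y_exp (\<alpha> i) (m i)) xs)"
  by (induction xs) (simp_all add: is_linear_def is_linear_add[OF is_linear_Y_exp] is_linear_smul[OF is_linear_Y_exp])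

text \<open>Because the charges sum to zero, the sector reached is that of \<open>\<beta>\<close>,
  and the diagonal entry of the trace is the one in \<open>path_coeff\<close>. The first product
  collects the conformal weights of the inserted vectors.\<close>

lemma trace_term_eq:
  fixes \<alpha> :: "'n::{finite,linorder} \<Rightarrow> 'l" and z :: "complex ^ 'n::{finite,linorder}"
  assumes sum0: "(\<Sum>i\<in>UNIV. \<alpha> i) = 0"
  shows "trace_term (\<lambda>i. evec (\<alpha> i)) \<beta> \<tau> z (\<mu>, m) =
    (\<Prod>i\<in>UNIV. exp (z $ i * of_int (B (\<alpha> i) (\<alpha> i)) / 2)) *
    exp (2 * of_real pi * \<i> * \<tau> * (of_int (B \<beta> \<beta>) / 2 - 1 / 24)) *
    (nome \<tau> ^ weight \<mu> * path_coeff \<alpha> \<beta> (\<lambda>i. exp (z $ i)) (sorted_list_of_set UNIV) m \<mu> \<mu>)"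
proof -
  let ?xs = "sorted_list_of_set (UNIV :: 'n set)"
  let ?e = "\<lambda>i. exp (z $ i * of_int (B (\<alpha> i) (\<alpha> i)) / 2)"
  have tc: "total_charge \<alpha> \<beta> ?xs = \<beta>" using sum0 by (simp add: total_charge_def)
  have pl: "prod_list (map ?e ?xs) = (\<Prod>i\<in>UNIV. ?e i)"
    using prod.distinct_set_conv_list[of ?xs ?e] by simp
  have "2 * of_real pi * \<i> * \<tau> * (of_int (B \<beta> \<beta>) / 2 + of_nat (weight \<mu>) - 1 / 24) =
      2 * of_real pi * \<i> * \<tau> * (of_int (B \<beta> \<beta>) / 2 - 1 / 24) + of_nat (weight \<mu>) * (2 * of_real pi * \<i> * \<tau>)"
    by (simp add: algebra_simps)
  hence q: "exp (2 * of_real pi * \<i> * \<tau> * (of_int (B \<beta> \<beta>) / 2 + of_nat (weight \<mu>) - 1 / 24)) =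
      exp (2 * of_real pi * \<i> * \<tau> * (of_int (B \<beta> \<beta>) / 2 - 1 / 24)) * nome \<tau> ^ weight \<mu>"
    by (simp only: exp_add exp_of_nat_mult nome_def)
  show ?thesis
    unfolding trace_term_def prod.case exp_L0_evec foldr_Y_evec q_L0_bvec
      is_linear_smul[OF is_linear_foldr_Y_exp] lookup_smul pl q path_coeff_def tc
    by (simp add: mult_ac)
qed

text \<open>After \<open>trace_path_coeff\<close>, what remains is to match scalars. Vanishing row
  sums of the pairings cancel the non-invariant exponentials and turn the diagonal terms of the
  exponent into denominators of pair factors.\<close>

lemma trace_has_sum:
  fixes \<alpha> :: "'n::{finite,linorder} \<Rightarrow> 'l" and z :: "complex ^ 'n::{finite,linorder}"
  assumes sum0: "(\<Sum>i\<in>UNIV. \<alpha> i) = 0" and \<tau>: "Im \<tau> > 0" and z: "z \<in> trace_region \<tau>"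
  shows "(trace_term (\<lambda>i. evec (\<alpha> i)) \<beta> \<tau> z has_sum n_point_value \<alpha> \<beta> \<tau> z) UNIV"
proof -
  define Q where "Q i = exp (z $ i)" for i
  let ?t = "nome \<tau>"
  note t = norm_nome[OF \<tau>]
  define E where "E = (\<Prod>i\<in>UNIV. exp (z $ i * of_int (B (\<alpha> i) (\<alpha> i)) / 2)) *
    exp (2 * of_real pi * \<i> * \<tau> * (of_int (B \<beta> \<beta>) / 2 - 1 / 24))"
  define b where "b i j = (of_int (B (\<alpha> i) (\<alpha> j)) :: complex)" for i j
  define l where "l i j = q_log ?t (Q i / Q j)" for i j
  let ?P = "{(i, j). i < j} :: ('n \<times> 'n) set"
  let ?bl = "\<Sum>i\<in>UNIV. \<Sum>j\<in>UNIV. b i j * l i j"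
  let ?zd = "\<Sum>i\<in>UNIV. z $ i * b i i / 2" and ?zp = "\<Sum>(i, j)\<in>?P. b i j * (z $ i + z $ j) / 2"
  let ?bp = "\<Sum>(i, j)\<in>?P. b i j" and ?n = "\<lambda>i j. B (\<alpha> i) (\<alpha> j)"
  define V where "V = path_factor \<alpha> \<beta> Q UNIV * exp (- ?bl) / q_prod ?t 1"
  have Qnz: "Q i \<noteq> 0" for i by (simp add: Q_def)
  have Qm: "norm (Q j) < norm (Q i)" if "i < j" for i j
    using z that by (auto simp: trace_region_def Q_def)
  have tQ: "norm ?t * norm (Q i) < norm (Q j)" for i j
    using trace_region_bound[OF z] by (simp add: Q_def)
  have tx: "norm ?t * norm (Q i / Q j) < 1" for i j
    using tQ[of i j] Qnz[of j] by (simp add: norm_divide divide_simps)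
  have S: "((\<lambda>(\<mu>, m). ?t ^ weight \<mu> * path_coeff \<alpha> \<beta> Q (sorted_list_of_set UNIV) m \<mu> \<mu>) has_sum V) (UNIV \<times> UNIV)"
    unfolding V_def b_def l_def q_prod_def mult_1_right by (rule trace_path_coeff[OF Qnz Qm t tQ])
  have "trace_term (\<lambda>i. evec (\<alpha> i)) \<beta> \<tau> z = (\<lambda>p. E * (case p of (\<mu>, m) \<Rightarrow>
      ?t ^ weight \<mu> * path_coeff \<alpha> \<beta> Q (sorted_list_of_set UNIV) m \<mu> \<mu>))"
  proof
    fix p :: "nat multiset \<times> ('n \<Rightarrow> int)"
    show "trace_term (\<lambda>i. evec (\<alpha> i)) \<beta> \<tau> z p = E * (case p of (\<mu>, m) \<Rightarrow>
      ?t ^ weight \<mu> * path_coeff \<alpha> \<beta> Q (sorted_list_of_set UNIV) m \<mu> \<mu>)"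
      by (cases p) (simp only: trace_term_eq[OF sum0] E_def Q_def[abs_def] prod.case)
  qed
  hence "(trace_term (\<lambda>i. evec (\<alpha> i)) \<beta> \<tau> z has_sum E * V) UNIV"
    using has_sum_cmult_right[OF S, of E] by (simp only: UNIV_Times_UNIV)
  moreover have "E * V = n_point_value \<alpha> \<beta> \<tau> z"
  proof -
    define sh where "sh i j = exp ((z $ i - z $ j) / 2) - exp (- (z $ i - z $ j) / 2)" for i j
    define qq where "qq i j = q_prod ?t (exp (z $ i - z $ j)) * q_prod ?t (exp (- (z $ i - z $ j))) / q_prod ?t 1 ^ 2" for i j
    have bs: "b i j = b j i" for i j by (simp add: b_def B_sym)
    have bP: "b (snd p) (fst p) = b (fst p) (snd p)" for p by (rule bs)
    have brow: "(\<Sum>j\<in>UNIV. b i j) = 0" for i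
      unfolding b_def of_int_sum[symmetric] B_sum_right[symmetric] sum0 by simp
    \<comment> \<open>The signs against \<open>\<beta>\<close> multiply to the cocycle value at the
      total charge 0, which is 1.\<close>
    have single: "(\<Prod>i\<in>UNIV. single_factor \<alpha> \<beta> Q i) = (\<Prod>r\<in>UNIV. exp (of_int (B \<beta> (\<alpha> r)) * z $ r))"
    proof -
      have "(\<Prod>i\<in>UNIV. \<epsilon> (\<alpha> i) \<beta>) = 1"
        using eps_sum_left[of UNIV \<alpha> \<beta>] sum0 by simp
      hence "(\<Prod>i\<in>UNIV. of_int (\<epsilon> (\<alpha> i) \<beta>)) = (1 :: complex)"
        by (metis of_int_1 of_int_prod)
      thus ?thesis
        unfolding single_factor_def prod.distrib by (simp add: Q_def exp_power_int B_sym)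
    qed
    \<comment> \<open>The difference \<open>Q i - Q j\<close> is made symmetric by splitting off the
      exponential of half the sum of the two arguments.\<close>
    have pair: "pair_factor \<alpha> Q i j = exp (b i j * (z $ i + z $ j) / 2) *
        (of_int (\<epsilon> (\<alpha> i) (\<alpha> j)) * sh i j powi ?n i j)" for i j
    proof -
      have "Q i * (1 - Q j / Q i) = exp ((z $ i + z $ j) / 2) * sh i j"
      proof -
        have "exp ((z $ i + z $ j) / 2) * sh i j = exp ((z $ i + z $ j) / 2 + (z $ i - z $ j) / 2) -
            exp ((z $ i + z $ j) / 2 + - (z $ i - z $ j) / 2)"
          by (simp only: sh_def exp_add right_diff_distrib)
        also have "\<dots> = Q i - Q j" by (simp add: Q_def add_divide_distrib diff_divide_distrib)
        finally show ?thesis using Qnz[of i] by (simp add: algebra_simps)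
      qed
      hence "Q i powi ?n i j * (1 - Q j / Q i) powi ?n i j =
          exp ((z $ i + z $ j) / 2) powi ?n i j * sh i j powi ?n i j"
        by (simp only: flip: power_int_mult_distrib)
      thus ?thesis unfolding pair_factor_def by (simp add: exp_power_int b_def mult_ac)
    qed
    \<comment> \<open>The exponents of the conformal weights cancel those split off in
      \<open>pair\<close>: together they are the sum over \<open>i\<close> of
      \<open>z $ i / 2\<close> times a row sum of \<open>b\<close>.\<close>
    have lin: "?zd + ?zp = 0"
    proof -
      have "(\<Sum>i\<in>UNIV. \<Sum>j\<in>UNIV. z $ i * b i j / 2) = (\<Sum>i\<in>UNIV. z $ i * (\<Sum>j\<in>UNIV. b i j) / 2)"
        by (simp add: sum_distrib_left sum_divide_distrib)
      hence "(\<Sum>i\<in>UNIV. \<Sum>j\<in>UNIV. z $ i * b i j / 2) = 0" by (simp add: brow)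
      moreover have "z $ i * b i j / 2 + z $ j * b j i / 2 = b i j * (z $ i + z $ j) / 2" for i j
        unfolding bs[of j i] by (simp add: algebra_simps add_divide_distrib)
      ultimately show ?thesis by (simp add: sum_pairs[of "\<lambda>i j. z $ i * b i j / 2"])
    qed
    have quad: "exp (- ?bl) = (\<Prod>(i, j)\<in>?P. qq i j powi ?n i j)"
    proof -
      \<comment> \<open>All row sums vanish, so the diagonal is minus twice the sum over pairs. It
        gives each pair its term \<open>- 2 * q_log ?t 1\<close>, hence the squared denominator of
        \<open>qq\<close>.\<close>
      have diag: "(\<Sum>i\<in>UNIV. b i i) = - 2 * ?bp"
      proof -
        have "(\<Sum>i\<in>UNIV. b i i) + (\<Sum>(i, j)\<in>?P. b i j + b j i) = 0"
          unfolding sum_pairs[of b, symmetric] brow by simp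
        moreover have "(\<Sum>(i, j)\<in>?P. b i j + b j i) = 2 * ?bp"
          by (simp add: case_prod_unfold bP sum_distrib_left)
        ultimately show ?thesis by (simp add: eq_neg_iff_add_eq_0)
      qed
      have "?bl =
          (\<Sum>i\<in>UNIV. b i i * q_log ?t 1) + (\<Sum>(i, j)\<in>?P. b i j * (l i j + l j i))"
        unfolding sum_pairs[of "\<lambda>i j. b i j * l i j"]
        by (simp add: l_def Qnz ring_distribs bP case_prod_unfold)
      also have "(\<Sum>i\<in>UNIV. b i i * q_log ?t 1) = - 2 * ?bp * q_log ?t 1"
        unfolding sum_distrib_right[symmetric] diag ..
      also have "- 2 * ?bp * q_log ?t 1 + (\<Sum>(i, j)\<in>?P. b i j * (l i j + l j i)) =
          (\<Sum>(i, j)\<in>?P. b i j * (l i j + l j i - 2 * q_log ?t 1))"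
        by (simp add: case_prod_unfold sum_distrib_left sum_distrib_right sum_subtractf algebra_simps sum.distrib sum_negf)
      finally have "exp (- ?bl) =
          (\<Prod>(i, j)\<in>?P. exp (b i j * (- (l i j + l j i - 2 * q_log ?t 1))))"
        by (simp add: case_prod_unfold exp_sum del: minus_diff_eq flip: sum_negf)
      also have "\<dots> = (\<Prod>(i, j)\<in>?P. qq i j powi ?n i j)"
      proof (intro prod.cong refl, clarify)
        fix i j
        have "exp (- (x + y - 2 * w)) = exp (- x) * exp (- y) / exp (- w) ^ 2" for x y w :: complex
          using exp_double[of w] by (simp add: exp_diff exp_add exp_minus field_simps)
        hence "exp (- (l i j + l j i - 2 * q_log ?t 1)) = exp (- l i j) * exp (- l j i) / exp (- q_log ?t 1) ^ 2" .
        also have "exp (- l i j) = q_prod ?t (exp (z $ i - z $ j))"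
          unfolding l_def exp_q_log[OF t tx] by (simp add: Q_def exp_diff)
        also have "exp (- l j i) = q_prod ?t (exp (- (z $ i - z $ j)))"
          unfolding l_def exp_q_log[OF t tx] by (simp add: Q_def exp_diff)
        also have "exp (- q_log ?t 1) = q_prod ?t 1" by (rule exp_q_log[OF t]) (use t in simp)
        finally have "exp (- (l i j + l j i - 2 * q_log ?t 1)) = qq i j" by (simp only: qq_def)
        thus "exp (b i j * (- (l i j + l j i - 2 * q_log ?t 1))) = qq i j powi ?n i j"
          unfolding b_def exp_power_int[symmetric] by simp
      qed
      finally show ?thesis .
    qed
    have pf: "prime_form (z $ i - z $ j) \<tau> powi ?n i j =
        sh i j powi ?n i j * qq i j powi ?n i j" for i j
      unfolding prime_form_eq[OF \<tau>] prime_form_prod_def sh_def qq_def power_int_mult_distrib ..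
    have E: "E = exp ?zd * (exp (2 * of_real pi * \<i> * \<tau> * (of_int (B \<beta> \<beta>) / 2)) /
        exp (2 * of_real pi * \<i> * \<tau> / 24))"
      by (simp add: E_def b_def exp_sum right_diff_distrib exp_diff)
    have "path_factor \<alpha> \<beta> Q UNIV = (\<Prod>r\<in>UNIV. exp (of_int (B \<beta> (\<alpha> r)) * z $ r)) *
        (exp ?zp *
         (\<Prod>(i, j)\<in>?P. of_int (\<epsilon> (\<alpha> i) (\<alpha> j)) * sh i j powi ?n i j))"
      unfolding path_factor_def single pair by (simp add: case_prod_unfold prod.distrib exp_sum)
    hence "E * V = exp (?zd + ?zp) *
        (exp (2 * of_real pi * \<i> * \<tau> * (of_int (B \<beta> \<beta>) / 2)) / dedekind_eta \<tau> *
         (\<Prod>r\<in>UNIV. exp (of_int (B \<beta> (\<alpha> r)) * z $ r)) *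
         ((\<Prod>(i, j)\<in>?P. of_int (\<epsilon> (\<alpha> i) (\<alpha> j)) * sh i j powi ?n i j) *
          (\<Prod>(i, j)\<in>?P. qq i j powi ?n i j)))"
      unfolding E V_def quad dedekind_eta_eq exp_add by (simp add: mult_ac)
    also have "\<dots> = n_point_value \<alpha> \<beta> \<tau> z"
      unfolding lin n_point_value_def pf by (simp add: case_prod_unfold prod.distrib mult_ac)
    finally show ?thesis .
  qed
  ultimately show ?thesis by simp
qed

lemma complex_differentiable_n_point_value:
  fixes \<alpha> :: "'n::{finite,linorder} \<Rightarrow> 'l" and z :: "complex ^ 'n::{finite,linorder}"
  assumes \<tau>: "Im \<tau> > 0" and z: "z \<in> config_space \<tau>"
  shows "complex_differentiable_at (n_point_value \<alpha> \<beta> \<tau>) z"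
  unfolding n_point_value_def[abs_def]
proof (intro complex_differentiable_mult complex_differentiable_const complex_differentiable_prod)
  fix r :: 'n
  have "(\<lambda>w. exp (of_int (B \<beta> (\<alpha> r)) * w)) field_differentiable at (z $ r)"
    by (rule holomorphic_on_imp_differentiable_at[of _ UNIV]) (auto intro!: holomorphic_intros)
  from complex_differentiable_compose[of "\<lambda>w. exp (of_int (B \<beta> (\<alpha> r)) * w)" "\<lambda>z. z $ r", OF this bounded_linear_vec_nth]
  show "complex_differentiable_at (\<lambda>z :: complex ^ 'n::{finite,linorder}. exp (of_int (B \<beta> (\<alpha> r)) * z $ r)) z"
    by simp
next
  fix p :: "'n \<times> 'n" assume p: "p \<in> {(i, j). i < j}"
  obtain i j where ij: "p = (i, j)" by force
  have "i \<noteq> j" using p ij by auto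
  hence w: "prime_form_prod \<tau> (z $ i - z $ j) \<noteq> 0"
    using z by (simp add: config_space_altdef prime_form_prod_eq_0_iff[OF \<tau>])
  let ?g = "\<lambda>w. of_int (\<epsilon> (\<alpha> i) (\<alpha> j)) * prime_form_prod \<tau> w powi B (\<alpha> i) (\<alpha> j)"
  have "open {w. prime_form_prod \<tau> w \<noteq> 0}"
    using holomorphic_on_imp_continuous_on[OF holomorphic_prime_form_prod[OF \<tau>, of UNIV]]
    by (intro open_Collect_neq continuous_on_const)
  moreover have "?g holomorphic_on {w. prime_form_prod \<tau> w \<noteq> 0}"
    by (intro holomorphic_intros holomorphic_prime_form_prod[OF \<tau>]) auto
  ultimately have g: "?g field_differentiable at (z $ i - z $ j)"
    using w holomorphic_on_imp_differentiable_at by blast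
  have "bounded_linear (\<lambda>z :: complex ^ 'n::{finite,linorder}. z $ i - z $ j)"
    by (intro bounded_linear_sub bounded_linear_vec_nth)
  from complex_differentiable_compose[of ?g "\<lambda>z. z $ i - z $ j", OF g this]
  show "complex_differentiable_at (\<lambda>z :: complex ^ 'n::{finite,linorder}. case p of (i, j) \<Rightarrow>
      of_int (\<epsilon> (\<alpha> i) (\<alpha> j)) * prime_form (z $ i - z $ j) \<tau> powi B (\<alpha> i) (\<alpha> j)) z"
    unfolding ij prime_form_eq[OF \<tau>] by (simp add: right_diff_distrib)
qed

text \<open>The description in \<open>n_point_function\<close> has exactly one solution: the sum
  fixes it on the trace region, \<open>config_space_continuation\<close> extends this to the
  configuration space, and elsewhere the value 0 is prescribed.\<close>

lemma n_point_function_eq: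
  fixes \<alpha> :: "'n::{finite,linorder} \<Rightarrow> 'l"
  assumes sum0: "(\<Sum>i\<in>UNIV. \<alpha> i) = 0" and \<tau>: "Im \<tau> > 0"
  shows "is_n_point_function (\<lambda>i. evec (\<alpha> i)) \<beta> \<tau> (n_point_function (\<lambda>i. evec (\<alpha> i)) \<beta> \<tau>)"
    and "z \<in> config_space \<tau> \<Longrightarrow> n_point_function (\<lambda>i. evec (\<alpha> i)) \<beta> \<tau> z = n_point_value \<alpha> \<beta> \<tau> z"
proof -
  define F where "F z = (if z \<in> config_space \<tau> then n_point_value \<alpha> \<beta> \<tau> z else 0)" for z
  have hol: "holomorphic_several F (config_space \<tau>)"
    unfolding holomorphic_several_def
  proof
    fix z :: "complex ^ 'n::{finite,linorder}" assume z: "z \<in> config_space \<tau>"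
    obtain F' where F': "(n_point_value \<alpha> \<beta> \<tau> has_derivative F') (at z)" "\<forall>c v. F' (c *s v) = c * F' v"
      using complex_differentiable_n_point_value[OF \<tau> z, of \<alpha> \<beta>] by (auto simp: complex_differentiable_at_def)
    have "(F has_derivative F') (at z)"
      by (rule has_derivative_transform_within_open[OF F'(1) open_config_space[OF \<tau>] z]) (simp add: F_def)
    thus "\<exists>F'. (F has_derivative F') (at z) \<and> (\<forall>c v. F' (c *s v) = c * F' v)" using F'(2) by blast
  qed
  have "F z = n_point_value \<alpha> \<beta> \<tau> z" if "z \<in> trace_region \<tau>" for z
    using that trace_region_subset[OF \<tau>] by (auto simp: F_def)
  hence F: "is_n_point_function (\<lambda>i. evec (\<alpha> i)) \<beta> \<tau> F"
    using hol trace_has_sum[OF sum0 \<tau>] by (simp add: is_n_point_function_def)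
  have "n_point_function (\<lambda>i. evec (\<alpha> i)) \<beta> \<tau> = F"
    unfolding n_point_function_def
  proof (rule the_equality)
    show "is_n_point_function (\<lambda>i. evec (\<alpha> i)) \<beta> \<tau> F \<and> (\<forall>z. z \<notin> config_space \<tau> \<longrightarrow> F z = 0)"
      using F by (simp add: F_def)
    fix G assume G: "is_n_point_function (\<lambda>i. evec (\<alpha> i)) \<beta> \<tau> G \<and> (\<forall>z. z \<notin> config_space \<tau> \<longrightarrow> G z = 0)"
    have "G z = F z" if z: "z \<in> config_space \<tau>" for z
    proof (rule config_space_continuation[OF \<tau> _ hol _ z])
      show "holomorphic_several G (config_space \<tau>)" using G by (simp add: is_n_point_function_def)
      show "G z = F z" if "z \<in> trace_region \<tau>" for z
        using G F that has_sum_unique unfolding is_n_point_function_def by blast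
    qed
    thus "G = F" using G by (auto simp: F_def fun_eq_iff)
  qed
  thus "is_n_point_function (\<lambda>i. evec (\<alpha> i)) \<beta> \<tau> (n_point_function (\<lambda>i. evec (\<alpha> i)) \<beta> \<tau>)"
    and "z \<in> config_space \<tau> \<Longrightarrow> n_point_function (\<lambda>i. evec (\<alpha> i)) \<beta> \<tau> z = n_point_value \<alpha> \<beta> \<tau> z"
    using F by (simp_all add: F_def)
qed

end

theorem proposition3p13:
  fixes B :: "'l::ab_group_add \<Rightarrow> 'l \<Rightarrow> int"
    and \<epsilon> :: "'l \<Rightarrow> 'l \<Rightarrow> int"
    and a :: "complex \<times> 'l"
    and \<alpha> :: "'n::{finite,linorder} \<Rightarrow> 'l"
    and \<beta> :: 'l
    and \<tau> :: complex
  assumes "pos_def_even_lattice_rank_one B"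
    and "lattice_voa.form B a a = 1"
    and "lattice_voa.is_sign_cocycle B \<epsilon>"
    and "(\<Sum>i\<in>UNIV. \<alpha> i) = 0"
    and "Im \<tau> > 0"
  shows "lattice_voa.is_n_point_function B \<epsilon> a (\<lambda>i. evec (\<alpha> i)) \<beta> \<tau>
           (lattice_voa.n_point_function B \<epsilon> a (\<lambda>i. evec (\<alpha> i)) \<beta> \<tau>) \<and>
         (\<forall>z\<in>config_space \<tau>.
           lattice_voa.n_point_function B \<epsilon> a (\<lambda>i. evec (\<alpha> i)) \<beta> \<tau> z =
             exp (2 * of_real pi * \<i> * \<tau> * (of_int (B \<beta> \<beta>) / 2)) / dedekind_eta \<tau> *
             (\<Prod>r\<in>UNIV. exp (of_int (B \<beta> (\<alpha> r)) * z $ r)) *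
             (\<Prod>(i, j)\<in>{(i, j). i < j}.
                of_int (\<epsilon> (\<alpha> i) (\<alpha> j)) * prime_form (z $ i - z $ j) \<tau> powi B (\<alpha> i) (\<alpha> j)))"
proof -
  interpret rank_one_lattice_voa B \<epsilon> a
    using assms(1-3) by unfold_locales
  show ?thesis
    using n_point_function_eq[OF assms(4,5)] by (simp add: n_point_value_def)
qed

end
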